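(* Let $-\frac12<\tau<0$, $\lambda\in\mathbb{C}$, let $\alpha,\rho,\beta,\sigma\in\mathbb{C}$ be generic, and put $$(a,b,c,d)=(1+\rho+\sigma,\;1-\rho+\sigma,\;1+\alpha+\rho-\beta-\sigma,\;1-\alpha-\rho-\beta-\sigma),$$ $$\delta(x)=\frac{G_{2\tau}\bigl(-1+\frac1{2\tau}+a-x\bigr)G_{2\tau}\bigl(-1+\frac1{2\tau}+b-x\bigr)}{G_{2\tau}\bigl(1+\frac1{2\tau}-c-x\bigr)G_{2\tau}\bigl(1+\frac1{2\tau}-d-x\bigr)}.$$ Then the meromorphic function $H_\lambda(x)=\delta(x)^{-1}\psi_\lambda(x)$ satisfies the Askey-Wilson second order difference equation $$A(x)\bigl(H_\lambda(x+2)-H_\lambda(x)\bigr)+A(-x)\bigl(H_\lambda(x-2)-H_\lambda(x)\bigr)=E(\lambda)H_\lambda(x),$$ where $$A(x)=\frac{(1-q^{a+x})(1-q^{b+x})(1-q^{c+x})(1-q^{d+x})}{(1-q^{2x})(1-q^{2+2x})},\qquad E(\lambda)=-1-q^{2-2\beta}+q^{1-\beta}(q^{2i\lambda}+q^{-2i\lambda}).$$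
   Context: $q=\exp(2\pi i\tau)$ (so $|q|=1$, $q\neq\pm1$), $q^u=\exp(2\pi i\tau u)$ for $u\in\mathbb{C}$. Hyperbolic gamma function: for $\tau<0$ and $|\mathrm{Re}(z)|<1-\tau^{-1}$ put $\gamma_\tau(z)=\frac1{2i}\int_0^\infty\frac{dy}{y}\Bigl(\frac zy-\frac{\sinh(\tau yz)}{\sinh(y)\sinh(\tau y)}\Bigr)$ and $G_\tau(z)=\exp(i\gamma_\tau(z))$; $G_\tau$ satisfies $G_\tau(z+2)=2\cos(\pi(z+1)\tau/2)G_\tau(z)$ and is extended by this to a meromorphic function on $\mathbb{C}$. $G_{2\tau}$ is this function with $\tau$ replaced by $2\tau$. The function $\psi_\lambda$ is $$\psi_\lambda(x)=\int_{\mathcal{C}_x}\frac{G_{2\tau}\bigl(\frac1{2\tau}+\beta+\sigma-i\lambda+x+z\bigr)G_{2\tau}\bigl(\frac1{2\tau}-1+\sigma-i\lambda-x-z\bigr)}{G_{2\tau}\bigl(-\frac1{2\tau}+\beta+\sigma+i\lambda-x-z\bigr)G_{2\tau}\bigl(-\frac1{2\tau}+1+\sigma+i\lambda+x+z\bigr)}\cdot\frac{G_{2\tau}\bigl(-\frac1{2\tau}-1+\alpha+\rho+i\lambda-z\bigr)G_{2\tau}\bigl(-\frac1{2\tau}+\rho+i\lambda+z\bigr)}{G_{2\tau}\bigl(-\frac1{2\tau}+1+\alpha+\rho-i\lambda+z\bigr)G_{2\tau}\bigl(-\frac1{2\tau}+\rho-i\lambda-z\bigr)}\,dz .$$ Singular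 half lines (containing all singularities in $z$ of the integrand): the four leftward half lines $-1-\beta-\sigma+i\lambda-x+\mathbb{R}_{\le0}$, $-1+\beta+\sigma+i\lambda-x+\mathbb{R}_{\le0}$, $-1+\frac1\tau-\rho-i\lambda+\mathbb{R}_{\le0}$, $-1+\rho-i\lambda+\mathbb{R}_{\le0}$, and the four rightward half lines $-\sigma-i\lambda-x+\mathbb{R}_{\ge0}$, $\sigma-i\lambda-x+\mathbb{R}_{\ge0}$, $-\alpha-\rho+i\lambda+\mathbb{R}_{\ge0}$, $-\frac1\tau+\alpha+\rho+i\lambda+\mathbb{R}_{\ge0}$. A contour $\mathcal{C}$ is a deformation of $i\mathbb{R}$ if it meets each line $\{z\mid\mathrm{Im}(z)=c\}$, $c\in\mathbb{R}$, in exactly one point $z_c(\mathcal{C})$, and $z_c(\mathcal{C})=ic$ for $|c|$ large. It is oriented from $-i\infty$ to $i\infty$. $\mathcal{C}_x$ is any deformation of $i\mathbb{R}$ separating the four leftward from the four rightward singular half lines. Parameters are generic if, for generic $x$ (i.e. for all $x$ with $\mathrm{Im}(x)$ outside a finite set), the eight singular half lines lie on eight different horizontal lines; for such $x$ the contour exists and the absolutely convergent integral does not depend on its choice. $\psi_\lambda$ is defined by the integral for such $x$ and is regarded as a meromorphic function of $x\in\mathbb{C}$ by continuation; the difference equation in the claim is an identity of meromorphic functions (equivalently it holds at all such $x$ at which the coefficients $A(\pm x)$ are defined and $\delta^{-1}$ is regular at $x$, $x\pm2$). *)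

theory Defs
  imports "HOL-Complex_Analysis.Complex_Analysis"
begin

definition qpow :: "real \<Rightarrow> complex \<Rightarrow> complex" where
  "qpow \<tau> u = exp (2 * of_real pi * \<i> * of_real \<tau> * u)"

definition hyp_gamma :: "real \<Rightarrow> complex \<Rightarrow> complex" where
  "hyp_gamma \<tau> z = 1 / (2 * \<i>) *
     (LBINT y:{0<..}. 1 / of_real y *
        (z / of_real y
          - sinh (of_real (\<tau> * y) * z) / (of_real (sinh y) * of_real (sinh (\<tau> * y)))))"

text \<open>
  The integral for \<open>hyp_gamma \<tau>\<close> converges for \<open>\<bar>Re z\<bar> < 1 - 1 / \<tau>\<close>. The extension by
  \<open>G (z + 2) = 2 * cos (pi * (z + 1) * \<tau> / 2) * G z\<close> is written out explicitly: \<open>z\<close> is shifted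
  by a multiple of 2 to a point \<open>w\<close> with \<open>\<bar>Re w\<bar> \<le> 1\<close>, which is inside the strip of
  convergence as \<open>\<tau> < 0\<close>, and the factors are collected on the way back (at most one of the two
  products is non-empty). The only division by zero occurs at the poles, where the value is 0.
\<close>
definition hyp_G :: "real \<Rightarrow> complex \<Rightarrow> complex" where
  "hyp_G \<tau> z =
     (let n = round (Re z / 2); w = z - 2 * of_int n
      in exp (\<i> * hyp_gamma \<tau> w)
         * (\<Prod>k<nat n. 2 * cos (of_real pi * (w + 2 * of_nat k + 1) * of_real \<tau> / 2))
         / (\<Prod>k<nat (- n). 2 * cos (of_real pi * (w - 2 * of_nat k - 1) * of_real \<tau> / 2)))"

definition psi_integrand ::
  "real \<Rightarrow> complex \<Rightarrow> complex \<Rightarrow> complex \<Rightarrow> complex \<Rightarrow> complex \<Rightarrow> complex \<Rightarrow> complex \<Rightarrow> complex" where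
  "psi_integrand \<tau> lam \<alpha> \<rho> \<beta> \<sigma> x z =
     (let G = hyp_G (2 * \<tau>); h = 1 / (2 * of_real \<tau>) in
       (G (h + \<beta> + \<sigma> - \<i> * lam + x + z) * G (h - 1 + \<sigma> - \<i> * lam - x - z))
       / (G (- h + \<beta> + \<sigma> + \<i> * lam - x - z) * G (- h + 1 + \<sigma> + \<i> * lam + x + z))
       * ((G (- h - 1 + \<alpha> + \<rho> + \<i> * lam - z) * G (- h + \<rho> + \<i> * lam + z))
       / (G (- h + 1 + \<alpha> + \<rho> - \<i> * lam + z) * G (- h + \<rho> - \<i> * lam - z))))"

text \<open>End points of the singular half lines.\<close>

definition left_ends ::
  "real \<Rightarrow> complex \<Rightarrow> complex \<Rightarrow> complex \<Rightarrow> complex \<Rightarrow> complex \<Rightarrow> complex \<Rightarrow> complex list" where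
  "left_ends \<tau> lam \<alpha> \<rho> \<beta> \<sigma> x =
     [- 1 - \<beta> - \<sigma> + \<i> * lam - x,
      - 1 + \<beta> + \<sigma> + \<i> * lam - x,
      - 1 + 1 / of_real \<tau> - \<rho> - \<i> * lam,
      - 1 + \<rho> - \<i> * lam]"

definition right_ends ::
  "real \<Rightarrow> complex \<Rightarrow> complex \<Rightarrow> complex \<Rightarrow> complex \<Rightarrow> complex \<Rightarrow> complex \<Rightarrow> complex list" where
  "right_ends \<tau> lam \<alpha> \<rho> \<beta> \<sigma> x =
     [- \<sigma> - \<i> * lam - x,
      \<sigma> - \<i> * lam - x,
      - \<alpha> - \<rho> + \<i> * lam,
      - 1 / of_real \<tau> + \<alpha> + \<rho> + \<i> * lam]"

definition left_half_line :: "complex \<Rightarrow> complex set" where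
  "left_half_line p = {p + of_real t | t. t \<le> 0}"

definition right_half_line :: "complex \<Rightarrow> complex set" where
  "right_half_line p = {p + of_real t | t. t \<ge> 0}"

definition generic_arg ::
  "real \<Rightarrow> complex \<Rightarrow> complex \<Rightarrow> complex \<Rightarrow> complex \<Rightarrow> complex \<Rightarrow> complex \<Rightarrow> bool" where
  "generic_arg \<tau> lam \<alpha> \<rho> \<beta> \<sigma> x \<longleftrightarrow>
     distinct (map Im (left_ends \<tau> lam \<alpha> \<rho> \<beta> \<sigma> x @ right_ends \<tau> lam \<alpha> \<rho> \<beta> \<sigma> x))"

definition generic_params ::
  "real \<Rightarrow> complex \<Rightarrow> complex \<Rightarrow> complex \<Rightarrow> complex \<Rightarrow> complex \<Rightarrow> bool" where
  "generic_params \<tau> lam \<alpha> \<rho> \<beta> \<sigma> \<longleftrightarrow>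
     (\<exists>S. finite S \<and> (\<forall>x. Im x \<notin> S \<longrightarrow> generic_arg \<tau> lam \<alpha> \<rho> \<beta> \<sigma> x))"

text \<open>
  A deformation of the imaginary axis is given by the function \<open>C\<close> mapping a height \<open>c\<close> to the
  unique point of the contour on \<open>{z. Im z = c}\<close>; increasing \<open>c\<close> is the orientation from
  \<open>-\<i>\<infinity>\<close> to \<open>\<i>\<infinity>\<close>. Since \<open>piecewise_C1_differentiable_on\<close> does not bound the derivative near the
  break points, rectifiability has to be required as well.
\<close>
definition imaginary_axis_deformation :: "(real \<Rightarrow> complex) \<Rightarrow> bool" where
  "imaginary_axis_deformation C \<longleftrightarrow>
     (\<forall>c. Im (C c) = c) \<and>
     (\<exists>R. (\<forall>c. \<bar>c\<bar> \<ge> R \<longrightarrow> C c = \<i> * of_real c) \<and>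
          C piecewise_C1_differentiable_on {- R..R} \<and>
          (\<lambda>c. vector_derivative C (at c)) absolutely_integrable_on {- R..R})"

definition separates :: "(real \<Rightarrow> complex) \<Rightarrow> complex set \<Rightarrow> complex set \<Rightarrow> bool" where
  "separates C A B \<longleftrightarrow>
     (\<forall>w\<in>A. Re w < Re (C (Im w))) \<and> (\<forall>w\<in>B. Re (C (Im w)) < Re w)"

definition psi_contour ::
  "real \<Rightarrow> complex \<Rightarrow> complex \<Rightarrow> complex \<Rightarrow> complex \<Rightarrow> complex \<Rightarrow> complex \<Rightarrow> (real \<Rightarrow> complex) \<Rightarrow> bool" where
  "psi_contour \<tau> lam \<alpha> \<rho> \<beta> \<sigma> x C \<longleftrightarrow>
     imaginary_axis_deformation C \<and>
     separates C (\<Union>p\<in>set (left_ends \<tau> lam \<alpha> \<rho> \<beta> \<sigma> x). left_half_line p)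
                 (\<Union>p\<in>set (right_ends \<tau> lam \<alpha> \<rho> \<beta> \<sigma> x). right_half_line p)"

definition has_line_integral ::
  "(complex \<Rightarrow> complex) \<Rightarrow> complex \<Rightarrow> (real \<Rightarrow> complex) \<Rightarrow> bool" where
  "has_line_integral f I C \<longleftrightarrow>
     has_bochner_integral lborel (\<lambda>c. f (C c) * vector_derivative C (at c)) I"

text \<open>
  The meromorphic continuation to the whole plane of the function given by the absolutely
  convergent integral at the generic \<open>x\<close>. Working with \<open>nicely_meromorphic_on\<close> (value 0 at poles,
  continuous elsewhere) makes it unique as a function.
\<close>
definition psi ::
  "real \<Rightarrow> complex \<Rightarrow> complex \<Rightarrow> complex \<Rightarrow> complex \<Rightarrow> complex \<Rightarrow> complex \<Rightarrow> complex" where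
  "psi \<tau> lam \<alpha> \<rho> \<beta> \<sigma> =
     (THE F. F nicely_meromorphic_on UNIV \<and>
        (\<forall>x C. generic_arg \<tau> lam \<alpha> \<rho> \<beta> \<sigma> x \<longrightarrow> psi_contour \<tau> lam \<alpha> \<rho> \<beta> \<sigma> x C \<longrightarrow>
           has_line_integral (psi_integrand \<tau> lam \<alpha> \<rho> \<beta> \<sigma> x) (F x) C))"

definition delta ::
  "real \<Rightarrow> complex \<Rightarrow> complex \<Rightarrow> complex \<Rightarrow> complex \<Rightarrow> complex \<Rightarrow> complex" where
  "delta \<tau> a b c d x =
     (let G = hyp_G (2 * \<tau>); h = 1 / (2 * of_real \<tau>) in
       (G (- 1 + h + a - x) * G (- 1 + h + b - x)) / (G (1 + h - c - x) * G (1 + h - d - x)))"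

definition AW_coeff ::
  "real \<Rightarrow> complex \<Rightarrow> complex \<Rightarrow> complex \<Rightarrow> complex \<Rightarrow> complex \<Rightarrow> complex" where
  "AW_coeff \<tau> a b c d x =
     ((1 - qpow \<tau> (a + x)) * (1 - qpow \<tau> (b + x)) * (1 - qpow \<tau> (c + x)) * (1 - qpow \<tau> (d + x)))
     / ((1 - qpow \<tau> (2 * x)) * (1 - qpow \<tau> (2 + 2 * x)))"

definition AW_eigenvalue :: "real \<Rightarrow> complex \<Rightarrow> complex \<Rightarrow> complex" where
  "AW_eigenvalue \<tau> \<beta> lam =
     - 1 - qpow \<tau> (2 - 2 * \<beta>)
     + qpow \<tau> (1 - \<beta>) * (qpow \<tau> (2 * \<i> * lam) + qpow \<tau> (- 2 * \<i> * lam))"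

end

theory Submission
  imports Defs
begin

text \<open>
  The reflection formula \<open>G (- z) = 1 / G z\<close> turns the integrand into \<open>\<phi> (x + z) * \<theta> z\<close>, where \<open>\<phi>\<close> and \<open>\<theta>\<close> are
  quotients of hyperbolic gamma functions with trigonometric quotients \<open>\<phi> (w + 2) / \<phi> w\<close> and
  \<open>\<theta> (z + 2) / \<theta> z\<close>. A suitable combination of the integrands for \<open>x + 2\<close>, \<open>x\<close> and \<open>x - 2\<close> is a
  difference \<open>K z - K (z + 2)\<close> with \<open>K\<close> decaying exponentially in vertical directions, and \<open>K\<close> has no
  singularities between the contour and its translate by 2 if the contour keeps a distance larger
  than 2 from the half lines. By Cauchy's theorem the combination integrates to 0, which is the
  difference equation after multiplication by \<open>\<delta>\<close>.

  This settles all \<open>x\<close> with \<open>Im x\<close> outside a finite set. The equation extends by the identity theorem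
  once \<open>\<psi>\<close> is known to be meromorphic: cancelling the finitely many poles of \<open>\<phi>\<close> and \<open>\<theta>\<close> in a wide
  strip by polynomials leaves an integral of a rational function in \<open>x\<close> and \<open>z\<close> against a holomorphic
  function, and partial fractions make the pinching poles explicit.

  The analytic input on \<open>G\<close> is its functional equation, which amounts to evaluating
  \<open>\<integral> (1 / y - cosh (a * y) / sinh y) dy / y\<close> over \<open>y > 0\<close> as \<open>ln (2 * cos (pi * a / 2))\<close>, and its growth
  rate in vertical directions, which follows from the real part of the defining integral.
\<close>

subsection \<open>Contour integrals along deformed vertical lines\<close>

text \<open>\<open>psi\<close> is given by a definite description, so no property of it is available
  before a nicely meromorphic function with the prescribed integrals has been constructed; the
  continuation in \<open>x\<close> is part of the proof itself. When a left and a right singular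
  half line share a height, a separating contour may fail to exist, and as \<open>x\<close>
  approaches such a value the contour gets pinched. Genericity of \<open>x\<close> depends on
  \<open>Im x\<close> only, hence it is inherited by \<open>x + 2\<close> and \<open>x - 2\<close>,
  and a single contour can serve all three.

  Decay is a budget. The rates of \<phi> and \<theta> depend on \<open>Im lam\<close> and may be
  negative one by one, but their sum is \<open>pi * (1 - 2 * \<tau>) > 0\<close>. Polynomial factors
  used for cancelling poles cost an arbitrarily small part of it. The two Laurent polynomials in
  \<open>qexp \<tau> (2 * z)\<close> that occur in \<open>K\<close> cost
  \<open>- 4 * pi * \<tau>\<close> together; \<open>K\<close> gains exactly this much from a gamma
  quotient with numerators shifted by 2, and the rate \<open>pi\<close> remains.\<close>

lemma integrable_exp_neg_abs:
  assumes "(\<kappa>::real) > 0"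
  shows "integrable lborel (\<lambda>c::real. exp (- \<kappa> * \<bar>c\<bar>))"
proof -
  have "(\<lambda>c::real. exp (- \<kappa> * c)) absolutely_integrable_on {0..}"
    using integrable_on_exp_minus_to_infinity[OF assms, of 0]
    by (intro nonnegative_absolutely_integrable_1) auto
  hence "set_integrable lborel {0..} (\<lambda>c::real. exp (- \<kappa> * c))"
    unfolding set_integrable_def by (subst (asm) integrable_completion) auto
  hence 1: "integrable lborel (\<lambda>c::real. indicator {0..} c * exp (- \<kappa> * c))"
    by (simp add: set_integrable_def)
  hence 2: "integrable lborel (\<lambda>c::real. indicator {0..} (-c) * exp (- \<kappa> * (-c)))"
    using lborel_integrable_real_affine[OF 1, of "-1" 0] by simp
  show ?thesis
    by (rule Bochner_Integration.integrable_bound[OF Bochner_Integration.integrable_add[OF 1 2]])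
       (auto simp: indicator_def)
qed

text \<open>Contours are also needed off the imaginary axis: vertical lines beyond all poles of one
  side, and the translate by 2 of a given contour. Hence the abscissa \<open>m\<close> is a
  parameter.\<close>

definition vertical_deformation :: "real \<Rightarrow> (real \<Rightarrow> complex) \<Rightarrow> bool" where
  "vertical_deformation m C \<longleftrightarrow>
     (\<forall>c. Im (C c) = c) \<and>
     (\<exists>R. (\<forall>c. \<bar>c\<bar> \<ge> R \<longrightarrow> C c = of_real m + \<i> * of_real c) \<and>
          C piecewise_C1_differentiable_on {- R..R} \<and>
          (\<lambda>c. vector_derivative C (at c)) absolutely_integrable_on {- R..R})"

lemma imaginary_axis_deformation_iff: "imaginary_axis_deformation C \<longleftrightarrow> vertical_deformation 0 C"
  by (simp add: imaginary_axis_deformation_def vertical_deformation_def)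

text \<open>Only large heights are constrained, as the functions in question have poles at bounded
  heights; \<open>B\<close> and \<open>Y\<close> may depend on the strip. A negative
  \<open>\<kappa>\<close> stands for controlled growth.\<close>

definition exp_bound :: "real \<Rightarrow> (complex \<Rightarrow> complex) \<Rightarrow> bool" where
  "exp_bound \<kappa> f \<longleftrightarrow> (\<forall>K. \<exists>B Y. \<forall>w. \<bar>Re w\<bar> \<le> K \<longrightarrow> \<bar>Im w\<bar> \<ge> Y \<longrightarrow> norm (f w) \<le> B * exp (- \<kappa> * \<bar>Im w\<bar>))"

lemma exp_boundE:
  assumes "exp_bound \<kappa> f"
  obtains B Y where "B > 0" "Y > 0"
    "\<And>w. \<bar>Re w\<bar> \<le> K \<Longrightarrow> \<bar>Im w\<bar> \<ge> Y \<Longrightarrow> norm (f w) \<le> B * exp (- \<kappa> * \<bar>Im w\<bar>)"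
proof -
  obtain B Y where BY: "\<forall>w. \<bar>Re w\<bar> \<le> K \<longrightarrow> \<bar>Im w\<bar> \<ge> Y \<longrightarrow> norm (f w) \<le> B * exp (- \<kappa> * \<bar>Im w\<bar>)"
    using assms unfolding exp_bound_def by blast
  show ?thesis
  proof (rule that[of "max B 1" "max Y 1"])
    fix w assume w: "\<bar>Re w\<bar> \<le> K" "\<bar>Im w\<bar> \<ge> max Y 1"
    hence "norm (f w) \<le> B * exp (- \<kappa> * \<bar>Im w\<bar>)" using BY by auto
    also have "\<dots> \<le> max B 1 * exp (- \<kappa> * \<bar>Im w\<bar>)" by (intro mult_right_mono) auto
    finally show "norm (f w) \<le> max B 1 * exp (- \<kappa> * \<bar>Im w\<bar>)" .
  qed auto
qed

lemma vertical_deformation_facts: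
  assumes "vertical_deformation m C"
  obtains R S where "R > 0" "finite S" "continuous_on UNIV C"
    "\<And>c. \<bar>c\<bar> \<ge> R \<Longrightarrow> C c = of_real m + \<i> * of_real c"
    "\<And>c. c \<notin> S \<Longrightarrow> (C has_vector_derivative vector_derivative C (at c)) (at c)"
    "continuous_on (- S) (\<lambda>c. vector_derivative C (at c))"
    "\<And>c. \<bar>c\<bar> > R \<Longrightarrow> vector_derivative C (at c) = \<i>"
    "set_integrable lborel {-R..R} (\<lambda>c. vector_derivative C (at c))"
proof -
  obtain R0 where R0: "\<And>c. \<bar>c\<bar> \<ge> R0 \<Longrightarrow> C c = of_real m + \<i> * of_real c"
    "C piecewise_C1_differentiable_on {- R0..R0}"
    "(\<lambda>c. vector_derivative C (at c)) absolutely_integrable_on {- R0..R0}"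
    using assms unfolding vertical_deformation_def by blast
  \<comment> \<open>\<open>R0\<close> may be zero or negative, in which case the contour is a
    straight line; a positive radius is wanted below.\<close>
  define R where "R = max R0 1"
  obtain S0 where S0: "continuous_on {-R0..R0} C" "finite S0" "C C1_differentiable_on ({-R0..R0} - S0)"
    using R0(2) unfolding piecewise_C1_differentiable_on_def by blast
  obtain D where D: "\<And>c. c \<in> {-R0..R0} - S0 \<Longrightarrow> (C has_vector_derivative D c) (at c)"
     "continuous_on ({-R0..R0} - S0) D"
    using S0(3) unfolding C1_differentiable_on_def by blast
  \<comment> \<open>The points where the curved part meets the straight part count as exceptional,
    so that the complement of \<open>S\<close> is a union of two open sets.\<close>
  define S where "S = S0 \<union> {-R0, R0}"
  define U1 where "U1 = {-R0<..<R0} - S"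
  define U2 where "U2 = {c. \<bar>c\<bar> > R0} - S"
  have fS: "finite S" using S0 by (auto simp: S_def)
  have op: "open U1" "open U2"
    unfolding U1_def U2_def using fS
    by (auto intro!: open_Diff finite_imp_closed open_Collect_less continuous_intros)
  have un: "- S = U1 \<union> U2" by (auto simp: U1_def U2_def S_def)
  have d1: "(C has_vector_derivative D c) (at c)" if "c \<in> U1" for c
    using that D(1)[of c] by (auto simp: U1_def S_def)
  have d2: "(C has_vector_derivative \<i>) (at c)" if "\<bar>c\<bar> > R0" for c
  proof -
    have "((\<lambda>c. of_real m + \<i> * of_real c) has_vector_derivative \<i>) (at c)"
      by (auto intro!: derivative_eq_intros)
    have "eventually (\<lambda>x. x \<in> {c. \<bar>c\<bar> > R0}) (nhds c)"
      using that by (intro eventually_nhds_in_open open_Collect_less continuous_intros) auto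
    hence ev: "eventually (\<lambda>x. x \<in> UNIV \<longrightarrow> C x = of_real m + \<i> * of_real x) (nhds c)"
      by eventually_elim (use R0(1) in auto)
    have eq: "C c = of_real m + \<i> * of_real c" using that R0(1)[of c] by simp
    show ?thesis
      unfolding has_vector_derivative_cong_ev[OF ev eq] by fact
  qed
  have vd1: "vector_derivative C (at c) = D c" if "c \<in> U1" for c
    using d1[OF that] by (rule vector_derivative_at)
  have vd2: "vector_derivative C (at c) = \<i>" if "\<bar>c\<bar> > R0" for c
    using d2[OF that] by (rule vector_derivative_at)
  have c1: "continuous_on U1 (\<lambda>c. vector_derivative C (at c))"
    by (subst continuous_on_cong[OF refl vd1], assumption)
       (rule continuous_on_subset[OF D(2)], auto simp: U1_def S_def)
  have c2: "continuous_on U2 (\<lambda>c. vector_derivative C (at c))"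
    by (subst continuous_on_cong[OF refl vd2]) (auto simp: U2_def)
  have c12: "continuous_on (- S) (\<lambda>c. vector_derivative C (at c))"
    unfolding un by (rule continuous_on_open_Un) (use op c1 c2 in auto)
  have meas: "(\<lambda>c. vector_derivative C (at c)) \<in> borel_measurable borel"
    by (rule borel_measurable_continuous_countable_exceptions[OF _ c12]) (use fS in \<open>auto intro: countable_finite\<close>)
  have cont: "continuous_on UNIV C"
  proof -
    have "continuous_on ({-R0..R0} \<union> {c. \<bar>c\<bar> \<ge> R0}) C"
    proof (rule continuous_on_closed_Un)
      show "closed {c::real. \<bar>c\<bar> \<ge> R0}" by (intro closed_Collect_le continuous_intros)
      show "continuous_on {c. R0 \<le> \<bar>c\<bar>} C"
        by (subst continuous_on_cong[OF refl R0(1)]) (auto intro!: continuous_intros)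
    qed (use S0 in auto)
    moreover have "{-R0..R0} \<union> {c. \<bar>c\<bar> \<ge> R0} = UNIV" by auto
    ultimately show ?thesis by simp
  qed
  have si: "set_integrable lborel {-R..R} (\<lambda>c. vector_derivative C (at c))"
  proof -
    have 1: "set_integrable lborel {-R0..R0} (\<lambda>c. vector_derivative C (at c))"
      using R0(3) meas unfolding set_integrable_def by (subst (asm) integrable_completion) auto
    have "integrable lborel (\<lambda>c. norm (indicator {-R0..R0} c *\<^sub>R vector_derivative C (at c)) + indicator {-R..R} c)"
      using 1 unfolding set_integrable_def
      by (intro Bochner_Integration.integrable_add integrable_norm integrable_real_indicator)
         (auto simp: emeasure_lborel_Icc_eq)
    thus ?thesis unfolding set_integrable_def
    proof (rule Bochner_Integration.integrable_bound)
      show "AE x in lborel. norm (indicat_real {- R..R} x *\<^sub>R vector_derivative C (at x))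
         \<le> norm (norm (indicat_real {- R0..R0} x *\<^sub>R vector_derivative C (at x)) + indicat_real {- R..R} x)"
      proof (rule AE_I2)
        fix x show "norm (indicat_real {- R..R} x *\<^sub>R vector_derivative C (at x))
         \<le> norm (norm (indicat_real {- R0..R0} x *\<^sub>R vector_derivative C (at x)) + indicat_real {- R..R} x)"
          using vd2[of x] by (cases "\<bar>x\<bar> > R0") (auto simp: indicator_def)
      qed
    qed (use meas in measurable)
  qed
  show ?thesis
  proof (rule that[of R S])
    show "(C has_vector_derivative vector_derivative C (at c)) (at c)" if "c \<notin> S" for c
    proof (cases "c \<in> U1")
      case True
      thus ?thesis using d1 vd1 by simp
    next
      case False
      hence "\<bar>c\<bar> > R0" using that un by (auto simp: U2_def)
      thus ?thesis using d2 vd2 by simp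
    qed
  qed (use fS cont R0(1) c12 vd2 si in \<open>auto simp: R_def\<close>)
qed

lemma vertical_deformation_Im [simp]: "vertical_deformation m C \<Longrightarrow> Im (C c) = c"
  by (simp add: vertical_deformation_def)

lemma vertical_deformation_bounded:
  assumes "vertical_deformation m C"
  obtains K where "K > 0" "\<And>c. \<bar>Re (C c)\<bar> \<le> K"
proof -
  obtain R S where RS: "R > 0" "finite S" "continuous_on UNIV C"
    "\<And>c. \<bar>c\<bar> \<ge> R \<Longrightarrow> C c = of_real m + \<i> * of_real c"
    "\<And>c. c \<notin> S \<Longrightarrow> (C has_vector_derivative vector_derivative C (at c)) (at c)"
    "continuous_on (- S) (\<lambda>c. vector_derivative C (at c))"
    "\<And>c. \<bar>c\<bar> > R \<Longrightarrow> vector_derivative C (at c) = \<i>"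
    "set_integrable lborel {-R..R} (\<lambda>c. vector_derivative C (at c))"
    by (rule vertical_deformation_facts[OF assms], rule that)
  note R = RS(1,3,4)
  have "compact ((\<lambda>c. Re (C c)) ` {-R..R})"
    by (intro compact_continuous_image continuous_intros continuous_on_subset[OF R(2)]) auto
  from compact_imp_bounded[OF this] obtain B where "\<forall>w\<in>(\<lambda>c. Re (C c)) ` {-R..R}. norm w \<le> B"
    unfolding bounded_iff by blast
  hence B: "\<And>c. c \<in> {-R..R} \<Longrightarrow> \<bar>Re (C c)\<bar> \<le> B" by auto
  show ?thesis
  proof (rule that[of "max 1 (max B \<bar>m\<bar>)"])
    fix c show "\<bar>Re (C c)\<bar> \<le> max 1 (max B \<bar>m\<bar>)"
    proof (cases "\<bar>c\<bar> \<ge> R")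
      case False
      hence "\<bar>Re (C c)\<bar> \<le> B" by (intro B) auto
      thus ?thesis by simp
    qed (simp add: R(3))
  qed auto
qed

lemma integrable_line:
  assumes C: "vertical_deformation m C" and f: "continuous_on \<Omega> f" "\<And>c. C c \<in> \<Omega>"
    and ex: "exp_bound \<kappa> f" and \<kappa>: "\<kappa> > 0"
  shows "integrable lborel (\<lambda>c. f (C c) * vector_derivative C (at c))"
proof -
  obtain R S where RS0: "R > 0" "finite S" "continuous_on UNIV C"
    "\<And>c. \<bar>c\<bar> \<ge> R \<Longrightarrow> C c = of_real m + \<i> * of_real c"
    "\<And>c. c \<notin> S \<Longrightarrow> (C has_vector_derivative vector_derivative C (at c)) (at c)"
    "continuous_on (- S) (\<lambda>c. vector_derivative C (at c))"
    "\<And>c. \<bar>c\<bar> > R \<Longrightarrow> vector_derivative C (at c) = \<i>"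
    "set_integrable lborel {-R..R} (\<lambda>c. vector_derivative C (at c))"
    by (rule vertical_deformation_facts[OF C], rule that)
  note RS = RS0(1-4,6-8)
  obtain K where "K > 0" and K: "\<And>c. \<bar>Re (C c)\<bar> \<le> K" by (rule vertical_deformation_bounded[OF C], rule that)
  obtain B Y where BY: "B > 0" "Y > 0"
    "\<And>w. \<bar>Re w\<bar> \<le> K \<Longrightarrow> \<bar>Im w\<bar> \<ge> Y \<Longrightarrow> norm (f w) \<le> B * exp (- \<kappa> * \<bar>Im w\<bar>)"
    by (rule exp_boundE[OF ex, of K], rule that)
  have cf: "continuous_on UNIV (\<lambda>c. f (C c))"
    by (rule continuous_on_compose2[OF f(1) RS(3)]) (use f(2) in auto)
  define R1 where "R1 = max R Y"
  have "compact ((\<lambda>c. f (C c)) ` {-R1..R1})"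
    by (intro compact_continuous_image continuous_on_subset[OF cf]) auto
  from compact_imp_bounded[OF this] obtain A where "\<forall>w\<in>(\<lambda>c. f (C c)) ` {-R1..R1}. norm w \<le> A"
    unfolding bounded_iff by blast
  hence A: "\<And>c. c \<in> {-R1..R1} \<Longrightarrow> norm (f (C c)) \<le> A" by blast
  have "0 \<le> norm (f (C 0))" by simp
  also have "\<dots> \<le> A" by (rule A) (use RS(1) BY(2) in \<open>auto simp: R1_def\<close>)
  finally have A0: "A \<ge> 0" .
  have meas: "(\<lambda>c. vector_derivative C (at c)) \<in> borel_measurable borel"
    by (rule borel_measurable_continuous_countable_exceptions[OF _ RS(5)]) (use RS(2) in \<open>auto intro: countable_finite\<close>)
  have mf: "(\<lambda>c. f (C c)) \<in> borel_measurable borel"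
    by (rule borel_measurable_continuous_onI[OF cf])
  \<comment> \<open>The majorant covers three ranges: up to \<open>R\<close> the function is bounded
    by \<open>A\<close>; between \<open>R\<close> and \<open>R1\<close> the derivative has norm 1
    and \<open>exp (\<kappa> * R1)\<close> turns the constant \<open>A\<close> into a multiple of
    the exponential; beyond \<open>R1\<close> the assumed decay applies.\<close>
  have "integrable lborel (\<lambda>c. A * norm (indicator {-R..R} c *\<^sub>R vector_derivative C (at c))
          + (A * exp (\<kappa> * R1) + B) * exp (- \<kappa> * \<bar>c\<bar>))"
    using RS(7) integrable_exp_neg_abs[OF \<kappa>] unfolding set_integrable_def
    by (intro Bochner_Integration.integrable_add integrable_mult_right integrable_norm) auto
  thus ?thesis
  proof (rule Bochner_Integration.integrable_bound)
    show "(\<lambda>c. f (C c) * vector_derivative C (at c)) \<in> borel_measurable lborel"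
      using meas mf by measurable
    show "AE c in lborel. norm (f (C c) * vector_derivative C (at c)) \<le>
      norm (A * norm (indicator {-R..R} c *\<^sub>R vector_derivative C (at c)) + (A * exp (\<kappa> * R1) + B) * exp (- \<kappa> * \<bar>c\<bar>))"
    proof (rule AE_I2)
      fix c
      have nn: "0 \<le> A * norm (indicat_real {-R..R} c *\<^sub>R vector_derivative C (at c))"
        "0 \<le> A * exp (\<kappa> * R1) * exp (- \<kappa> * \<bar>c\<bar>)" "0 \<le> B * exp (- \<kappa> * \<bar>c\<bar>)"
        using A0 BY by auto
      have "norm (f (C c) * vector_derivative C (at c)) \<le>
        A * norm (indicator {-R..R} c *\<^sub>R vector_derivative C (at c)) + (A * exp (\<kappa> * R1) + B) * exp (- \<kappa> * \<bar>c\<bar>)"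
      proof -
        consider "\<bar>c\<bar> \<le> R" | "\<bar>c\<bar> > R" "\<bar>c\<bar> \<le> R1" | "\<bar>c\<bar> > R1" by linarith
        thus ?thesis
        proof cases
          case 1
          hence "norm (f (C c) * vector_derivative C (at c)) \<le> A * norm (vector_derivative C (at c))"
            unfolding norm_mult by (intro mult_right_mono A) (auto simp: R1_def)
          moreover have "indicat_real {-R..R} c = 1" using 1 by (auto simp: indicator_def abs_le_iff)
          ultimately show ?thesis using nn by (simp add: ring_distribs)
        next
          case 2
          have "norm (f (C c) * vector_derivative C (at c)) \<le> A * 1"
            unfolding norm_mult using A[of c] RS(6)[of c] 2 A0 by (intro mult_mono) (auto simp: abs_le_iff)
          also have "\<dots> \<le> A * (exp (\<kappa> * R1) * exp (- \<kappa> * \<bar>c\<bar>))"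
            using 2 A0 \<kappa> by (intro mult_left_mono) (auto simp flip: exp_add intro!: mult_nonneg_nonneg simp: ring_distribs mult_left_mono)
          finally show ?thesis using nn by (simp add: ring_distribs)
        next
          case 3
          hence "norm (f (C c) * vector_derivative C (at c)) \<le> B * exp (- \<kappa> * \<bar>c\<bar>)"
            unfolding norm_mult using BY(3)[of "C c"] K[of c] RS(6)[of c] C
            by (auto simp: R1_def)
          thus ?thesis using nn by (simp add: ring_distribs)
        qed
      qed
      thus "norm (f (C c) * vector_derivative C (at c)) \<le>
         norm (A * norm (indicator {-R..R} c *\<^sub>R vector_derivative C (at c)) + (A * exp (\<kappa> * R1) + B) * exp (- \<kappa> * \<bar>c\<bar>))"
        by simp
    qed
  qed
qed

text \<open>Sliding horizontally onto the curve and then along the curve to \<open>C 0\<close>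
  contracts \<open>\<Omega>\<close> to a point. Hence \<open>\<Omega>\<close> is simply connected
  and holomorphic functions on it have global primitives.\<close>

lemma graph_domain_primitive:
  fixes C :: "real \<Rightarrow> complex"
  assumes \<Omega>: "open \<Omega>" and C: "continuous_on UNIV C" "\<And>c. Im (C c) = c" "\<And>c. C c \<in> \<Omega>"
    and seg: "\<And>z. z \<in> \<Omega> \<Longrightarrow> closed_segment z (C (Im z)) \<subseteq> \<Omega>"
    and f: "f holomorphic_on \<Omega>"
  obtains P where "\<And>z. z \<in> \<Omega> \<Longrightarrow> (P has_field_derivative f z) (at z)"
proof -
  have cI: "continuous_on A (\<lambda>z. C (Im z))" for A
    by (rule continuous_on_compose2[OF C(1)]) (auto intro!: continuous_intros)
  have "homotopic_with_canon (\<lambda>x. True) \<Omega> \<Omega> (\<lambda>z. z) (\<lambda>z. C (Im z))"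
    by (rule homotopic_with_linear) (use seg cI in \<open>auto intro!: continuous_intros\<close>)
  moreover have "homotopic_with_canon (\<lambda>x. True) \<Omega> \<Omega> (\<lambda>z. C (Im z)) (\<lambda>z. C 0)"
    unfolding homotopic_with_def
  proof (intro exI[of _ "\<lambda>y. C ((1 - fst y) * Im (snd y))"] conjI allI ballI)
    have "continuous_on ({0..1} \<times> \<Omega>) (\<lambda>y. C ((1 - fst y) * Im (snd y)))"
      by (rule continuous_on_compose2[OF C(1)]) (auto intro!: continuous_intros)
    thus "continuous_map (prod_topology (top_of_set {0..1}) (top_of_set \<Omega>)) (top_of_set \<Omega>)
       (\<lambda>y. C ((1 - fst y) * Im (snd y)))"
      using C(3) by (auto simp: continuous_map_in_subtopology subtopology_Times[symmetric] euclidean_product_topology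
          simp flip: subtopology_Times)
  qed auto
  ultimately have "homotopic_with_canon (\<lambda>x. True) \<Omega> \<Omega> id (\<lambda>z. C 0)"
    unfolding id_def by (rule homotopic_with_trans)
  hence "contractible \<Omega>" unfolding contractible_def by blast
  hence "simply_connected \<Omega>" by (rule contractible_imp_simply_connected)
  thus ?thesis using f that simply_connected_eq_global_primitive[OF \<Omega>] by metis
qed

text \<open>Planes cut along horizontal half lines are not convex, but each of their horizontal
  slices is. This is what the contraction onto a contour needs.\<close>

definition horizontally_convex :: "complex set \<Rightarrow> bool" where
  "horizontally_convex \<Omega> \<longleftrightarrow> (\<forall>z\<in>\<Omega>. \<forall>w\<in>\<Omega>. Im z = Im w \<longrightarrow> closed_segment z w \<subseteq> \<Omega>)"

lemma has_line_integral_exists: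
  assumes "vertical_deformation m C" "f holomorphic_on \<Omega>" "\<And>c. C c \<in> \<Omega>" "exp_bound \<kappa> f" "\<kappa> > 0"
  obtains I where "has_line_integral f I C"
proof (rule that)
  show "has_line_integral f (integral\<^sup>L lborel (\<lambda>c. f (C c) * vector_derivative C (at c))) C"
    unfolding has_line_integral_def
    by (intro has_bochner_integral_integrable
        integrable_line[OF assms(1) holomorphic_on_imp_continuous_on[OF assms(2)] assms(3-5)])
qed

text \<open>Integrability allows symmetric truncation by dominated convergence, and on each
  truncated piece the fundamental theorem applies, finitely many corners being harmless because
  \<open>P\<close> composed with \<open>C\<close> is continuous.\<close>

lemma has_line_integral_limit:
  assumes C: "vertical_deformation m C" and P: "\<And>c. (P has_field_derivative f (C c)) (at (C c))"
    and I: "has_line_integral f I C"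
  shows "(\<lambda>n. P (C (real n)) - P (C (- real n))) \<longlonglongrightarrow> I"
proof -
  let ?F = "\<lambda>c. f (C c) * vector_derivative C (at c)"
  obtain R S where RS: "R > 0" "finite S" "continuous_on UNIV C"
    "\<And>c. \<bar>c\<bar> \<ge> R \<Longrightarrow> C c = of_real m + \<i> * of_real c"
    "\<And>c. c \<notin> S \<Longrightarrow> (C has_vector_derivative vector_derivative C (at c)) (at c)"
    "continuous_on (- S) (\<lambda>c. vector_derivative C (at c))"
    "\<And>c. \<bar>c\<bar> > R \<Longrightarrow> vector_derivative C (at c) = \<i>"
    "set_integrable lborel {-R..R} (\<lambda>c. vector_derivative C (at c))"
    by (rule vertical_deformation_facts[OF C], rule that)
  have int: "integrable lborel ?F" and I_eq: "integral\<^sup>L lborel ?F = I"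
    using I unfolding has_line_integral_def has_bochner_integral_iff by auto
  have "(\<lambda>n. integral\<^sup>L lborel (\<lambda>c. indicator {-real n..real n} c *\<^sub>R ?F c)) \<longlonglongrightarrow> integral\<^sup>L lborel ?F"
  proof (rule integral_dominated_convergence[where w = "\<lambda>c. norm (?F c)"])
    show "AE c in lborel. (\<lambda>n. indicator {-real n..real n} c *\<^sub>R ?F c) \<longlonglongrightarrow> ?F c"
    proof (rule AE_I2)
      fix c :: real
      obtain N :: nat where N: "\<bar>c\<bar> \<le> real N" using real_arch_simple by blast
      have "eventually (\<lambda>n. indicator {-real n..real n} c *\<^sub>R ?F c = ?F c) sequentially"
        using eventually_ge_at_top[of N] by eventually_elim (use N in \<open>auto simp: indicator_def\<close>)
      thus "(\<lambda>n. indicator {-real n..real n} c *\<^sub>R ?F c) \<longlonglongrightarrow> ?F c"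
        by (rule tendsto_eventually)
    qed
    show "AE c in lborel. norm (indicator {-real n..real n} c *\<^sub>R ?F c) \<le> norm (?F c)" for n
      by (auto simp: indicator_def)
  qed (use int in auto)
  moreover have "integral\<^sup>L lborel (\<lambda>c. indicator {-real n..real n} c *\<^sub>R ?F c) = P (C (real n)) - P (C (- real n))" for n
  proof -
    have si: "set_integrable lborel {-real n..real n} ?F"
      unfolding set_integrable_def by (rule integrable_mult_indicator) (use int in auto)
    have "(?F has_integral ((P \<circ> C) (real n) - (P \<circ> C) (- real n))) {-real n..real n}"
    proof (rule fundamental_theorem_of_calculus_strong[OF RS(2)])
      fix c assume "c \<in> {-real n..real n} - S"
      hence "(C has_vector_derivative vector_derivative C (at c)) (at c)" using RS(5) by auto
      from field_vector_diff_chain_at[OF this P[of c]]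
      show "(P \<circ> C has_vector_derivative f (C c) * vector_derivative C (at c)) (at c)"
        by (simp add: mult.commute)
    next
      have "continuous_on (range C) P"
        by (rule continuous_at_imp_continuous_on) (use P DERIV_isCont in blast)
      thus "continuous_on {- real n..real n} (P \<circ> C)"
        by (intro continuous_on_compose continuous_on_subset[OF RS(3)]) (auto elim: continuous_on_subset)
    qed auto
    hence "integral {-real n..real n} ?F = P (C (real n)) - P (C (- real n))"
      by (simp add: integral_unique)
    thus ?thesis
      using set_borel_integral_eq_integral(2)[OF si] by (simp only: set_lebesgue_integral_def)
  qed
  ultimately show ?thesis by (simp add: I_eq)
qed

text \<open>Both integrals are limits of differences of one primitive. At height \<open>c\<close>
  the two contours are joined by a horizontal segment of length at most \<open>2 * K\<close> inside
  \<open>\<Omega>\<close>, on which \<open>f\<close> is exponentially small, so the limits coincide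
  even if the abscissae \<open>m1\<close> and \<open>m2\<close> differ.\<close>

lemma has_line_integral_deform:
  assumes \<Omega>: "open \<Omega>" "horizontally_convex \<Omega>" and f: "f holomorphic_on \<Omega>" "exp_bound \<kappa> f" "\<kappa> > 0"
    and C1: "vertical_deformation m1 C1" "\<And>c. C1 c \<in> \<Omega>" and C2: "vertical_deformation m2 C2" "\<And>c. C2 c \<in> \<Omega>"
    and I: "has_line_integral f I C1"
  shows "has_line_integral f I C2"
proof -
  obtain I2 where I2: "has_line_integral f I2 C2" using has_line_integral_exists[OF C2(1) f(1) C2(2) f(2,3)] .
  have "continuous_on UNIV C1" by (rule vertical_deformation_facts[OF C1(1)])
  moreover have "closed_segment z (C1 (Im z)) \<subseteq> \<Omega>" if "z \<in> \<Omega>" for z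
    using \<Omega>(2) that C1 unfolding horizontally_convex_def by auto
  ultimately obtain P where P: "\<And>z. z \<in> \<Omega> \<Longrightarrow> (P has_field_derivative f z) (at z)"
    using graph_domain_primitive[OF \<Omega>(1), of C1 f] C1 f(1) by auto
  have L1: "(\<lambda>n. P (C1 (real n)) - P (C1 (- real n))) \<longlonglongrightarrow> I"
    by (rule has_line_integral_limit[OF C1(1) P[OF C1(2)] I])
  have L2: "(\<lambda>n. P (C2 (real n)) - P (C2 (- real n))) \<longlonglongrightarrow> I2"
    by (rule has_line_integral_limit[OF C2(1) P[OF C2(2)] I2])
  obtain K1 where K1: "K1 > 0" "\<And>c. \<bar>Re (C1 c)\<bar> \<le> K1"
    by (rule vertical_deformation_bounded[OF C1(1)], rule that)
  obtain K2 where K2: "K2 > 0" "\<And>c. \<bar>Re (C2 c)\<bar> \<le> K2"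
    by (rule vertical_deformation_bounded[OF C2(1)], rule that)
  define K where "K = max K1 K2"
  obtain B Y where BY: "B > 0" "Y > 0"
    "\<And>w. \<bar>Re w\<bar> \<le> K \<Longrightarrow> \<bar>Im w\<bar> \<ge> Y \<Longrightarrow> norm (f w) \<le> B * exp (- \<kappa> * \<bar>Im w\<bar>)"
    by (rule exp_boundE[OF f(2), of K], rule that)
  have bd: "norm (P (C1 c) - P (C2 c)) \<le> B * exp (- \<kappa> * \<bar>c\<bar>) * (2 * K)" if "\<bar>c\<bar> \<ge> Y" for c
  proof -
    let ?s = "closed_segment (C1 c) (C2 c)"
    have sub: "?s \<subseteq> \<Omega>" using \<Omega>(2) C1 C2 unfolding horizontally_convex_def by auto
    have in_s: "\<bar>Re w\<bar> \<le> K \<and> Im w = c" if w: "w \<in> ?s" for w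
    proof -
      obtain u where u: "0 \<le> u" "u \<le> 1" "w = (1 - u) *\<^sub>R C1 c + u *\<^sub>R C2 c"
        using w by (auto simp: closed_segment_def)
      have "\<bar>Re w\<bar> \<le> (1 - u) * \<bar>Re (C1 c)\<bar> + u * \<bar>Re (C2 c)\<bar>"
        using u abs_triangle_ineq[of "(1 - u) * Re (C1 c)" "u * Re (C2 c)"] by (simp add: abs_mult)
      also have "\<dots> \<le> (1 - u) * K + u * K"
        using u K1(2)[of c] K2(2)[of c] by (intro add_mono mult_left_mono) (auto simp: K_def)
      finally have "\<bar>Re w\<bar> \<le> K" by (simp add: algebra_simps)
      moreover have "Im w = (1 - u) * Im (C1 c) + u * Im (C2 c)" unfolding u(3) by simp
      hence "Im w = c" using C1(1) C2(1) by (simp add: algebra_simps)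
      ultimately show ?thesis by simp
    qed
    have "norm (P (C1 c) - P (C2 c)) \<le> B * exp (- \<kappa> * \<bar>c\<bar>) * norm (C1 c - C2 c)"
    proof (rule field_differentiable_bound[of ?s])
      fix z assume z: "z \<in> ?s"
      show "(P has_field_derivative f z) (at z within ?s)"
        using P sub z has_field_derivative_at_within by blast
      show "norm (f z) \<le> B * exp (- \<kappa> * \<bar>c\<bar>)" using BY(3)[of z] in_s[OF z] that by auto
    qed auto
    also have "norm (C1 c - C2 c) \<le> 2 * K"
    proof -
      have "norm (C1 c - C2 c) \<le> \<bar>Re (C1 c - C2 c)\<bar> + \<bar>Im (C1 c - C2 c)\<bar>" by (rule cmod_le)
      thus ?thesis using K1(2)[of c] K2(2)[of c] C1(1) C2(1) by (auto simp: K_def)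
    qed
    finally show ?thesis using BY(1) by (simp add: mult_left_mono)
  qed
  have lim0: "(\<lambda>n. B * exp (- \<kappa> * real n) * (2 * K)) \<longlonglongrightarrow> 0"
  proof -
    have "filterlim (\<lambda>n. \<kappa> * real n) at_top sequentially"
      by (rule filterlim_tendsto_pos_mult_at_top[OF tendsto_const f(3) filterlim_real_sequentially])
    hence "filterlim (\<lambda>n. - \<kappa> * real n) at_bot sequentially"
      by (simp add: filterlim_uminus_at_bot)
    hence "(\<lambda>n. exp (- \<kappa> * real n)) \<longlonglongrightarrow> 0"
      by (rule filterlim_compose[OF exp_at_bot])
    from tendsto_mult_right_zero[OF this, of "B * (2 * K)"] show ?thesis by (simp add: mult_ac)
  qed
  have ev: "eventually (\<lambda>n. real n \<ge> Y) sequentially"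
    using eventually_ge_at_top[of "nat \<lceil>Y\<rceil>"] by eventually_elim linarith
  have ev1: "eventually (\<lambda>n. norm (P (C1 (real n)) - P (C2 (real n))) \<le> B * exp (- \<kappa> * real n) * (2 * K)) sequentially"
    using ev by eventually_elim (rule order_trans[OF bd], auto)
  have ev2: "eventually (\<lambda>n. norm (P (C1 (- real n)) - P (C2 (- real n))) \<le> B * exp (- \<kappa> * real n) * (2 * K)) sequentially"
    using ev by eventually_elim (rule order_trans[OF bd], auto)
  have "(\<lambda>n. P (C1 (real n)) - P (C2 (real n))) \<longlonglongrightarrow> 0"
    by (rule Lim_null_comparison[OF ev1 lim0])
  moreover have "(\<lambda>n. P (C1 (- real n)) - P (C2 (- real n))) \<longlonglongrightarrow> 0"
    by (rule Lim_null_comparison[OF ev2 lim0])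
  ultimately have "(\<lambda>n. (P (C1 (real n)) - P (C2 (real n))) - (P (C1 (- real n)) - P (C2 (- real n)))) \<longlonglongrightarrow> 0"
    using tendsto_diff by fastforce
  moreover have "(\<lambda>n. (P (C1 (real n)) - P (C2 (real n))) - (P (C1 (- real n)) - P (C2 (- real n)))) \<longlonglongrightarrow> I - I2"
    using tendsto_diff[OF L1 L2] by (simp add: algebra_simps)
  ultimately have "I - I2 = 0" using LIMSEQ_unique by blast
  thus ?thesis using I2 by simp
qed

text \<open>Dominated convergence applied to difference quotients, which Cauchy's estimate bounds.\<close>

lemma has_field_derivative_lebesgue_integral:
  fixes F :: "'b \<Rightarrow> complex \<Rightarrow> complex"
  assumes A: "open A" and hol: "\<And>y. y \<in> space M \<Longrightarrow> F y holomorphic_on A"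
    and meas: "\<And>x. x \<in> A \<Longrightarrow> (\<lambda>y. F y x) \<in> borel_measurable M"
    and dom: "\<And>x. x \<in> A \<Longrightarrow> \<exists>e>0. \<exists>g. integrable M g \<and> (\<forall>x'\<in>ball x e \<inter> A. \<forall>y\<in>space M. norm (F y x') \<le> g y)"
    and x: "x \<in> A"
  shows "((\<lambda>x. integral\<^sup>L M (\<lambda>y. F y x)) has_field_derivative integral\<^sup>L M (\<lambda>y. deriv (F y) x)) (at x)"
proof -
    obtain e0 g where e0: "e0 > 0" "integrable M g"
      "\<And>x' y. x' \<in> ball x e0 \<inter> A \<Longrightarrow> y \<in> space M \<Longrightarrow> norm (F y x') \<le> g y"
      using dom[OF x] by blast
    obtain e1 where e1: "e1 > 0" "ball x e1 \<subseteq> A" using A x openE by blast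
    define e where "e = min e0 e1 / 2"
    have e: "e > 0" "cball x e \<subseteq> A" "cball x e \<subseteq> ball x e0"
    proof -
      show "e > 0" using e0 e1 by (simp add: e_def)
      have "e < e0" "e < e1" using e0 e1 by (auto simp: e_def min_def)
      thus "cball x e \<subseteq> A" "cball x e \<subseteq> ball x e0"
        using e1(2) by (auto simp: subset_iff)
    qed
    have bd: "norm (F y x') \<le> g y" if "x' \<in> cball x e" "y \<in> space M" for x' y
      using e0(3)[of x' y] e(2,3) that by blast
    have gint: "integrable M (\<lambda>y. 2 / e * g y)" using e0(2) by simp
    have Fint: "integrable M (\<lambda>y. F y x')" if "x' \<in> cball x e" for x'
      by (rule Bochner_Integration.integrable_bound[OF e0(2) meas])
         (use that e bd in \<open>auto intro!: AE_I2 intro: order_trans[OF _ abs_ge_self]\<close>)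
    \<comment> \<open>Circles of radius \<open>e / 2\<close> around points of the smaller ball stay
      inside \<open>cball x e\<close>, where \<open>g\<close> is a majorant; Cauchy's estimate then
      gives the factor \<open>2 / e\<close>.\<close>
    have db: "norm (deriv (F y) w) \<le> 2 / e * g y" if w: "w \<in> ball x (e/2)" and y: "y \<in> space M" for w y
    proof -
      have sub: "cball w (e/2) \<subseteq> cball x e"
      proof
        fix v assume "v \<in> cball w (e/2)"
        hence "dist x v \<le> dist x w + dist w v" "dist x w < e/2" "dist w v \<le> e/2"
          using w by (auto intro: dist_triangle)
        thus "v \<in> cball x e" by simp
      qed
      have h: "F y holomorphic_on cball w (e/2)"
        by (rule holomorphic_on_subset[OF hol[OF y]]) (use sub e in auto)
      have "norm ((deriv ^^ 1) (F y) w) \<le> fact 1 * g y / (e/2)^1"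
      proof (rule Cauchy_inequality)
        show "F y holomorphic_on ball w (e/2)" using h by (rule holomorphic_on_subset) auto
        show "continuous_on (cball w (e/2)) (F y)" using h by (rule holomorphic_on_imp_continuous_on)
        show "norm (F y v) \<le> g y" if "norm (w - v) = e/2" for v
          using sub that y by (intro bd) (auto simp: dist_norm)
      qed (use e in auto)
      thus ?thesis by (simp add: mult.commute)
    qed
    have fd: "(F y has_field_derivative deriv (F y) w) (at w)" if "w \<in> cball x e" "y \<in> space M" for y w
    proof -
      have "w \<in> A" using that(1) e(2) by blast
      thus ?thesis by (rule holomorphic_derivI[OF hol[OF that(2)] A])
    qed
    have qb: "norm ((F y x' - F y x) / (x' - x)) \<le> 2 / e * g y"
      if x': "x' \<in> ball x (e/2)" "x' \<noteq> x" and y: "y \<in> space M" for x' y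
    proof -
      have "norm (F y x' - F y x) \<le> 2 / e * g y * norm (x' - x)"
      proof (rule field_differentiable_bound[of "ball x (e/2)"])
        show "(F y has_field_derivative deriv (F y) z) (at z within ball x (e/2))" if "z \<in> ball x (e/2)" for z
          by (rule has_field_derivative_at_within[OF fd]) (use that y e in auto)
      qed (use db x' y e in auto)
      thus ?thesis using x' by (simp add: norm_divide field_simps)
    qed
    have "((\<lambda>x'. (integral\<^sup>L M (\<lambda>y. F y x') - integral\<^sup>L M (\<lambda>y. F y x)) / (x' - x))
         \<longlongrightarrow> integral\<^sup>L M (\<lambda>y. deriv (F y) x)) (at x)"
      unfolding tendsto_at_iff_sequentially comp_def
    proof (intro allI impI)
      fix X :: "nat \<Rightarrow> complex" assume X: "\<forall>i. X i \<in> UNIV - {x}" "X \<longlonglongrightarrow> x"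
      have "eventually (\<lambda>n. X n \<in> ball x (e/2)) sequentially"
        using X(2) e(1) by (intro topological_tendstoD) auto
      then obtain N where N: "\<And>n. n \<ge> N \<Longrightarrow> X n \<in> ball x (e/2)"
        by (auto simp: eventually_sequentially)
      have "(\<lambda>n. integral\<^sup>L M (\<lambda>y. (F y (X (n + N)) - F y x) / (X (n + N) - x))) \<longlonglongrightarrow> integral\<^sup>L M (\<lambda>y. deriv (F y) x)"
      proof (rule integral_dominated_convergence[OF _ _ gint])
        have mq: "(\<lambda>y. (F y (X (n + N)) - F y x) / (X (n + N) - x)) \<in> borel_measurable M" for n
          using Fint[of x] Fint[of "X (n + N)"] N[of "n + N"] e
          by (auto intro!: borel_measurable_divide borel_measurable_diff dest: borel_measurable_integrable)
        thus "(\<lambda>y. (F y (X (n + N)) - F y x) / (X (n + N) - x)) \<in> borel_measurable M" for n .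
        have lim: "(\<lambda>n. (F y (X (n + N)) - F y x) / (X (n + N) - x)) \<longlonglongrightarrow> deriv (F y) x" if "y \<in> space M" for y
        proof -
          have "((\<lambda>x'. (F y x' - F y x) / (x' - x)) \<longlongrightarrow> deriv (F y) x) (at x)"
            using fd[of x y] that e by (auto simp: has_field_derivative_iff)
          hence "(\<lambda>n. (F y (X n) - F y x) / (X n - x)) \<longlonglongrightarrow> deriv (F y) x"
            using X unfolding tendsto_at_iff_sequentially comp_def by blast
          thus ?thesis by (rule LIMSEQ_ignore_initial_segment)
        qed
        thus "AE y in M. (\<lambda>n. (F y (X (n + N)) - F y x) / (X (n + N) - x)) \<longlonglongrightarrow> deriv (F y) x"
          by (intro AE_I2)
        show "(\<lambda>y. deriv (F y) x) \<in> borel_measurable M"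
          by (rule borel_measurable_LIMSEQ_metric[OF mq lim])
        show "AE y in M. norm ((F y (X (n + N)) - F y x) / (X (n + N) - x)) \<le> 2 / e * g y" for n
          using qb[of "X (n + N)"] N[of "n + N"] X(1) by (intro AE_I2) auto
      qed
      moreover have "integral\<^sup>L M (\<lambda>y. (F y (X (n + N)) - F y x) / (X (n + N) - x))
         = (integral\<^sup>L M (\<lambda>y. F y (X (n + N))) - integral\<^sup>L M (\<lambda>y. F y x)) / (X (n + N) - x)" for n
        using Fint[of x] Fint[of "X (n + N)"] N[of "n + N"] e
        by (subst integral_divide_zero, subst Bochner_Integration.integral_diff) auto
      ultimately have "(\<lambda>n. (integral\<^sup>L M (\<lambda>y. F y (X (n + N))) - integral\<^sup>L M (\<lambda>y. F y x)) / (X (n + N) - x))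
          \<longlonglongrightarrow> integral\<^sup>L M (\<lambda>y. deriv (F y) x)" by (simp only:)
      thus "(\<lambda>n. (integral\<^sup>L M (\<lambda>y. F y (X n)) - integral\<^sup>L M (\<lambda>y. F y x)) / (X n - x))
          \<longlonglongrightarrow> integral\<^sup>L M (\<lambda>y. deriv (F y) x)" by (rule LIMSEQ_offset)
    qed
    thus ?thesis unfolding has_field_derivative_iff .
qed

lemma holomorphic_lebesgue_integral:
  fixes F :: "'b \<Rightarrow> complex \<Rightarrow> complex"
  assumes "open A" and "\<And>y. y \<in> space M \<Longrightarrow> F y holomorphic_on A"
    and "\<And>x. x \<in> A \<Longrightarrow> (\<lambda>y. F y x) \<in> borel_measurable M"
    and "\<And>x. x \<in> A \<Longrightarrow> \<exists>e>0. \<exists>g. integrable M g \<and> (\<forall>x'\<in>ball x e \<inter> A. \<forall>y\<in>space M. norm (F y x') \<le> g y)"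
  shows "(\<lambda>x. integral\<^sup>L M (\<lambda>y. F y x)) holomorphic_on A"
  using has_field_derivative_lebesgue_integral[OF assms]
  by (auto simp: holomorphic_on_open[OF assms(1)])

section \<open>Calculus of exponential bounds\<close>

lemma exp_bound_mult:
  assumes "exp_bound \<kappa> f" "exp_bound \<mu> g"
  shows "exp_bound (\<kappa> + \<mu>) (\<lambda>z. f z * g z)"
  unfolding exp_bound_def
proof
  fix K
  obtain B Y where f: "B > 0" "Y > 0"
    "\<And>w. \<bar>Re w\<bar> \<le> K \<Longrightarrow> \<bar>Im w\<bar> \<ge> Y \<Longrightarrow> norm (f w) \<le> B * exp (- \<kappa> * \<bar>Im w\<bar>)"
    by (rule exp_boundE[OF assms(1), of K], rule that)
  obtain B' Y' where g: "B' > 0" "Y' > 0"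
    "\<And>w. \<bar>Re w\<bar> \<le> K \<Longrightarrow> \<bar>Im w\<bar> \<ge> Y' \<Longrightarrow> norm (g w) \<le> B' * exp (- \<mu> * \<bar>Im w\<bar>)"
    by (rule exp_boundE[OF assms(2), of K], rule that)
  show "\<exists>B Y. \<forall>w. \<bar>Re w\<bar> \<le> K \<longrightarrow> Y \<le> \<bar>Im w\<bar> \<longrightarrow> norm (f w * g w) \<le> B * exp (- (\<kappa> + \<mu>) * \<bar>Im w\<bar>)"
  proof (intro exI allI impI)
    fix w assume w: "\<bar>Re w\<bar> \<le> K" "max Y Y' \<le> \<bar>Im w\<bar>"
    have "norm (f w * g w) \<le> (B * exp (- \<kappa> * \<bar>Im w\<bar>)) * (B' * exp (- \<mu> * \<bar>Im w\<bar>))"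
      unfolding norm_mult using f g w by (intro mult_mono) auto
    also have "\<dots> = B * B' * exp (- (\<kappa> + \<mu>) * \<bar>Im w\<bar>)"
      by (simp add: algebra_simps flip: exp_add)
    finally show "norm (f w * g w) \<le> B * B' * exp (- (\<kappa> + \<mu>) * \<bar>Im w\<bar>)" .
  qed
qed

lemma exp_bound_mono:
  assumes "exp_bound \<kappa> f" "\<mu> \<le> \<kappa>"
  shows "exp_bound \<mu> f"
  unfolding exp_bound_def
proof
  fix K
  obtain B Y where f: "B > 0" "Y > 0"
    "\<And>w. \<bar>Re w\<bar> \<le> K \<Longrightarrow> \<bar>Im w\<bar> \<ge> Y \<Longrightarrow> norm (f w) \<le> B * exp (- \<kappa> * \<bar>Im w\<bar>)"
    by (rule exp_boundE[OF assms(1), of K], rule that)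
  show "\<exists>B Y. \<forall>w. \<bar>Re w\<bar> \<le> K \<longrightarrow> Y \<le> \<bar>Im w\<bar> \<longrightarrow> norm (f w) \<le> B * exp (- \<mu> * \<bar>Im w\<bar>)"
  proof (intro exI allI impI)
    fix w assume w: "\<bar>Re w\<bar> \<le> K" "Y \<le> \<bar>Im w\<bar>"
    have "norm (f w) \<le> B * exp (- \<kappa> * \<bar>Im w\<bar>)" using f w by auto
    also have "\<dots> \<le> B * exp (- \<mu> * \<bar>Im w\<bar>)"
      using f(1) assms(2) by (intro mult_left_mono) (auto intro: mult_right_mono)
    finally show "norm (f w) \<le> B * exp (- \<mu> * \<bar>Im w\<bar>)" .
  qed
qed

lemma exp_bound_shift:
  assumes "exp_bound \<kappa> f"
  shows "exp_bound \<kappa> (\<lambda>z. f (x + z))"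
  unfolding exp_bound_def
proof
  fix K
  obtain B Y where f: "B > 0" "Y > 0"
    "\<And>w. \<bar>Re w\<bar> \<le> K + \<bar>Re x\<bar> \<Longrightarrow> \<bar>Im w\<bar> \<ge> Y \<Longrightarrow> norm (f w) \<le> B * exp (- \<kappa> * \<bar>Im w\<bar>)"
    by (rule exp_boundE[OF assms(1), of "K + \<bar>Re x\<bar>"], rule that)
  show "\<exists>B Y. \<forall>w. \<bar>Re w\<bar> \<le> K \<longrightarrow> Y \<le> \<bar>Im w\<bar> \<longrightarrow> norm (f (x + w)) \<le> B * exp (- \<kappa> * \<bar>Im w\<bar>)"
  proof (intro exI allI impI)
    fix w assume w: "\<bar>Re w\<bar> \<le> K" "Y + \<bar>Im x\<bar> \<le> \<bar>Im w\<bar>"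
    have "norm (f (x + w)) \<le> B * exp (- \<kappa> * \<bar>Im (x + w)\<bar>)" using w by (intro f) auto
    also have "- \<kappa> * \<bar>Im (x + w)\<bar> \<le> \<bar>\<kappa>\<bar> * \<bar>Im x\<bar> - \<kappa> * \<bar>Im w\<bar>"
    proof -
      have "\<kappa> * \<bar>Im w\<bar> - \<kappa> * \<bar>Im (x + w)\<bar> \<le> \<bar>\<kappa> * (\<bar>Im w\<bar> - \<bar>Im (x + w)\<bar>)\<bar>"
        by (simp add: algebra_simps)
      also have "\<dots> = \<bar>\<kappa>\<bar> * \<bar>\<bar>Im w\<bar> - \<bar>Im (x + w)\<bar>\<bar>" by (rule abs_mult)
      also have "\<dots> \<le> \<bar>\<kappa>\<bar> * \<bar>Im x\<bar>" by (intro mult_left_mono) auto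
      finally show ?thesis by simp
    qed
    finally have "norm (f (x + w)) \<le> B * exp (\<bar>\<kappa>\<bar> * \<bar>Im x\<bar> - \<kappa> * \<bar>Im w\<bar>)" using f(1) by simp
    thus "norm (f (x + w)) \<le> B * exp (\<bar>\<kappa>\<bar> * \<bar>Im x\<bar>) * exp (- \<kappa> * \<bar>Im w\<bar>)"
      by (simp add: exp_diff exp_minus field_simps)
  qed
qed

lemma exp_bound_const: "exp_bound 0 (\<lambda>_. c)"
  unfolding exp_bound_def by (auto intro!: exI[of _ "norm c"])

lemma exp_bound_inverse_linear: "exp_bound 0 (\<lambda>z. inverse (z - e))"
  unfolding exp_bound_def
proof (intro allI exI impI)
  fix w assume "1 + \<bar>Im e\<bar> \<le> \<bar>Im w\<bar>"
  hence "1 \<le> \<bar>Im (w - e)\<bar>" by auto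
  also have "\<dots> \<le> norm (w - e)" by (rule abs_Im_le_cmod)
  finally show "norm (inverse (w - e)) \<le> 1 * exp (- 0 * \<bar>Im w\<bar>)"
    by (simp add: norm_inverse inverse_le_1_iff)
qed

text \<open>Linear growth is absorbed by any exponential, so a polynomial factor costs an
  arbitrarily small rate, which a strict inequality such as \<open>\<kappa> + \<mu> > 0\<close> can
  afford.\<close>

lemma exp_bound_linear:
  assumes "\<epsilon> > 0"
  shows "exp_bound (- \<epsilon>) (\<lambda>z. z - e)"
  unfolding exp_bound_def
proof (intro allI exI impI)
  fix K w assume w: "\<bar>Re w\<bar> \<le> K" "0 \<le> \<bar>Im w\<bar>"
  have K: "0 \<le> K" using w(1) by linarith
  have "norm (w - e) \<le> norm w + norm e" by (rule norm_triangle_ineq4)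
  also have "norm w \<le> K + \<bar>Im w\<bar>" using cmod_le[of w] w by linarith
  also have "\<bar>Im w\<bar> \<le> inverse \<epsilon> * exp (\<epsilon> * \<bar>Im w\<bar>)"
  proof -
    have "\<epsilon> * \<bar>Im w\<bar> \<le> exp (\<epsilon> * \<bar>Im w\<bar>)" using exp_ge_add_one_self[of "\<epsilon> * \<bar>Im w\<bar>"] by linarith
    thus ?thesis using assms by (simp add: field_simps)
  qed
  also have "K + inverse \<epsilon> * exp (\<epsilon> * \<bar>Im w\<bar>) + norm e \<le> (K + norm e + inverse \<epsilon>) * exp (- (- \<epsilon>) * \<bar>Im w\<bar>)"
  proof -
    have "(K + norm e) * 1 \<le> (K + norm e) * exp (\<epsilon> * \<bar>Im w\<bar>)"
      using K assms by (intro mult_left_mono) auto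
    thus ?thesis by (simp add: algebra_simps)
  qed
  finally show "norm (w - e) \<le> (K + norm e + inverse \<epsilon>) * exp (- (- \<epsilon>) * \<bar>Im w\<bar>)" by simp
qed

text \<open>In the absence of poles the bound extends to all heights, because the part of the strip
  at small heights is compact.\<close>

lemma exp_bound_strip:
  assumes "exp_bound \<kappa> f" "continuous_on {w. \<bar>Re w\<bar> \<le> K} f"
  obtains B where "B > 0" "\<And>w. \<bar>Re w\<bar> \<le> K \<Longrightarrow> norm (f w) \<le> B * exp (- \<kappa> * \<bar>Im w\<bar>)"
proof -
  obtain B Y where f: "B > 0" "Y > 0"
    "\<And>w. \<bar>Re w\<bar> \<le> K \<Longrightarrow> \<bar>Im w\<bar> \<ge> Y \<Longrightarrow> norm (f w) \<le> B * exp (- \<kappa> * \<bar>Im w\<bar>)"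
    by (rule exp_boundE[OF assms(1), of K], rule that)
  let ?Q = "cbox (Complex (-K) (-Y)) (Complex K Y)"
  have Q: "w \<in> ?Q \<longleftrightarrow> \<bar>Re w\<bar> \<le> K \<and> \<bar>Im w\<bar> \<le> Y" for w
    by (auto simp: in_cbox_complex_iff)
  have "compact ((\<lambda>w. norm (f w) * exp (\<kappa> * \<bar>Im w\<bar>)) ` ?Q)"
    by (intro compact_continuous_image continuous_intros continuous_on_subset[OF assms(2)]) (auto simp: Q)
  from compact_imp_bounded[OF this] obtain A
    where A: "\<forall>v\<in>(\<lambda>w. norm (f w) * exp (\<kappa> * \<bar>Im w\<bar>)) ` ?Q. norm v \<le> A" unfolding bounded_iff by blast
  show ?thesis
  proof (rule that[of "max A B"])
    fix w assume w: "\<bar>Re w\<bar> \<le> K"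
    show "norm (f w) \<le> max A B * exp (- \<kappa> * \<bar>Im w\<bar>)"
    proof (cases "\<bar>Im w\<bar> \<ge> Y")
      case True
      hence "norm (f w) \<le> B * exp (- \<kappa> * \<bar>Im w\<bar>)" using f w by auto
      also have "\<dots> \<le> max A B * exp (- \<kappa> * \<bar>Im w\<bar>)" by (intro mult_right_mono) auto
      finally show ?thesis .
    next
      case False
      hence "norm (f w) * exp (\<kappa> * \<bar>Im w\<bar>) \<le> A" using A w Q[of w] by fastforce
      hence "norm (f w) * exp (\<kappa> * \<bar>Im w\<bar>) \<le> max A B" by simp
      thus ?thesis by (simp add: exp_minus field_simps)
    qed
  qed (use f in auto)
qed

text \<open>The sign \<open>s\<close> treats both sides at once: \<open>s = 1\<close> removes the
  closed rightward half lines starting at the points of \<open>E\<close>, \<open>s = -1\<close> the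
  leftward ones.\<close>

definition cut_plane :: "real \<Rightarrow> complex set \<Rightarrow> complex set" where
  "cut_plane s E = {z. \<forall>e\<in>E. Im z = Im e \<longrightarrow> s * Re z < s * Re e}"

lemma open_cut_plane: "finite E \<Longrightarrow> open (cut_plane s E)"
proof -
  assume E: "finite E"
  have "cut_plane s E = - (\<Union>e\<in>E. {z. Im z = Im e} \<inter> {z. s * Re e \<le> s * Re z})"
    by (auto simp: cut_plane_def not_less)
  moreover have "closed ({z. Im z = Im e} \<inter> {z. s * Re e \<le> s * Re z})" for e
    by (intro closed_Int closed_Collect_eq closed_Collect_le continuous_intros)
  ultimately show ?thesis using E by (auto intro!: closed_UN simp: open_closed)
qed

lemma horizontally_convex_Int:
  "horizontally_convex A \<Longrightarrow> horizontally_convex B \<Longrightarrow> horizontally_convex (A \<inter> B)"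
  unfolding horizontally_convex_def by blast

lemma closed_segment_horizontal:
  assumes "Im z = Im w" "v \<in> closed_segment z w"
  obtains u where "0 \<le> u" "u \<le> 1" "Re v = (1 - u) * Re z + u * Re w" "Im v = Im z"
proof -
  obtain u where u: "0 \<le> u" "u \<le> 1" "v = (1 - u) *\<^sub>R z + u *\<^sub>R w"
    using assms(2) by (auto simp: closed_segment_def)
  have "Im v = (1 - u) * Im z + u * Im w" unfolding u(3) by simp
  hence "Im v = Im z" using assms(1) by (simp add: algebra_simps)
  thus ?thesis using that[of u] u by simp
qed

lemma horizontally_convex_cut_plane: "horizontally_convex (cut_plane s E)"
  unfolding horizontally_convex_def
proof (intro ballI impI subsetI)
  fix z w v assume zw: "z \<in> cut_plane s E" "w \<in> cut_plane s E" "Im z = Im w" and v: "v \<in> closed_segment z w"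
  obtain u where u: "0 \<le> u" "u \<le> 1" "Re v = (1 - u) * Re z + u * Re w" "Im v = Im z"
    using closed_segment_horizontal[OF zw(3) v] .
  show "v \<in> cut_plane s E" unfolding cut_plane_def
  proof (intro CollectI ballI impI)
    fix e assume e: "e \<in> E" "Im v = Im e"
    have "s * Re z < s * Re e" "s * Re w < s * Re e"
      using zw e u unfolding cut_plane_def by auto
    hence "(1 - u) * (s * Re z) + u * (s * Re w) < s * Re e"
      using u by (intro convex_bound_lt) auto
    thus "s * Re v < s * Re e" unfolding u(3) by (simp add: algebra_simps)
  qed
qed

lemma horizontally_convex_strip: "horizontally_convex {z. \<bar>Re z\<bar> < K}"
  unfolding horizontally_convex_def
proof (intro ballI impI subsetI)
  fix z w v assume zw: "z \<in> {z. \<bar>Re z\<bar> < K}" "w \<in> {z. \<bar>Re z\<bar> < K}" "Im z = Im w" and v: "v \<in> closed_segment z w"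
  obtain u where u: "0 \<le> u" "u \<le> 1" "Re v = (1 - u) * Re z + u * Re w" "Im v = Im z"
    using closed_segment_horizontal[OF zw(3) v] .
  have "\<bar>Re v\<bar> \<le> (1 - u) * \<bar>Re z\<bar> + u * \<bar>Re w\<bar>"
    using u abs_triangle_ineq[of "(1 - u) * Re z" "u * Re w"] by (simp add: abs_mult)
  also have "\<dots> < K" using zw u by (intro convex_bound_lt) auto
  finally show "v \<in> {z. \<bar>Re z\<bar> < K}" by simp
qed

lemma open_strip: "open {z. \<bar>Re z\<bar> < K}"
  by (intro open_Collect_less continuous_intros)

lemma vertical_line:
  "vertical_deformation m (\<lambda>c. of_real m + \<i> * of_real c)"
  "vector_derivative (\<lambda>c. of_real m + \<i> * of_real c) (at c) = \<i>"
proof -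
  have d: "((\<lambda>c. of_real m + \<i> * of_real c) has_vector_derivative \<i>) (at c)" for c
    by (auto intro!: derivative_eq_intros)
  have v: "vector_derivative (\<lambda>c. of_real m + \<i> * of_real c) (at c) = \<i>" for c
    by (rule vector_derivative_at[OF d])
  show "vector_derivative (\<lambda>c. of_real m + \<i> * of_real c) (at c) = \<i>" by (rule v)
  have "(\<lambda>c. of_real m + \<i> * of_real c) C1_differentiable_on {- 1..1}"
    unfolding C1_differentiable_on_def using d by (intro exI[of _ "\<lambda>_. \<i>"]) auto
  hence "(\<lambda>c. of_real m + \<i> * of_real c) piecewise_C1_differentiable_on {- 1..1}"
    by (rule C1_differentiable_imp_piecewise)
  thus "vertical_deformation m (\<lambda>c. of_real m + \<i> * of_real c)"
    unfolding vertical_deformation_def v by (intro conjI exI[of _ 1] allI absolutely_integrable_continuous_real) auto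
qed

subsection \<open>Continuation in the position of the poles\<close>

text \<open>A pair \<open>(p, b)\<close> is a pole at \<open>p - b * x\<close>. Poles of a function
  of \<open>x + z\<close> move with \<open>x\<close> and have \<open>b = 1\<close>, poles of a
  function of \<open>z\<close> alone have \<open>b = 0\<close>; repetitions in the list are
  multiplicities.\<close>

fun end_prod :: "(complex \<times> complex) list \<Rightarrow> complex \<Rightarrow> complex \<Rightarrow> complex" where
  "end_prod [] x z = 1"
| "end_prod ((p, b) # E) x z = (z - (p - b * x)) * end_prod E x z"

definition moving_ends :: "(complex \<times> complex) list \<Rightarrow> complex \<Rightarrow> complex set" where
  "moving_ends E x = (\<lambda>(p, b). p - b * x) ` set E"

lemma moving_ends_simps [simp]: "moving_ends [] x = {}"
  "moving_ends ((p, b) # E) x = insert (p - b * x) (moving_ends E x)"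
  by (auto simp: moving_ends_def)

lemma finite_moving_ends [simp]: "finite (moving_ends E x)"
  by (auto simp: moving_ends_def)

lemma end_prod_eq_0_iff: "end_prod E x z = 0 \<longleftrightarrow> z \<in> moving_ends E x"
  by (induction E) auto

lemma end_prod_holomorphic [holomorphic_intros]:
  assumes "f holomorphic_on S" "g holomorphic_on S"
  shows "(\<lambda>w. end_prod E (f w) (g w)) holomorphic_on S"
  by (induction E) (use assms in \<open>auto intro!: holomorphic_intros\<close>)

lemma exp_bound_inverse_end_prod: "exp_bound 0 (\<lambda>z. inverse (end_prod E x z))"
proof (induction E)
  case Nil
  show ?case using exp_bound_const[of 1] by simp
next
  case (Cons a E)
  obtain p b where a: "a = (p, b)" by (cases a)
  show ?case
    using exp_bound_mult[OF exp_bound_inverse_linear[of "p - b * x"] Cons.IH] by (simp add: a inverse_mult_distrib)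
qed

lemma norm_inverse_end_prod_le:
  assumes "g > 0" "\<And>e. e \<in> moving_ends E x \<Longrightarrow> norm (z - e) \<ge> g"
  shows "norm (inverse (end_prod E x z)) \<le> inverse g ^ length E"
  using assms(2)
proof (induction E)
  case (Cons a E)
  obtain p b where a: "a = (p, b)" by (cases a)
  have "norm (inverse (z - (p - b * x))) \<le> inverse g"
    using Cons.prems[of "p - b * x"] assms(1) by (simp add: a norm_inverse le_imp_inverse_le)
  moreover have "norm (inverse (end_prod E x z)) \<le> inverse g ^ length E"
    by (rule Cons.IH) (use Cons.prems in \<open>auto simp: a\<close>)
  ultimately show ?case
    using assms(1) by (simp add: a inverse_mult_distrib norm_mult mult_mono)
qed auto

text \<open>With poles on one side only nothing can be pinched: the contour is pushed to a fixed
  line on the free side, where the integrand is holomorphic in \<open>x\<close> and locally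
  dominated. The poles lie to the right for \<open>s = 1\<close> and to the left for
  \<open>s = -1\<close>.\<close>

lemma one_sided_continuation:
  fixes s :: real
  assumes s: "s = 1 \<or> s = -1"
    and F: "F holomorphic_on {w. \<bar>Re w\<bar> < M}" "exp_bound \<kappa> F"
    and G: "G holomorphic_on {w. \<bar>Re w\<bar> < M}" "exp_bound \<mu> G"
    and \<kappa>\<mu>: "\<kappa> + \<mu> > 0" and N: "N > 0" and K: "K > 0" and M: "K + 2 * N + 1 \<le> M"
    and E: "\<And>p b. (p, b) \<in> set E \<Longrightarrow> (b = 0 \<or> b = 1) \<and> s * Re p > - K"
  obtains h where "h holomorphic_on {x. \<bar>Re x\<bar> < N}"
    "\<And>x C. \<bar>Re x\<bar> < N \<Longrightarrow> vertical_deformation 0 C \<Longrightarrow> (\<And>c. \<bar>Re (C c)\<bar> \<le> K + N) \<Longrightarrow>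
      (\<And>c. C c \<in> cut_plane s (moving_ends E x)) \<Longrightarrow>
      has_line_integral (\<lambda>z. F (x + z) * G z * inverse (end_prod E x z)) (h x) C"
proof -
  define A where "A = {x::complex. \<bar>Re x\<bar> < N}"
  \<comment> \<open>For \<open>\<bar>Re x\<bar> < N\<close> all poles satisfy
    \<open>s * Re e > - K - N\<close>, so this abscissa lies strictly on the free side of each of
    them.\<close>
  define m where "m = - s * (K + N)"
  define L where "L = (\<lambda>c. complex_of_real m + \<i> * complex_of_real c)"
  define \<Phi> where "\<Phi> = (\<lambda>x z. F (x + z) * G z * inverse (end_prod E x z))"
  define h where "h = (\<lambda>x. integral\<^sup>L lborel (\<lambda>c. \<Phi> x (L c) * \<i>))"
  \<comment> \<open>Contours with \<open>\<bar>Re (C c)\<bar> \<le> K + N\<close> fit in with a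
    margin of 1, and \<open>x + z\<close> stays in the strip of half width
    \<open>K + 2 * N + 1 \<le> M\<close>, where \<open>F\<close> is holomorphic.\<close>
  define \<Omega> where "\<Omega> = (\<lambda>x. {z. \<bar>Re z\<bar> < K + N + 1} \<inter> cut_plane s (moving_ends E x))"
  have m: "\<bar>m\<bar> = K + N" using s N K by (auto simp: m_def)
  have L: "vertical_deformation m L" "vector_derivative L (at c) = \<i>" for c
    unfolding L_def by (rule vertical_line)+
  have ReL [simp]: "Re (L c) = m" and ImL [simp]: "Im (L c) = c" for c by (auto simp: L_def)
  have gap: "s * Re e - s * m > N - \<bar>Re x\<bar>" if "e \<in> moving_ends E x" for x e
  proof -
    obtain p b where pb: "(p, b) \<in> set E" "e = p - b * x" using \<open>e \<in> _\<close> by (auto simp: moving_ends_def)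
    have "s * Re e - s * m = s * Re p - s * Re (b * x) + (K + N)"
      using s by (elim disjE) (simp_all add: pb m_def)
    moreover have "\<bar>s * Re (b * x)\<bar> \<le> \<bar>Re x\<bar>" using E[OF pb(1)] s by auto
    moreover have "s * Re p > - K" using E[OF pb(1)] by simp
    ultimately show ?thesis by linarith
  qed
  have L_in: "L c \<in> \<Omega> x" if "x \<in> A" for x c
  proof -
    have "s * m < s * Re e" if "e \<in> moving_ends E x" for e
      using gap[OF that] \<open>x \<in> A\<close> by (simp add: A_def)
    thus ?thesis using m by (auto simp: \<Omega>_def cut_plane_def)
  qed
  have hol_z: "\<Phi> x holomorphic_on \<Omega> x" if "x \<in> A" for x
  proof -
    have "end_prod E x z \<noteq> 0" if "z \<in> \<Omega> x" for z
      using that by (auto simp: end_prod_eq_0_iff \<Omega>_def cut_plane_def)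
    moreover have "(\<lambda>z. F (x + z)) holomorphic_on \<Omega> x"
      by (rule holomorphic_on_compose_gen[of "\<lambda>z. x + z" _ F, unfolded o_def, OF _ F(1)])
         (use that M in \<open>auto intro!: holomorphic_intros simp: \<Omega>_def A_def\<close>)
    moreover have "G holomorphic_on \<Omega> x"
      by (rule holomorphic_on_subset[OF G(1)]) (use M N in \<open>auto simp: \<Omega>_def\<close>)
    ultimately show ?thesis unfolding \<Phi>_def by (auto intro!: holomorphic_intros)
  qed
  have bd: "exp_bound (\<kappa> + \<mu>) (\<Phi> x)" for x
    using exp_bound_mult[OF exp_bound_mult[OF exp_bound_shift[OF F(2)] G(2)] exp_bound_inverse_end_prod[of E x], of x]
    by (simp add: \<Phi>_def)
  have I1: "has_line_integral (\<Phi> x) (h x) L" if x: "x \<in> A" for x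
  proof -
    obtain I where I: "has_line_integral (\<Phi> x) I L"
      by (rule has_line_integral_exists[OF L(1) hol_z[OF x] L_in[OF x] bd \<kappa>\<mu>], rule that)
    hence "h x = I"
      using has_bochner_integral_integral_eq unfolding has_line_integral_def h_def L(2) by blast
    thus ?thesis using I by simp
  qed
  have "h holomorphic_on A" unfolding h_def
  proof (rule holomorphic_lebesgue_integral)
    show "open A" unfolding A_def by (rule open_strip)
  next
    fix c :: real
    have 1: "(\<lambda>x. F (x + L c)) holomorphic_on A"
      by (rule holomorphic_on_compose_gen[of "\<lambda>z. z + L c" _ F, unfolded o_def, OF _ F(1)])
         (use M m in \<open>auto intro!: holomorphic_intros simp: A_def\<close>)
    have 2: "end_prod E x (L c) \<noteq> 0" if "x \<in> A" for x
      unfolding end_prod_eq_0_iff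
    proof
      assume "L c \<in> moving_ends E x"
      hence "s * Re (L c) < s * Re (L c)"
        using L_in[OF that, of c] unfolding \<Omega>_def cut_plane_def by blast
      thus False by simp
    qed
    show "(\<lambda>x. \<Phi> x (L c) * \<i>) holomorphic_on A"
      unfolding \<Phi>_def by (intro holomorphic_intros 1 2)
  next
    fix x assume "x \<in> A"
    from I1[OF this] show "(\<lambda>c. \<Phi> x (L c) * \<i>) \<in> borel_measurable lborel"
      unfolding has_line_integral_def L(2) by (auto simp: has_bochner_integral_iff)
  next
    fix x0 assume x0: "x0 \<in> A"
    \<comment> \<open>Half of the margin of \<open>x0\<close>: throughout the ball of radius
      \<open>g\<close> the poles keep a distance of at least \<open>g\<close> from the line, which
      bounds the inverse product uniformly.\<close>
    define g where "g = (N - \<bar>Re x0\<bar>) / 2"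
    have g: "g > 0" using x0 by (simp add: A_def g_def)
    have cF: "continuous_on {w. \<bar>Re w\<bar> \<le> K + 2 * N} F" and cG: "continuous_on {w. \<bar>Re w\<bar> \<le> K + 2 * N} G"
      using M by (auto intro!: holomorphic_on_imp_continuous_on holomorphic_on_subset[OF F(1)] holomorphic_on_subset[OF G(1)])
    obtain BF where BF: "BF > 0" "\<And>w. \<bar>Re w\<bar> \<le> K + 2 * N \<Longrightarrow> norm (F w) \<le> BF * exp (- \<kappa> * \<bar>Im w\<bar>)"
      by (rule exp_bound_strip[OF F(2) cF], rule that)
    obtain BG where BG: "BG > 0" "\<And>w. \<bar>Re w\<bar> \<le> K + 2 * N \<Longrightarrow> norm (G w) \<le> BG * exp (- \<mu> * \<bar>Im w\<bar>)"
      by (rule exp_bound_strip[OF G(2) cG], rule that)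
    define D where "D = BF * exp (\<bar>\<kappa>\<bar> * (\<bar>Im x0\<bar> + g)) * BG * inverse g ^ length E"
    show "\<exists>e>0. \<exists>w. integrable lborel w \<and> (\<forall>x'\<in>ball x0 e \<inter> A. \<forall>c\<in>space lborel. norm (\<Phi> x' (L c) * \<i>) \<le> w c)"
    proof (intro exI conjI ballI)
      show "integrable lborel (\<lambda>c. D * exp (- (\<kappa> + \<mu>) * \<bar>c\<bar>))"
        using integrable_exp_neg_abs[OF \<kappa>\<mu>] by (intro integrable_mult_right)
      fix x and c :: real assume x: "x \<in> ball x0 g \<inter> A" and "c \<in> space lborel"
      have "\<bar>Re (x0 - x)\<bar> < g" "\<bar>Im (x0 - x)\<bar> < g"
        using x abs_Re_le_cmod[of "x0 - x"] abs_Im_le_cmod[of "x0 - x"] by (auto simp: dist_norm)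
      moreover have "N = \<bar>Re x0\<bar> + 2 * g" by (simp add: g_def field_simps)
      ultimately have R: "\<bar>Re x\<bar> \<le> N - g" "\<bar>Im x\<bar> \<le> \<bar>Im x0\<bar> + g" "\<bar>Re x\<bar> < N"
        using x by (auto simp: A_def)
      have "norm (F (x + L c)) \<le> BF * exp (- \<kappa> * \<bar>Im x + c\<bar>)"
        using BF(2)[of "x + L c"] R m by simp
      also have "- \<kappa> * \<bar>Im x + c\<bar> \<le> \<bar>\<kappa>\<bar> * (\<bar>Im x0\<bar> + g) - \<kappa> * \<bar>c\<bar>"
      proof -
        have "\<kappa> * \<bar>c\<bar> - \<kappa> * \<bar>Im x + c\<bar> \<le> \<bar>\<kappa> * (\<bar>c\<bar> - \<bar>Im x + c\<bar>)\<bar>" by (simp add: algebra_simps)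
        also have "\<dots> = \<bar>\<kappa>\<bar> * \<bar>\<bar>c\<bar> - \<bar>Im x + c\<bar>\<bar>" by (rule abs_mult)
        also have "\<dots> \<le> \<bar>\<kappa>\<bar> * (\<bar>Im x0\<bar> + g)" using R by (intro mult_left_mono) auto
        finally show ?thesis by simp
      qed
      finally have 1: "norm (F (x + L c)) \<le> BF * exp (\<bar>\<kappa>\<bar> * (\<bar>Im x0\<bar> + g) - \<kappa> * \<bar>c\<bar>)" using BF(1) by simp
      have 2: "norm (G (L c)) \<le> BG * exp (- \<mu> * \<bar>c\<bar>)" using BG(2)[of "L c"] m N by simp
      have 3: "norm (inverse (end_prod E x (L c))) \<le> inverse g ^ length E"
      proof (rule norm_inverse_end_prod_le[OF g])
        fix e assume e: "e \<in> moving_ends E x"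
        have "g \<le> \<bar>s * (Re e - m)\<bar>" using gap[OF e] R by (simp add: algebra_simps)
        also have "\<dots> = \<bar>Re (L c - e)\<bar>" using s by auto
        also have "\<dots> \<le> norm (L c - e)" by (rule abs_Re_le_cmod)
        finally show "g \<le> norm (L c - e)" .
      qed
      have "norm (\<Phi> x (L c) * \<i>) = norm (F (x + L c)) * norm (G (L c)) * norm (inverse (end_prod E x (L c)))"
        by (simp add: \<Phi>_def norm_mult)
      also have "\<dots> \<le> (BF * exp (\<bar>\<kappa>\<bar> * (\<bar>Im x0\<bar> + g) - \<kappa> * \<bar>c\<bar>)) * (BG * exp (- \<mu> * \<bar>c\<bar>)) * inverse g ^ length E"
        by (intro mult_mono 1 2 3 mult_nonneg_nonneg) (use BF BG g in auto)
      also have "\<dots> = D * exp (- (\<kappa> + \<mu>) * \<bar>c\<bar>)"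
        by (simp add: D_def algebra_simps exp_diff exp_minus exp_add divide_simps)
      finally show "norm (\<Phi> x (L c) * \<i>) \<le> D * exp (- (\<kappa> + \<mu>) * \<bar>c\<bar>)" .
    qed (use g in auto)
  qed
  moreover have "has_line_integral (\<Phi> x) (h x) C"
    if "\<bar>Re x\<bar> < N" "vertical_deformation 0 C" "\<And>c. \<bar>Re (C c)\<bar> \<le> K + N"
      "\<And>c. C c \<in> cut_plane s (moving_ends E x)" for x C
  proof (rule has_line_integral_deform[OF _ _ hol_z bd \<kappa>\<mu> L(1) L_in that(2) _ I1])
    show "open (\<Omega> x)" "horizontally_convex (\<Omega> x)"
      unfolding \<Omega>_def
      by (auto intro!: open_Int open_strip open_cut_plane horizontally_convex_Int horizontally_convex_strip horizontally_convex_cut_plane)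
    show "C c \<in> \<Omega> x" for c
      using that(3)[of c] that(4)[of c] by (auto simp: \<Omega>_def)
  qed (use that in \<open>auto simp: A_def\<close>)
  ultimately show ?thesis using that[of h] unfolding A_def \<Phi>_def by blast
qed

lemma has_line_integral_cong:
  assumes "\<And>c. f (C c) = g (C c)" "has_line_integral f I C"
  shows "has_line_integral g I C"
  using assms by (simp add: has_line_integral_def)

lemma has_line_integral_diff:
  assumes "has_line_integral f I C" "has_line_integral g J C"
  shows "has_line_integral (\<lambda>z. f z - g z) (I - J) C"
  using has_bochner_integral_diff[OF assms[unfolded has_line_integral_def]]
  by (simp add: has_line_integral_def algebra_simps)

lemma has_line_integral_cmult:
  assumes "has_line_integral f I C"
  shows "has_line_integral (\<lambda>z. k * f z) (k * I) C"
proof -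
  have "has_bochner_integral lborel (\<lambda>c. k * (f (C c) * vector_derivative C (at c))) (k * I)"
    using assms unfolding has_line_integral_def by (intro has_bochner_integral_mult_right)
  thus ?thesis by (simp add: has_line_integral_def mult.assoc)
qed

text \<open>
  The poles to the left and to the right of the contour are removed one pair at a time with
  \<open>1 / ((z - l) * (z - r)) = (1 / (z - l) - 1 / (z - r)) / (l - r)\<close>, until the poles lie on one side
  only and the contour can be moved to a vertical line on the other side.
\<close>

lemma two_sided_continuation:
  assumes F: "F holomorphic_on {w. \<bar>Re w\<bar> < M}" "exp_bound \<kappa> F"
    and G: "G holomorphic_on {w. \<bar>Re w\<bar> < M}" "exp_bound \<mu> G"
    and \<kappa>\<mu>: "\<kappa> + \<mu> > 0" and N: "N > 0" and K: "K > 0" and M: "K + 2 * N + 1 \<le> M"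
    and Ls: "\<And>p b. (p, b) \<in> set Ls \<Longrightarrow> (b = 0 \<or> b = 1) \<and> Re p < K"
    and Rs: "\<And>p b. (p, b) \<in> set Rs \<Longrightarrow> (b = 0 \<or> b = 1) \<and> Re p > - K"
  shows "\<exists>h. h meromorphic_on {x. \<bar>Re x\<bar> < N} \<and>
    (\<forall>x. \<bar>Re x\<bar> < N \<longrightarrow> moving_ends Ls x \<inter> moving_ends Rs x = {} \<longrightarrow> h analytic_on {x}) \<and>
    (\<forall>x C. \<bar>Re x\<bar> < N \<longrightarrow> vertical_deformation 0 C \<longrightarrow> (\<forall>c. \<bar>Re (C c)\<bar> \<le> K + N) \<longrightarrow>
      (\<forall>c. C c \<in> cut_plane (-1) (moving_ends Ls x)) \<longrightarrow> (\<forall>c. C c \<in> cut_plane 1 (moving_ends Rs x)) \<longrightarrow>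
      has_line_integral (\<lambda>z. F (x + z) * G z * inverse (end_prod Ls x z * end_prod Rs x z)) (h x) C)"
  using Ls Rs
proof (induction Ls arbitrary: Rs)
  case Nil
  obtain h where h: "h holomorphic_on {x. \<bar>Re x\<bar> < N}"
    "\<And>x C. \<bar>Re x\<bar> < N \<Longrightarrow> vertical_deformation 0 C \<Longrightarrow> (\<And>c. \<bar>Re (C c)\<bar> \<le> K + N) \<Longrightarrow>
      (\<And>c. C c \<in> cut_plane 1 (moving_ends Rs x)) \<Longrightarrow>
      has_line_integral (\<lambda>z. F (x + z) * G z * inverse (end_prod Rs x z)) (h x) C"
    by (rule one_sided_continuation[OF _ F G \<kappa>\<mu> N K M, of 1 Rs]) (use Nil.prems(2) in auto)
  have "h meromorphic_on {x. \<bar>Re x\<bar> < N}"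
    using h(1) open_strip by (simp add: analytic_on_imp_meromorphic_on analytic_on_open)
  moreover have "h analytic_on {x}" if "\<bar>Re x\<bar> < N" for x
    by (rule holomorphic_on_imp_analytic_at[OF h(1) open_strip]) (use that in simp)
  ultimately show ?case using h(2) by (intro exI[of _ h]) auto
next
  case (Cons l Ls)
  obtain p b where l: "l = (p, b)" by (cases l)
  note outer = Cons.IH
  have prL: "\<And>p' b'. (p', b') \<in> set ((p, b) # Ls) \<Longrightarrow> (b' = 0 \<or> b' = 1) \<and> Re p' < K"
    using Cons.prems(1) by (simp add: l)
  \<comment> \<open>Partial fractions drop either the right pole or the left one. The first case is
    the inner induction hypothesis with the same left list; the second is the outer one, applied to
    the full list \<open>r # Rs\<close>.\<close>
  show ?case using Cons.prems(2)
  proof (induction Rs)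
    case Nil
    obtain h where h: "h holomorphic_on {x. \<bar>Re x\<bar> < N}"
      "\<And>x C. \<bar>Re x\<bar> < N \<Longrightarrow> vertical_deformation 0 C \<Longrightarrow> (\<And>c. \<bar>Re (C c)\<bar> \<le> K + N) \<Longrightarrow>
        (\<And>c. C c \<in> cut_plane (-1) (moving_ends ((p, b) # Ls) x)) \<Longrightarrow>
        has_line_integral (\<lambda>z. F (x + z) * G z * inverse (end_prod ((p, b) # Ls) x z)) (h x) C"
      by (rule one_sided_continuation[OF _ F G \<kappa>\<mu> N K M, of "-1" "(p, b) # Ls"]) (use prL in force)+
    have "h meromorphic_on {x. \<bar>Re x\<bar> < N}"
      using h(1) open_strip by (simp add: analytic_on_imp_meromorphic_on analytic_on_open)
    moreover have "h analytic_on {x}" if "\<bar>Re x\<bar> < N" for x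
      by (rule holomorphic_on_imp_analytic_at[OF h(1) open_strip]) (use that in simp)
    ultimately show ?case using h(2) by (intro exI[of _ h]) (auto simp: l)
  next
    case (Cons r Rs)
    obtain q b' where r: "r = (q, b')" by (cases r)
    have "(b = 0 \<or> b = 1) \<and> Re p > - K" if "(p, b) \<in> set Rs" for p b using that Cons.prems by auto
    from Cons.IH[OF this] obtain h1 where h1: "h1 meromorphic_on {x. \<bar>Re x\<bar> < N} \<and>
      (\<forall>x. \<bar>Re x\<bar> < N \<longrightarrow> moving_ends (l # Ls) x \<inter> moving_ends Rs x = {} \<longrightarrow> h1 analytic_on {x}) \<and>
      (\<forall>x C. \<bar>Re x\<bar> < N \<longrightarrow> vertical_deformation 0 C \<longrightarrow> (\<forall>c. \<bar>Re (C c)\<bar> \<le> K + N) \<longrightarrow>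
        (\<forall>c. C c \<in> cut_plane (-1) (moving_ends (l # Ls) x)) \<longrightarrow> (\<forall>c. C c \<in> cut_plane 1 (moving_ends Rs x)) \<longrightarrow>
        has_line_integral (\<lambda>z. F (x + z) * G z * inverse (end_prod (l # Ls) x z * end_prod Rs x z)) (h1 x) C)"
      by (rule exE)
    have "(b' = 0 \<or> b' = 1) \<and> Re p' < K" if "(p', b') \<in> set Ls" for p' b' using prL that by auto
    from outer[OF this Cons.prems] obtain h2 where h2: "h2 meromorphic_on {x. \<bar>Re x\<bar> < N} \<and>
      (\<forall>x. \<bar>Re x\<bar> < N \<longrightarrow> moving_ends Ls x \<inter> moving_ends (r # Rs) x = {} \<longrightarrow> h2 analytic_on {x}) \<and>
      (\<forall>x C. \<bar>Re x\<bar> < N \<longrightarrow> vertical_deformation 0 C \<longrightarrow> (\<forall>c. \<bar>Re (C c)\<bar> \<le> K + N) \<longrightarrow>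
        (\<forall>c. C c \<in> cut_plane (-1) (moving_ends Ls x)) \<longrightarrow> (\<forall>c. C c \<in> cut_plane 1 (moving_ends (r # Rs) x)) \<longrightarrow>
        has_line_integral (\<lambda>z. F (x + z) * G z * inverse (end_prod Ls x z * end_prod (r # Rs) x z)) (h2 x) C)"
      by (rule exE)
    define d where "d = (\<lambda>x. (p - b * x) - (q - b' * x))"
    \<comment> \<open>If the two poles coincide for all \<open>x\<close>, then \<open>d\<close> is
      identically zero and the candidate is 0 by convention; the remaining two claims are vacuous
      then, since the poles intersect and no contour separates them.\<close>
    have "(\<lambda>x. inverse (d x) * (h1 x - h2 x)) meromorphic_on {x. \<bar>Re x\<bar> < N}"
      unfolding d_def by (intro meromorphic_intros h1[THEN conjunct1] h2[THEN conjunct1])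
    moreover have "(\<lambda>x. inverse (d x) * (h1 x - h2 x)) analytic_on {x}"
      if "\<bar>Re x\<bar> < N" "moving_ends (l # Ls) x \<inter> moving_ends (r # Rs) x = {}" for x
    proof -
      have "moving_ends (l # Ls) x \<inter> moving_ends Rs x = {}" "moving_ends Ls x \<inter> moving_ends (r # Rs) x = {}" "d x \<noteq> 0"
        using that(2) by (auto simp: d_def l r)
      hence "h1 analytic_on {x}" "h2 analytic_on {x}" "d x \<noteq> 0"
        using that(1) h1[THEN conjunct2, THEN conjunct1] h2[THEN conjunct2, THEN conjunct1] by blast+
      thus ?thesis unfolding d_def by (intro analytic_intros) auto
    qed
    moreover have "has_line_integral (\<lambda>z. F (x + z) * G z * inverse (end_prod (l # Ls) x z * end_prod (r # Rs) x z))
        (inverse (d x) * (h1 x - h2 x)) C"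
      if x: "\<bar>Re x\<bar> < N" and C: "vertical_deformation 0 C" "\<forall>c. \<bar>Re (C c)\<bar> \<le> K + N"
        and cut: "\<forall>c. C c \<in> cut_plane (-1) (moving_ends (l # Ls) x)" "\<forall>c. C c \<in> cut_plane 1 (moving_ends (r # Rs) x)" for x C
    proof (rule has_line_integral_cong)
      have "\<forall>c. C c \<in> cut_plane (-1) (moving_ends Ls x)" "\<forall>c. C c \<in> cut_plane 1 (moving_ends Rs x)"
        using cut by (auto simp: cut_plane_def l r)
      thus "has_line_integral (\<lambda>z. inverse (d x) *
          (F (x + z) * G z * inverse (end_prod (l # Ls) x z * end_prod Rs x z) -
           F (x + z) * G z * inverse (end_prod Ls x z * end_prod (r # Rs) x z))) (inverse (d x) * (h1 x - h2 x)) C"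
        using x C cut by (intro has_line_integral_cmult has_line_integral_diff h1[THEN conjunct2, THEN conjunct2, rule_format] h2[THEN conjunct2, THEN conjunct2, rule_format]) auto
      fix c
      define u where "u = C c - (p - b * x)"
      define v where "v = C c - (q - b' * x)"
      have nz: "C c \<noteq> p - b * x" "C c \<noteq> q - b' * x"
        using cut[THEN spec, of c] by (auto simp: cut_plane_def l r)
      \<comment> \<open>The contour passes to the right of one pole and to the left of the other; at
        their common height this would be contradictory.\<close>
      have "d x \<noteq> 0"
      proof
        assume "d x = 0"
        hence eq: "p - b * x = q - b' * x" by (simp add: d_def)
        have "Re (p - b * x) < Re (C (Im (p - b * x)))" "Re (C (Im (q - b' * x))) < Re (q - b' * x)"
          using cut[THEN spec, of "Im (p - b * x)"] cut[THEN spec, of "Im (q - b' * x)"] C(1)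
          by (auto simp: cut_plane_def l r)
        thus False using eq by simp
      qed
      moreover have "d x = v - u" by (simp add: d_def u_def v_def)
      moreover have "u \<noteq> 0" "v \<noteq> 0" using nz by (auto simp: u_def v_def)
      moreover from this have "inverse u - inverse v = (v - u) * (inverse u * inverse v)"
        by (simp add: field_simps)
      ultimately have eq: "inverse (d x) * (inverse u - inverse v) = inverse u * inverse v"
        by simp
      have pair: "inverse (d x) * (X * (inverse u * a * b') - X * (a * (inverse v * b')))
          = X * (inverse u * a * (inverse v * b'))" for X a b'
      proof -
        have "inverse (d x) * (X * (inverse u * a * b') - X * (a * (inverse v * b')))
          = inverse (d x) * (inverse u - inverse v) * (X * a * b')" by (simp add: algebra_simps)
        thus ?thesis unfolding eq by (simp add: mult_ac)
      qed
      show "inverse (d x) *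
          (F (x + C c) * G (C c) * inverse (end_prod (l # Ls) x (C c) * end_prod Rs x (C c)) -
           F (x + C c) * G (C c) * inverse (end_prod Ls x (C c) * end_prod (r # Rs) x (C c)))
          = F (x + C c) * G (C c) * inverse (end_prod (l # Ls) x (C c) * end_prod (r # Rs) x (C c))"
        unfolding l r end_prod.simps u_def[symmetric] v_def[symmetric] inverse_mult_distrib
        by (rule pair)
    qed
    ultimately show ?case by (intro exI[of _ "\<lambda>x. inverse (d x) * (h1 x - h2 x)"]) blast
  qed
qed

section \<open>Contours separating two finite sets of half lines\<close>

lemma poly_interpolation:
  assumes "finite S"
  shows "\<exists>p::real poly. \<forall>x\<in>S. poly p x = f x"
  using assms
proof (induction S rule: finite_induct)
  case (insert a S)
  then obtain p :: "real poly" where p: "\<forall>x\<in>S. poly p x = f x" by blast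
  define q where "q = (\<Prod>s\<in>S. [:- s, 1:])"
  have q: "poly q a \<noteq> 0" "poly q x = 0" if "x \<in> S" for x
    using insert.hyps that by (auto simp: q_def poly_prod)
  have qa: "poly q a \<noteq> 0" using insert.hyps by (auto simp: q_def poly_prod)
  have "\<forall>x\<in>insert a S. poly (p + smult ((f a - poly p a) / poly q a) q) x = f x"
    using p q qa by auto
  thus ?case by blast
qed auto

text \<open>A polynomial \<open>Q\<close> with value 1 at the heights of \<open>A\<close>, -1 at the
  heights of \<open>B\<close> and 0 at both ends is squashed into \<open>[- 1, 1]\<close> and scaled
  by \<open>V\<close>: the contour is at \<open>V\<close> where it must pass \<open>A\<close> and at
  \<open>- V\<close> where it must pass \<open>B\<close>. The bound by \<open>V\<close> matters
  because the continuation lemma admits only contours in a fixed strip.\<close>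

lemma separating_contour:
  fixes A B :: "complex set"
  assumes fin: "finite A" "finite B" and disj: "\<And>a b. a \<in> A \<Longrightarrow> b \<in> B \<Longrightarrow> Im a \<noteq> Im b"
    and V: "V \<ge> 0" "\<And>a. a \<in> A \<Longrightarrow> Re a < V" "\<And>b. b \<in> B \<Longrightarrow> - V < Re b"
  obtains C where "vertical_deformation 0 C" "\<And>c. \<bar>Re (C c)\<bar> \<le> V" "\<And>c. C c \<in> cut_plane (- 1) A \<inter> cut_plane 1 B"
proof -
  define R where "R = 1 + (\<Sum>e\<in>A \<union> B. \<bar>Im e\<bar>)"
  have R: "\<bar>Im e\<bar> < R" if "e \<in> A \<union> B" for e
  proof -
    have "\<bar>Im e\<bar> \<le> (\<Sum>e\<in>A \<union> B. \<bar>Im e\<bar>)" by (rule member_le_sum) (use that fin in auto)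
    thus ?thesis by (simp add: R_def)
  qed
  have R1: "R \<ge> 1" by (simp add: R_def sum_nonneg)
  \<comment> \<open>The division by \<open>R^2 - y^2\<close> anticipates the factor of
    \<open>Q\<close> that makes the contour return to the imaginary axis at height \<open>R\<close>
    and \<open>- R\<close>.\<close>
  obtain P :: "real poly" where P: "\<forall>y\<in>Im ` (A \<union> B). poly P y = (if y \<in> Im ` A then 1 else - 1) / (R^2 - y^2)"
    using poly_interpolation[of "Im ` (A \<union> B)" "\<lambda>y. (if y \<in> Im ` A then 1 else - 1) / (R^2 - y^2)"] fin by auto
  define Q where "Q = P * [:R^2, 0, - 1:]"
  have Qv: "poly Q c = poly P c * (R^2 - c^2)" for c by (simp add: Q_def power2_eq_square algebra_simps)
  have Qh: "poly Q (Im e) = (if Im e \<in> Im ` A then 1 else - 1)" if "e \<in> A \<union> B" for e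
  proof -
    have "(Im e)^2 < R^2" using power_strict_mono[OF R[OF that], of 2] by simp
    thus ?thesis using P that by (simp add: Qv)
  qed
  \<comment> \<open>The map \<open>u \<mapsto> 2 * u / (1 + u^2)\<close> has values in
    \<open>[- 1, 1]\<close> and fixes -1, 0 and 1.\<close>
  define s where "s = (\<lambda>c. V * (2 * poly Q c / (1 + (poly Q c)^2)))"
  define s' where "s' = (\<lambda>c. V * ((2 * poly (pderiv Q) c * (1 + (poly Q c)^2) - 2 * poly Q c * (2 * poly Q c * poly (pderiv Q) c)) / (1 + (poly Q c)^2)^2))"
  have nz: "1 + (poly Q c)^2 \<noteq> 0" for c
  proof -
    have "0 \<le> (poly Q c)^2" by simp
    thus ?thesis by linarith
  qed
  have ds: "(s has_real_derivative s' c) (at c)" for c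
    unfolding s_def s'_def using nz[of c]
    by (auto intro!: derivative_eq_intros poly_DERIV[THEN DERIV_chain2] simp: power2_eq_square algebra_simps)
  have cs: "continuous_on X s" for X unfolding s_def using nz by (intro continuous_intros) auto
  have cs': "continuous_on X s'" for X unfolding s'_def using nz by (intro continuous_intros) auto
  have s_bd: "\<bar>s c\<bar> \<le> V" for c
  proof -
    have "2 * \<bar>poly Q c\<bar> \<le> 1 + (poly Q c)^2"
      using zero_le_power2[of "\<bar>poly Q c\<bar> - 1"] by (simp add: power2_eq_square algebra_simps)
    moreover have "0 < 1 + (poly Q c)^2" by (simp add: add_pos_nonneg)
    ultimately have "\<bar>2 * poly Q c / (1 + (poly Q c)^2)\<bar> \<le> 1" by (simp add: abs_mult)
    thus ?thesis unfolding s_def abs_mult using V(1) mult_left_le[of "\<bar>2 * poly Q c / (1 + (poly Q c)^2)\<bar>" V] by simp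
  qed
  define C where "C = (\<lambda>c. complex_of_real (if \<bar>c\<bar> < R then s c else 0) + \<i> * of_real c)"
  have sR: "s c = 0" if "\<bar>c\<bar> = R" for c
  proof -
    have "c^2 = R^2" using that R1 by (metis power2_abs)
    thus ?thesis by (simp add: s_def Qv)
  qed
  have ImC: "Im (C c) = c" and ReC: "Re (C c) = (if \<bar>c\<bar> < R then s c else 0)" for c by (simp_all add: C_def)
  have C_in: "C c = of_real (s c) + \<i> * of_real c" if "\<bar>c\<bar> \<le> R" for c
    using sR[of c] that by (auto simp: C_def)
  have dC: "(C has_vector_derivative (of_real (s' c) + \<i>)) (at c)" if "c \<in> {-R<..<R}" for c
  proof -
    have "((\<lambda>c. of_real (s c) + \<i> * of_real c) has_vector_derivative (of_real (s' c) + \<i>)) (at c)"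
      using ds[of c] by (auto intro!: derivative_eq_intros has_vector_derivative_of_real simp: has_real_derivative_iff_has_vector_derivative)
    thus ?thesis
      by (rule has_vector_derivative_transform_within_open[of _ _ _ "{-R<..<R}"]) (use that C_in in auto)
  qed
  have "vertical_deformation 0 C"
    unfolding vertical_deformation_def
  proof (intro conjI allI exI[of _ R] impI)
    show "C c = of_real 0 + \<i> * of_real c" if "R \<le> \<bar>c\<bar>" for c using that by (simp add: C_def)
    show "C piecewise_C1_differentiable_on {- R..R}"
      unfolding piecewise_C1_differentiable_on_def C1_differentiable_on_def
    proof (intro conjI exI[of _ "{-R, R}"] exI[of _ "\<lambda>c. of_real (s' c) + \<i>"] ballI)
      have "continuous_on {-R..R} (\<lambda>c. of_real (s c) + \<i> * of_real c)" by (intro continuous_intros cs)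
      thus "continuous_on {-R..R} C" by (rule continuous_on_eq) (use C_in in auto)
      show "continuous_on ({- R..R} - {- R, R}) (\<lambda>c. complex_of_real (s' c) + \<i>)" by (intro continuous_intros cs')
    qed (use dC in auto)
    have "(\<lambda>c. complex_of_real (s' c) + \<i>) absolutely_integrable_on {-R..R}"
      by (intro absolutely_integrable_continuous_real continuous_intros cs')
    moreover have "negligible {-R, R}" by simp
    ultimately show "(\<lambda>c. vector_derivative C (at c)) absolutely_integrable_on {- R..R}"
      by (subst (asm) absolutely_integrable_spike_eq[of "{-R, R}" _ "\<lambda>c. vector_derivative C (at c)"])
         (use dC in \<open>auto intro!: vector_derivative_at\<close>)
  qed (use ImC in auto)
  moreover have "\<bar>Re (C c)\<bar> \<le> V" for c using s_bd V(1) by (simp add: ReC)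
  moreover have "C c \<in> cut_plane (- 1) A \<inter> cut_plane 1 B" for c
  proof -
    have "Re a < Re (C c)" if "a \<in> A" "c = Im a" for a
      using R[of a] V(2)[of a] Qh[of a] that by (simp add: ReC s_def)
    moreover have "Re (C c) < Re b" if "b \<in> B" "c = Im b" for b
    proof -
      have "Im b \<notin> Im ` A" using disj that by force
      thus ?thesis using R[of b] V(3)[of b] Qh[of b] that by (simp add: ReC s_def)
    qed
    ultimately show ?thesis by (auto simp: cut_plane_def ImC)
  qed
  ultimately show ?thesis using that by blast
qed

text \<open>The difference is meromorphic with zeros accumulating at \<open>z\<close>, so
  \<open>f\<close> and \<open>g\<close> agree near \<open>z\<close>. A nicely meromorphic function
  is determined at \<open>z\<close> by its values nearby: 0 at a pole, the limit otherwise.\<close>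

lemma nicely_meromorphic_eqI:
  assumes f: "f nicely_meromorphic_on A" and g: "g nicely_meromorphic_on A" and z: "z \<in> A"
    and freq: "\<exists>\<^sub>F w in at z. f w = g w"
  shows "f z = g z"
proof -
  have m: "f meromorphic_on {z}" "g meromorphic_on {z}"
    using f g z meromorphic_on_subset[of _ A "{z}"] by (auto simp: nicely_meromorphic_on_def)
  have "(\<lambda>w. f w - g w) meromorphic_on {z}" by (intro meromorphic_intros m)
  hence "\<forall>\<^sub>F w in at z. f w - g w = 0"
    using freq not_essential_frequently_0_imp_eventually_0[of "\<lambda>w. f w - g w" z]
    by (auto simp: meromorphic_at_iff)
  hence ev: "\<forall>\<^sub>F w in at z. f w = g w" by eventually_elim simp
  have pole: "is_pole f z \<longleftrightarrow> is_pole g z" by (intro is_pole_cong ev refl)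
  have lim: "f \<midarrow>z\<rightarrow> c \<longleftrightarrow> g \<midarrow>z\<rightarrow> c" for c by (intro tendsto_cong ev)
  have np: "\<not> is_pole f z" if "f \<midarrow>z\<rightarrow> c" for c
    using that not_tendsto_and_filterlim_at_infinity[of "at z" f c] by (auto simp: is_pole_def)
  from f g z have "(is_pole f z \<and> f z = 0) \<or> f \<midarrow>z\<rightarrow> f z" "(is_pole g z \<and> g z = 0) \<or> g \<midarrow>z\<rightarrow> g z"
    by (auto simp: nicely_meromorphic_on_def)
  thus ?thesis using pole lim np LIM_unique[of g "f z" z "g z"] by metis
qed

subsection \<open>The hyperbolic gamma function\<close>

text \<open>As a measure space of its own the half line lets bounds be stated for
  \<open>y > 0\<close> only, in the form that the lemma on parameter integrals expects.\<close>

abbreviation pos_lborel :: "real measure" where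
  "pos_lborel \<equiv> restrict_space lborel {0<..}"

lemma space_pos_lborel: "space pos_lborel = {0<..}"
  by (simp add: space_restrict_space)

lemma pos_lborel_measurable:
  fixes f :: "real \<Rightarrow> 'a::topological_space"
  assumes "continuous_on {0<..} f"
  shows "f \<in> borel_measurable pos_lborel"
  using borel_measurable_continuous_on_restrict[OF assms]
  by (subst measurable_cong_sets[OF sets_restrict_space_cong[OF sets_lborel] refl])

lemma pos_lborel_integrable:
  fixes f :: "real \<Rightarrow> 'a::{banach, second_countable_topology}"
  assumes "f \<in> borel_measurable pos_lborel"
    and "\<And>y. 0 < y \<Longrightarrow> y \<le> 1 \<Longrightarrow> norm (f y) \<le> C" "\<And>y. y \<ge> 1 \<Longrightarrow> norm (f y) \<le> C / y^2"
  shows "integrable pos_lborel f"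
proof -
  have "(\<lambda>y::real. 1 / y^2) absolutely_integrable_on {1..}"
    using has_integral_inverse_power_to_inf[of 2 1]
    by (intro nonnegative_absolutely_integrable_1) auto
  hence "integrable lebesgue (\<lambda>y::real. indicator {1..} y *\<^sub>R (1 / y^2))"
    by (simp add: set_integrable_def)
  hence i1: "integrable lborel (\<lambda>y::real. indicator {1..} y *\<^sub>R (1 / y^2))"
    by (subst (asm) integrable_completion) auto
  have i2: "integrable lborel (\<lambda>y::real. indicator {0..1} y :: real)"
    by (intro integrable_real_indicator) auto
  have "integrable lborel (\<lambda>y. C * (indicator {1..} y *\<^sub>R (1 / y^2) + indicator {0..1} y))"
    by (intro integrable_mult_right Bochner_Integration.integrable_add i1 i2)
  hence "integrable lborel (\<lambda>y. indicator {0<..} y *\<^sub>R (C * (indicator {1..} y *\<^sub>R (1 / y^2) + indicator {0..1} y)))"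
    by (intro integrable_mult_indicator) auto
  hence int: "integrable pos_lborel (\<lambda>y. C * (indicator {1..} y *\<^sub>R (1 / y^2) + indicator {0..1} y))"
    by (subst integrable_restrict_space) auto
  show ?thesis
  proof (rule Bochner_Integration.integrable_bound[OF int assms(1)], rule AE_I2)
    fix y assume "y \<in> space pos_lborel"
    hence y: "y > 0" by (simp add: space_pos_lborel)
    have C: "0 \<le> C" using assms(2)[of 1] norm_ge_zero[of "f 1"] by linarith
    have "norm (f y) \<le> C * (indicator {1..} y *\<^sub>R (1 / y^2) + indicator {0..1} y)"
    proof (cases "y \<le> 1")
      case True
      have "norm (f y) \<le> C * 1" using assms(2) y True by simp
      also have "\<dots> \<le> C * (indicator {1..} y *\<^sub>R (1 / y^2) + indicator {0..1} y)"
        using C y True by (intro mult_left_mono) (auto simp: indicator_def)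
      finally show ?thesis .
    qed (use assms(3)[of y] in \<open>simp add: indicator_def\<close>)
    thus "norm (f y) \<le> norm (C * (indicator {1..} y *\<^sub>R (1 / y^2) + indicator {0..1} y))"
      by (rule order_trans) simp
  qed
qed

lemma exp_neg_le_inverse_square:
  assumes "(k::real) > 0" "y > 0"
  shows "exp (- k * y) \<le> (2 / k^2) / y^2"
proof -
  have "(k * y)^2 / 2 \<le> exp (k * y)"
    using exp_lower_Taylor_quadratic[of "k * y"] assms by (smt (verit) mult_pos_pos)
  thus ?thesis using assms by (simp add: exp_minus field_simps power_mult_distrib)
qed

lemma norm_sinh_le: "norm (sinh (z::complex)) \<le> exp \<bar>Re z\<bar>"
proof -
  have "norm (exp z - exp (- z)) \<le> norm (exp z) + norm (exp (- z))" by (rule norm_triangle_ineq4)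
  also have "\<dots> \<le> exp \<bar>Re z\<bar> + exp \<bar>Re z\<bar>" by (intro add_mono) auto
  finally show ?thesis by (simp add: sinh_def norm_mult)
qed

lemma sinh_of_real: "sinh (complex_of_real y) = of_real (sinh y)"
  by (simp add: sinh_def scaleR_conv_of_real exp_of_real flip: of_real_minus)

lemma cosh_of_real: "cosh (complex_of_real y) = of_real (cosh y)"
  by (simp add: cosh_def scaleR_conv_of_real exp_of_real flip: of_real_minus)

text \<open>The even Taylor terms of \<open>exp z\<close> and \<open>exp (- z)\<close> cancel. The
  cubic remainder is what makes the numerator of the kernel vanish to fourth order at 0.\<close>

lemma norm_sinh_minus_self_le: "norm (sinh (z::complex) - z) \<le> exp \<bar>Re z\<bar> * norm z ^ 3 / 2"
proof -
  have 1: "norm (exp z - (1 + z + z^2/2)) \<le> exp \<bar>Re z\<bar> * norm z ^ 3 / 2"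
    using Taylor_exp[of z 2] by (simp add: numeral_eq_Suc)
  have 2: "norm (exp (-z) - (1 - z + z^2/2)) \<le> exp \<bar>Re z\<bar> * norm z ^ 3 / 2"
    using Taylor_exp[of "-z" 2] by (simp add: numeral_eq_Suc)
  define A where "A = exp z - (1 + z + z^2/2)"
  define B where "B = exp (-z) - (1 - z + z^2/2)"
  have "sinh z - z = (A - B) / 2"
    by (simp add: A_def B_def sinh_def field_simps scaleR_conv_of_real)
  hence "norm (sinh z - z) = norm (A - B) / 2" by (simp only: norm_divide) simp
  also have "\<dots> \<le> (norm A + norm B) / 2"
    by (intro divide_right_mono norm_triangle_ineq4) auto
  also have "\<dots> \<le> (exp \<bar>Re z\<bar> * norm z ^ 3 / 2 + exp \<bar>Re z\<bar> * norm z ^ 3 / 2) / 2"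
    using 1 2 unfolding A_def B_def by (intro divide_right_mono add_mono) auto
  finally show ?thesis by simp
qed

lemma sinh_ge_self: "(y::real) \<ge> 0 \<Longrightarrow> sinh y \<ge> y"
proof -
  assume y: "y \<ge> 0"
  have "(\<lambda>y. sinh y - y) 0 \<le> (\<lambda>y. sinh y - y) y"
    by (rule DERIV_nonneg_imp_nondecreasing[OF y])
       (auto intro!: derivative_eq_intros exI simp: cosh_real_ge_1)
  thus ?thesis by simp
qed

lemma sinh_ge_exp:
  assumes "(y::real) \<ge> c" "c > 0"
  shows "sinh y \<ge> (1 - exp (-2*c)) / 2 * exp y"
proof -
  have "exp (-2*y) \<le> exp (-2*c)" using assms by simp
  hence "(1 - exp (-2*c)) / 2 * exp y \<le> (1 - exp (-2*y)) / 2 * exp y"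
    by (intro mult_right_mono divide_right_mono) auto
  also have "\<dots> = sinh y" by (simp add: sinh_def field_simps flip: exp_add)
  finally show ?thesis .
qed

text \<open>Twice the integrand of \<open>\<i> * hyp_gamma \<tau>\<close> for
  \<open>t = - \<tau>\<close>; with \<open>t > 0\<close> both factors of the denominator are
  positive.\<close>

definition gkern :: "real \<Rightarrow> real \<Rightarrow> complex \<Rightarrow> complex" where
  "gkern t y z = z / of_real y ^ 2 - sinh (of_real (t * y) * z) / of_real (y * sinh y * sinh (t * y))"

text \<open>Near 0 the denominator \<open>y^2 * sinh y * sinh (t * y)\<close> is at least
  \<open>t * y^4\<close>, and the numerator is of order \<open>y^4\<close>. For large
  \<open>y\<close>, growth \<open>exp (t * a * y)\<close> competes with
  \<open>exp ((1 + t) * y)\<close>, and \<open>a < 1 + 1 / t\<close> says that the gap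
  \<open>k\<close> is positive. Uniformity in \<open>z\<close> serves both holomorphy and growth
  estimates.\<close>

lemma gkern_bound:
  assumes t: "t > 0" and a: "a < 1 + 1 / t"
  obtains C where "\<And>y z. 0 < y \<Longrightarrow> y \<le> 1 \<Longrightarrow> norm z \<le> R \<Longrightarrow> norm (gkern t y z) \<le> C"
    "\<And>y z. y \<ge> 1 \<Longrightarrow> norm z \<le> R \<Longrightarrow> \<bar>Re z\<bar> \<le> a \<Longrightarrow> norm (gkern t y z) \<le> C / y^2"
proof -
  define c1 where "c1 = exp (1::real) / 2"
  define c2 where "c2 = exp t * t^3 / 2"
  define c4 where "c4 = exp (t * R) * (t * R)^3 / 2"
  define C1 where "C1 = (R * (c1 * (t + c2) + c2) + c4) / t"
  define k where "k = 1 + t - t * a"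
  define s1 where "s1 = (1 - exp (-2*1::real)) / 2"
  define s2 where "s2 = (1 - exp (-2*t)) / 2"
  define C2 where "C2 = R + 1 / (s1 * s2) * (2 / k^2)"
  have k: "k > 0" using t a by (simp add: k_def field_simps)
  have s12: "s1 > 0" "s2 > 0" using t by (auto simp: s1_def s2_def)
  have small: "norm (gkern t y z) \<le> C1" if y: "0 < y" "y \<le> 1" and z: "norm z \<le> R" for y z
  proof -
    have R: "0 \<le> R" using z norm_ge_zero[of z] by linarith
    have sy: "\<bar>sinh y - y\<bar> \<le> c1 * y^3"
    proof -
      have "\<bar>sinh y - y\<bar> \<le> exp y * y^3 / 2"
        using norm_sinh_minus_self_le[of "of_real y"] y(1)
        by (simp only: sinh_of_real norm_of_real flip: of_real_diff) simp
      also have "\<dots> \<le> exp 1 * y^3 / 2" using y by (intro divide_right_mono mult_right_mono) auto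
      finally show ?thesis by (simp add: c1_def)
    qed
    have st: "\<bar>sinh (t*y) - t*y\<bar> \<le> c2 * y^3"
    proof -
      have "\<bar>sinh (t*y) - t*y\<bar> \<le> exp (t*y) * (t*y)^3 / 2"
        using norm_sinh_minus_self_le[of "of_real (t*y)"] y(1) t
        by (simp only: sinh_of_real norm_of_real flip: of_real_diff) simp
      also have "\<dots> \<le> exp t * (t*y)^3 / 2"
        using y t by (intro divide_right_mono mult_right_mono) auto
      finally show ?thesis by (simp add: c2_def power_mult_distrib)
    qed
    have st': "\<bar>sinh (t*y)\<bar> \<le> (t + c2) * y"
    proof -
      have "c2 * y^3 \<le> c2 * y" using y t
        by (intro mult_left_mono) (auto simp: c2_def power3_eq_cube mult_le_one mult_left_le_one_le)
      moreover have "t * y > 0" using y t by simp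
      moreover have "(t + c2) * y = t * y + c2 * y" by (simp add: algebra_simps)
      ultimately show ?thesis using st by linarith
    qed
    have sz: "norm (sinh (of_real (t*y) * z) - of_real (t*y) * z) \<le> c4 * y^3"
    proof -
      have "\<bar>Re (of_real (t*y) * z)\<bar> \<le> norm (of_real (t*y) * z)" by (rule abs_Re_le_cmod)
      also have n: "\<dots> \<le> t * y * R" using y t z by (simp add: norm_mult mult_left_mono)
      also have "\<dots> \<le> t * R" using y t R by (simp add: mult_right_mono mult_left_le)
      finally have e: "exp \<bar>Re (of_real (t*y) * z)\<bar> \<le> exp (t * R)" by simp
      have "norm (sinh (of_real (t*y) * z) - of_real (t*y) * z) \<le> exp \<bar>Re (of_real (t*y) * z)\<bar> * norm (of_real (t*y) * z) ^ 3 / 2"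
        by (rule norm_sinh_minus_self_le)
      also have "\<dots> \<le> exp (t * R) * (t * y * R) ^ 3 / 2"
        using e n by (intro divide_right_mono mult_mono power_mono) auto
      finally show ?thesis by (simp add: c4_def power_mult_distrib mult_ac)
    qed
    have pos: "sinh y > 0" "sinh (t*y) > 0" using y t by auto
    \<comment> \<open>The term \<open>t * y^2 * z\<close> is subtracted in the first summand and
      restored in the second, which exhibits each of them as a difference of order
      \<open>y^4\<close>.\<close>
    define num where "num = z * of_real (sinh y * sinh (t*y) - t * y^2) - of_real y * (sinh (of_real (t*y) * z) - of_real (t*y) * z)"
    have eq: "gkern t y z = num / of_real (y^2 * sinh y * sinh (t*y))"
    proof -
      have gen: "z / Y^2 - W / (Y * S * S') = (z * S * S' - Y * W) / (Y^2 * S * S')"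
        if "Y \<noteq> 0" "S \<noteq> 0" "S' \<noteq> 0" for Y S S' W :: complex
        using that by (simp add: field_simps power2_eq_square)
      have "num = z * of_real (sinh y) * of_real (sinh (t*y)) - of_real y * sinh (of_real (t*y) * z)"
        by (simp add: num_def algebra_simps power2_eq_square)
      thus ?thesis
        using gen[of "of_real y" "of_real (sinh y)" "of_real (sinh (t*y))" "sinh (of_real (t*y) * z)"] pos y t
        by (simp only: gkern_def of_real_mult of_real_power) simp
    qed
    have "\<bar>sinh y * sinh (t*y) - t * y^2\<bar> = \<bar>(sinh y - y) * sinh (t*y) + y * (sinh (t*y) - t*y)\<bar>"
      by (simp add: algebra_simps power2_eq_square)
    also have "\<dots> \<le> \<bar>sinh y - y\<bar> * \<bar>sinh (t*y)\<bar> + \<bar>y\<bar> * \<bar>sinh (t*y) - t*y\<bar>"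
      unfolding abs_mult[symmetric] by (rule abs_triangle_ineq)
    also have "\<dots> \<le> (c1 * y^3) * ((t + c2) * y) + y * (c2 * y^3)"
      using y sy st st' by (intro add_mono mult_mono) (auto simp: c1_def)
    also have "\<dots> = (c1 * (t + c2) + c2) * y^4" by (simp add: algebra_simps numeral_eq_Suc)
    finally have 1: "\<bar>sinh y * sinh (t*y) - t * y^2\<bar> \<le> (c1 * (t + c2) + c2) * y^4" .
    have "norm num \<le> norm (z * of_real (sinh y * sinh (t*y) - t * y^2)) + norm (of_real y * (sinh (of_real (t*y) * z) - of_real (t*y) * z))"
      unfolding num_def by (rule norm_triangle_ineq4)
    also have "\<dots> = norm z * \<bar>sinh y * sinh (t*y) - t * y^2\<bar> + y * norm (sinh (of_real (t*y) * z) - of_real (t*y) * z)"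
      using y by (simp only: norm_mult norm_of_real abs_of_pos)
    also have "\<dots> \<le> R * ((c1 * (t + c2) + c2) * y^4) + y * (c4 * y^3)"
      using y z sz 1 R by (intro add_mono mult_mono) auto
    also have "\<dots> = C1 * (t * y^4)" using t by (simp add: C1_def field_simps numeral_eq_Suc)
    finally have 2: "norm num \<le> C1 * (t * y^4)" .
    have "t * y^4 = y^2 * y * (t*y)" by (simp add: numeral_eq_Suc)
    also have "\<dots> \<le> y^2 * sinh y * sinh (t*y)"
      using y t pos by (intro mult_mono sinh_ge_self) auto
    finally have 3: "t * y^4 \<le> y^2 * sinh y * sinh (t*y)" .
    have C1: "C1 \<ge> 0" using R t by (simp add: C1_def c1_def c2_def c4_def)
    have pos2: "y^2 * sinh y * sinh (t*y) > 0" using y pos by simp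
    have "norm (gkern t y z) = norm num / (y^2 * sinh y * sinh (t*y))"
      unfolding eq norm_divide norm_of_real using pos2 by simp
    also have "\<dots> \<le> C1"
      using order_trans[OF 2 mult_left_mono[OF 3 C1]] pos2 by (simp add: divide_le_eq)
    finally show ?thesis .
  qed
  have large: "norm (gkern t y z) \<le> C2 / y^2" if y: "y \<ge> 1" and z: "norm z \<le> R" "\<bar>Re z\<bar> \<le> a" for y z
  proof -
    have pos: "sinh y > 0" "sinh (t*y) > 0" using y t by auto
    have "norm (sinh (of_real (t*y) * z)) \<le> exp \<bar>Re (of_real (t*y) * z)\<bar>" by (rule norm_sinh_le)
    also have "\<bar>Re (of_real (t*y) * z)\<bar> = t * y * \<bar>Re z\<bar>" using y t by (simp add: abs_mult)
    also have "\<dots> \<le> t * y * a" using y t z by (intro mult_left_mono) auto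
    finally have 1: "norm (sinh (of_real (t*y) * z)) \<le> exp (t * y * a)" by simp
    have "(s1 * exp y) * (s2 * exp (t*y)) \<le> sinh y * sinh (t*y)"
      unfolding s1_def s2_def using y t s12 pos
      by (intro mult_mono sinh_ge_exp) (auto simp: s1_def s2_def)
    moreover have "1 * (sinh y * sinh (t*y)) \<le> y * (sinh y * sinh (t*y))"
      using y pos by (intro mult_right_mono) auto
    ultimately have 2: "s1 * s2 * exp (y + t*y) \<le> y * sinh y * sinh (t*y)" by (simp add: exp_add mult_ac)
    have "norm (sinh (of_real (t * y) * z) / of_real (y * sinh y * sinh (t * y)))
        = norm (sinh (of_real (t*y) * z)) / (y * sinh y * sinh (t*y))"
      unfolding norm_divide norm_of_real using y pos by simp
    also have "\<dots> \<le> exp (t*y*a) / (s1 * s2 * exp (y + t*y))"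
      using 1 2 s12 by (intro frac_le) auto
    also have "\<dots> = 1 / (s1 * s2) * exp (- k * y)"
      by (simp add: k_def algebra_simps exp_diff exp_add exp_minus divide_simps)
    also have "\<dots> \<le> 1 / (s1 * s2) * ((2 / k^2) / y^2)"
      using y s12 k by (intro mult_left_mono exp_neg_le_inverse_square) auto
    finally have 3: "norm (sinh (of_real (t * y) * z) / of_real (y * sinh y * sinh (t * y))) \<le> 1 / (s1 * s2) * (2 / k^2) / y^2"
      by simp
    have "norm (gkern t y z) \<le> norm (z / of_real y ^ 2) + norm (sinh (of_real (t * y) * z) / of_real (y * sinh y * sinh (t * y)))"
      unfolding gkern_def by (rule norm_triangle_ineq4)
    also have "\<dots> \<le> R / y^2 + 1 / (s1 * s2) * (2 / k^2) / y^2"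
      using 3 z y by (intro add_mono) (auto simp: norm_divide norm_power divide_right_mono)
    finally show ?thesis by (simp add: C2_def add_divide_distrib)
  qed
  show ?thesis
  proof (rule that[of "max C1 C2"])
    show "norm (gkern t y z) \<le> max C1 C2" if "0 < y" "y \<le> 1" "norm z \<le> R" for y z
      using small[OF that] by simp
    show "norm (gkern t y z) \<le> max C1 C2 / y^2" if "1 \<le> y" "norm z \<le> R" "\<bar>Re z\<bar> \<le> a" for y z
      using large[OF that] by (rule order_trans) (simp add: divide_right_mono)
  qed
qed

definition gexp :: "real \<Rightarrow> complex \<Rightarrow> complex" where
  "gexp t z = integral\<^sup>L pos_lborel (\<lambda>y. gkern t y z) / 2"

lemma gkern_measurable:
  assumes "t > 0"
  shows "(\<lambda>y. gkern t y z) \<in> borel_measurable pos_lborel"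
  by (rule pos_lborel_measurable)
     (use assms in \<open>auto simp: gkern_def intro!: continuous_intros\<close>)

lemma gkern_integrable:
  assumes "t > 0" "\<bar>Re z\<bar> < 1 + 1 / t"
  shows "integrable pos_lborel (\<lambda>y. gkern t y z)"
proof -
  obtain C where "\<And>y z'. 0 < y \<Longrightarrow> y \<le> 1 \<Longrightarrow> norm z' \<le> norm z \<Longrightarrow> norm (gkern t y z') \<le> C"
    "\<And>y z'. y \<ge> 1 \<Longrightarrow> norm z' \<le> norm z \<Longrightarrow> \<bar>Re z'\<bar> \<le> \<bar>Re z\<bar> \<Longrightarrow> norm (gkern t y z') \<le> C / y^2"
    by (rule gkern_bound[OF assms, of "norm z"], rule that)
  thus ?thesis by (intro pos_lborel_integrable[OF gkern_measurable[OF assms(1)], of z C]) auto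
qed

lemma gkern_holomorphic [holomorphic_intros]: "gkern t y holomorphic_on A"
  unfolding gkern_def sinh_def by (intro holomorphic_intros) auto

lemma pos_lborel_dominated:
  assumes "\<And>y x. 0 < y \<Longrightarrow> y \<le> 1 \<Longrightarrow> x \<in> B \<Longrightarrow> norm (F y x :: complex) \<le> C"
    "\<And>y x. y \<ge> 1 \<Longrightarrow> x \<in> B \<Longrightarrow> norm (F y x) \<le> C / y^2" "B \<noteq> {}"
  shows "\<exists>g. integrable pos_lborel g \<and> (\<forall>x\<in>B. \<forall>y\<in>space pos_lborel. norm (F y x) \<le> g y)"
proof (intro exI[of _ "\<lambda>y. min 1 (1 / y^2) * C"] conjI ballI)
  obtain x where x: "x \<in> B" using assms(3) by blast
  have C: "C \<ge> 0" using assms(1)[of 1 x] x norm_ge_zero[of "F 1 x"] by linarith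
  show "integrable pos_lborel (\<lambda>y. min 1 (1 / y^2) * C)"
  proof (rule pos_lborel_integrable)
    show "(\<lambda>y. min 1 (1 / y\<^sup>2) * C) \<in> borel_measurable pos_lborel"
      by (intro pos_lborel_measurable continuous_intros) auto
    show "norm (min 1 (1 / y\<^sup>2) * C) \<le> C" if "0 < y" "y \<le> 1" for y
      using that C by (simp add: mult_left_le_one_le min_def)
    show "norm (min 1 (1 / y\<^sup>2) * C) \<le> C / y^2" if "1 \<le> y" for y :: real
    proof -
      have "min 1 (1 / y\<^sup>2) * C \<le> 1 / y^2 * C" using C by (intro mult_right_mono) auto
      thus ?thesis using C by (simp add: abs_mult)
    qed
  qed
  fix x y assume "x \<in> B" "y \<in> space pos_lborel"
  thus "norm (F y x) \<le> min 1 (1 / y\<^sup>2) * C"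
  proof (cases "y \<le> 1")
    case True
    hence "y^2 \<le> 1" "y > 0" using \<open>y \<in> space pos_lborel\<close> by (auto simp: space_pos_lborel power_le_one)
    hence "min 1 (1 / y^2) = 1" by (simp add: min_def le_divide_eq)
    thus ?thesis using assms(1)[of y x] \<open>x \<in> B\<close> True \<open>y > 0\<close> by simp
  next
    case False
    hence "1 / y^2 \<le> 1" by (simp add: divide_le_eq)
    hence "min 1 (1 / y^2) = 1 / y^2" by simp
    thus ?thesis using assms(2)[of y x] \<open>x \<in> B\<close> False by simp
  qed
qed

lemma gexp_holomorphic:
  assumes t: "t > 0"
  shows "gexp t holomorphic_on {z. \<bar>Re z\<bar> < 1 + 1 / t}"
proof -
  have "(\<lambda>z. integral\<^sup>L pos_lborel (\<lambda>y. gkern t y z)) holomorphic_on {z. \<bar>Re z\<bar> < 1 + 1 / t}"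
  proof (rule holomorphic_lebesgue_integral)
    show "open {z. \<bar>Re z\<bar> < 1 + 1 / t}" by (intro open_Collect_less continuous_intros)
    show "gkern t y holomorphic_on {z. \<bar>Re z\<bar> < 1 + 1 / t}" for y by (rule gkern_holomorphic)
    show "(\<lambda>y. gkern t y z) \<in> borel_measurable pos_lborel" for z by (rule gkern_measurable[OF t])
    fix z assume z: "z \<in> {z. \<bar>Re z\<bar> < 1 + 1 / t}"
    define e where "e = (1 + 1 / t - \<bar>Re z\<bar>) / 2"
    have e: "e > 0" using z by (simp add: e_def)
    have a: "\<bar>Re z\<bar> + e < 1 + 1 / t" using e unfolding e_def by (simp add: field_simps)
    obtain C where C: "\<And>y z'. 0 < y \<Longrightarrow> y \<le> 1 \<Longrightarrow> norm z' \<le> norm z + e \<Longrightarrow> norm (gkern t y z') \<le> C"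
      "\<And>y z'. y \<ge> 1 \<Longrightarrow> norm z' \<le> norm z + e \<Longrightarrow> \<bar>Re z'\<bar> \<le> \<bar>Re z\<bar> + e \<Longrightarrow> norm (gkern t y z') \<le> C / y^2"
      by (rule gkern_bound[OF t a, of "norm z + e"], rule that)
    let ?B = "ball z e \<inter> {z. \<bar>Re z\<bar> < 1 + 1 / t}"
    have B: "norm z' \<le> norm z + e" "\<bar>Re z'\<bar> \<le> \<bar>Re z\<bar> + e" if "z' \<in> ?B" for z'
      using that norm_triangle_ineq2[of z' z] abs_Re_le_cmod[of "z - z'"] by (auto simp: dist_norm norm_minus_commute)
    have "\<exists>g. integrable pos_lborel g \<and> (\<forall>z'\<in>?B. \<forall>y\<in>space pos_lborel. norm (gkern t y z') \<le> g y)"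
      by (rule pos_lborel_dominated[of ?B _ C]) (use B C z centre_in_ball[of z e] e in \<open>blast+\<close>)
    thus "\<exists>e>0. \<exists>g. integrable pos_lborel g \<and> (\<forall>z'\<in>ball z e \<inter> {z. \<bar>Re z\<bar> < 1 + 1 / t}. \<forall>y\<in>space pos_lborel. norm (gkern t y z') \<le> g y)"
      using e by blast
  qed
  thus ?thesis unfolding gexp_def by (intro holomorphic_intros) auto
qed

lemma Re_sinh: "Re (sinh (z::complex)) = sinh (Re z) * cos (Im z)"
  by (simp add: sinh_def Re_exp field_simps)

lemma gexp_minus: "gexp t (- z) = - gexp t z"
proof -
  have "gkern t y (- z) = - gkern t y z" for y by (simp add: gkern_def)
  thus ?thesis by (simp add: gexp_def)
qed

lemma hyp_gamma_eq:
  assumes "\<tau> < 0"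
  shows "\<i> * hyp_gamma \<tau> z = gexp (- \<tau>) z"
proof -
  have eq: "1 / of_real y * (z / of_real y - sinh (of_real (\<tau> * y) * z) / (of_real (sinh y) * of_real (sinh (\<tau> * y))))
      = gkern (- \<tau>) y z" for y
  proof -
    have "sinh (of_real (\<tau> * y) * z) = - sinh (of_real (- \<tau> * y) * z)" "sinh (\<tau> * y) = - sinh (- \<tau> * y)"
      by (simp_all flip: sinh_minus)
    moreover have "1 / Y * (z / Y - (- W) / (A * (- B))) = z / Y^2 - W / (Y * A * B)" for W Y A B :: complex
      by (simp add: right_diff_distrib power2_eq_square)
    ultimately show ?thesis unfolding gkern_def by (simp only: of_real_mult of_real_minus)
  qed
  show ?thesis unfolding hyp_gamma_def eq gexp_def set_lebesgue_integral_def
    by (subst integral_restrict_space) auto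
qed

text \<open>The real part of the kernel on \<open>a + \<i> * b\<close> is \<open>a * (1 - cos (t * y * b)) / y^2\<close> plus
  \<open>cos (t * y * b)\<close> times the kernel at \<open>a\<close>, and the first integral is linear in \<open>\<bar>b\<bar>\<close> by scaling.\<close>

lemma one_minus_cos_integrable: "integrable pos_lborel (\<lambda>y. (1 - cos (c * y)) / y^2)"
proof (rule pos_lborel_integrable)
  show "(\<lambda>y. (1 - cos (c * y)) / y\<^sup>2) \<in> borel_measurable pos_lborel"
    by (intro pos_lborel_measurable continuous_intros) auto
  have nn: "0 \<le> 1 - cos (c * y)" for y by simp
  show "norm ((1 - cos (c * y)) / y\<^sup>2) \<le> max 2 (c^2 / 2)" if "0 < y" for y
  proof -
    have "1 - cos (c * y) = 2 * sin (c * y / 2) ^ 2"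
      using cos_double_sin[of "c * y / 2"] by simp
    also have "\<dots> \<le> 2 * \<bar>c * y / 2\<bar> ^ 2"
      using power_mono[OF abs_sin_x_le_abs_x abs_ge_zero, of "c * y / 2" 2] by simp
    finally have "1 - cos (c * y) \<le> c^2 / 2 * y^2" by (simp add: power_mult_distrib power_divide)
    also have "\<dots> \<le> max 2 (c^2 / 2) * y^2" by (intro mult_right_mono) auto
    finally show ?thesis using that nn by (simp add: divide_le_eq)
  qed
  show "norm ((1 - cos (c * y)) / y\<^sup>2) \<le> max 2 (c^2 / 2) / y^2" if "1 \<le> y" for y
  proof -
    have "1 - cos (c * y) \<le> max 2 (c^2 / 2)" using cos_ge_minus_one[of "c * y"] by linarith
    thus ?thesis using nn[of y] by (simp add: divide_right_mono)
  qed
qed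

lemma one_minus_cos_integral:
  "integral\<^sup>L pos_lborel (\<lambda>y. (1 - cos (c * y)) / y^2) = \<bar>c\<bar> * integral\<^sup>L pos_lborel (\<lambda>y. (1 - cos y) / y^2)"
proof (cases "c = 0")
  case False
  have "integral\<^sup>L lborel (\<lambda>y. indicator {0<..} y *\<^sub>R ((1 - cos y) / y^2))
      = \<bar>c\<bar> * integral\<^sup>L lborel (\<lambda>y. indicator {0<..} (\<bar>c\<bar> * y) *\<^sub>R ((1 - cos (\<bar>c\<bar> * y)) / (\<bar>c\<bar> * y)^2))"
    using lborel_integral_real_affine[of "\<bar>c\<bar>" "\<lambda>y. indicator {0<..} y *\<^sub>R ((1 - cos y) / y^2)" 0] False by simp
  also have "(\<lambda>y. indicator {0<..} (\<bar>c\<bar> * y) *\<^sub>R ((1 - cos (\<bar>c\<bar> * y)) / (\<bar>c\<bar> * y)^2))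
      = (\<lambda>y. (indicator {0<..} y *\<^sub>R ((1 - cos (c * y)) / y^2)) / c^2)"
  proof
    fix y
    have "cos (\<bar>c\<bar> * y) = cos (c * y)" by (cases "c \<ge> 0") auto
    thus "indicator {0<..} (\<bar>c\<bar> * y) *\<^sub>R ((1 - cos (\<bar>c\<bar> * y)) / (\<bar>c\<bar> * y)^2)
        = (indicator {0<..} y *\<^sub>R ((1 - cos (c * y)) / y^2)) / c^2"
      using False by (auto simp: indicator_def zero_less_mult_iff power_mult_distrib)
  qed
  also have "integral\<^sup>L lborel \<dots> = integral\<^sup>L lborel (\<lambda>y. indicator {0<..} y *\<^sub>R ((1 - cos (c * y)) / y^2)) / c^2"
    by (rule integral_divide_zero)
  finally have eq: "integral\<^sup>L lborel (\<lambda>y. indicator {0<..} y *\<^sub>R ((1 - cos y) / y^2))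
      = \<bar>c\<bar> * (integral\<^sup>L lborel (\<lambda>y. indicator {0<..} y *\<^sub>R ((1 - cos (c * y)) / y^2)) / c^2)" .
  have r: "integral\<^sup>L pos_lborel f = integral\<^sup>L lborel (\<lambda>y. indicator {0<..} y *\<^sub>R f y)" for f :: "real \<Rightarrow> real"
    by (rule integral_restrict_space) auto
  have "\<bar>c\<bar> * (\<bar>c\<bar> * (B / c^2)) = B" for B using False by (simp add: power2_eq_square abs_if)
  thus ?thesis unfolding r eq by (rule sym)
qed auto

text \<open>The integral of \<open>(1 - cos y) / y^2\<close> is left unevaluated; its value will be
  forced by the functional equation.\<close>

lemma gexp_Re_bound:
  assumes t: "t > 0" and a1: "a1 < 1 + 1 / t"
  obtains C where "\<And>z. \<bar>Re z\<bar> \<le> a1 \<Longrightarrow>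
    \<bar>Re (gexp t z) - t * integral\<^sup>L pos_lborel (\<lambda>y. (1 - cos y) / y^2) / 2 * Re z * \<bar>Im z\<bar>\<bar> \<le> C"
proof -
  obtain D where D: "\<And>y z. 0 < y \<Longrightarrow> y \<le> 1 \<Longrightarrow> norm z \<le> a1 \<Longrightarrow> norm (gkern t y z) \<le> D"
    "\<And>y z. y \<ge> 1 \<Longrightarrow> norm z \<le> a1 \<Longrightarrow> \<bar>Re z\<bar> \<le> a1 \<Longrightarrow> norm (gkern t y z) \<le> D / y^2"
    by (rule gkern_bound[OF t a1, of a1], rule that)
  define J where "J = integral\<^sup>L pos_lborel (\<lambda>y. (1 - cos y) / y^2)"
  show ?thesis
  proof (cases "a1 \<ge> 0")
    case True
    \<comment> \<open>The oscillating part involves the kernel at the real number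
      \<open>Re z\<close> only, so one majorant on a disc of radius \<open>a1\<close> gives a bound
      that does not depend on \<open>Im z\<close>.\<close>
    have "\<exists>g. integrable pos_lborel g \<and> (\<forall>z\<in>cball 0 a1. \<forall>y\<in>space pos_lborel. norm (gkern t y z) \<le> g y)"
      by (rule pos_lborel_dominated[of _ _ D]) (use D True in \<open>auto intro!: D order_trans[OF abs_Re_le_cmod]\<close>)
    then obtain g where g: "integrable pos_lborel g"
      "\<And>z y. z \<in> cball 0 a1 \<Longrightarrow> y \<in> space pos_lborel \<Longrightarrow> norm (gkern t y z) \<le> g y" by blast
    show ?thesis
    proof (rule that[of "integral\<^sup>L pos_lborel g / 2"])
      fix z assume z: "\<bar>Re z\<bar> \<le> a1"
      define a where "a = Re z"
      define b where "b = Im z"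
      have int: "integrable pos_lborel (\<lambda>y. gkern t y z)"
        by (rule gkern_integrable[OF t]) (use z a1 in auto)
      have int_a: "integrable pos_lborel (\<lambda>y. gkern t y (of_real a))"
        by (rule gkern_integrable[OF t]) (use z a1 in \<open>auto simp: a_def\<close>)
      have eq: "Re (gkern t y z) = a * ((1 - cos (t * b * y)) / y^2) + Re (gkern t y (of_real a)) * cos (t * b * y)"
        if "y \<in> space pos_lborel" for y
      proof -
        have y: "y > 0" using that by (simp add: space_pos_lborel)
        have "Re (sinh (of_real (t * y) * z)) = sinh (t * y * a) * cos (t * b * y)"
          unfolding Re_sinh by (simp add: a_def b_def mult_ac)
        moreover have "Re (sinh (of_real (t * y) * of_real a)) = sinh (t * y * a)"
          by (simp add: sinh_of_real flip: of_real_mult)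
        ultimately show ?thesis using y
          by (simp add: gkern_def a_def Re_divide_of_real field_simps flip: of_real_power of_real_mult)
      qed
      have int2: "integrable pos_lborel (\<lambda>y. Re (gkern t y (of_real a)) * cos (t * b * y))"
      proof (rule Bochner_Integration.integrable_bound[OF int_a])
        show "(\<lambda>y. Re (gkern t y (of_real a)) * cos (t * b * y)) \<in> borel_measurable pos_lborel"
          by (intro borel_measurable_times borel_measurable_Re[THEN measurable_compose_rev] pos_lborel_measurable
               gkern_measurable t continuous_intros | simp)+
        show "AE y in pos_lborel. norm (Re (gkern t y (of_real a)) * cos (t * b * y)) \<le> norm (gkern t y (of_real a))"
        proof (rule AE_I2)
          fix y
          have "\<bar>Re (gkern t y (of_real a))\<bar> * \<bar>cos (t * b * y)\<bar> \<le> norm (gkern t y (of_real a)) * 1"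
            by (intro mult_mono abs_Re_le_cmod) auto
          thus "norm (Re (gkern t y (of_real a)) * cos (t * b * y)) \<le> norm (gkern t y (of_real a))"
            by (simp add: abs_mult)
        qed
      qed
      have "Re (integral\<^sup>L pos_lborel (\<lambda>y. gkern t y z)) = integral\<^sup>L pos_lborel (\<lambda>y. Re (gkern t y z))"
        using int by simp
      also have "\<dots> = integral\<^sup>L pos_lborel (\<lambda>y. a * ((1 - cos (t * b * y)) / y^2) + Re (gkern t y (of_real a)) * cos (t * b * y))"
        by (intro Bochner_Integration.integral_cong refl eq)
      also have "\<dots> = a * integral\<^sup>L pos_lborel (\<lambda>y. (1 - cos (t * b * y)) / y^2) + integral\<^sup>L pos_lborel (\<lambda>y. Re (gkern t y (of_real a)) * cos (t * b * y))"
        by (subst Bochner_Integration.integral_add[OF integrable_mult_right[OF one_minus_cos_integrable] int2])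
           (simp only: integral_mult_right_zero)
      also have "integral\<^sup>L pos_lborel (\<lambda>y. (1 - cos (t * b * y)) / y^2) = t * \<bar>b\<bar> * J"
        unfolding one_minus_cos_integral[of "t * b"] J_def using t by (simp add: abs_mult)
      finally have "Re (gexp t z) - t * J / 2 * a * \<bar>b\<bar> = integral\<^sup>L pos_lborel (\<lambda>y. Re (gkern t y (of_real a)) * cos (t * b * y)) / 2"
        by (simp add: gexp_def add_divide_distrib mult_ac)
      also have "\<bar>\<dots>\<bar> \<le> integral\<^sup>L pos_lborel g / 2"
      proof -
        have "norm (integral\<^sup>L pos_lborel (\<lambda>y. Re (gkern t y (of_real a)) * cos (t * b * y))) \<le> integral\<^sup>L pos_lborel g"
        proof (rule Bochner_Integration.integral_norm_bound_integral[OF int2 g(1)])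
          fix y assume y: "y \<in> space pos_lborel"
          have "\<bar>Re (gkern t y (of_real a))\<bar> * \<bar>cos (t * b * y)\<bar> \<le> norm (gkern t y (of_real a)) * 1"
            by (intro mult_mono abs_Re_le_cmod) auto
          also have "\<dots> \<le> g y" using g(2)[OF _ y, of "of_real a"] z by (simp add: a_def)
          finally show "norm (Re (gkern t y (of_real a)) * cos (t * b * y)) \<le> g y" by (simp add: abs_mult)
        qed
        thus ?thesis by simp
      qed
      finally show "\<bar>Re (gexp t z) - t * integral\<^sup>L pos_lborel (\<lambda>y. (1 - cos y) / y^2) / 2 * Re z * \<bar>Im z\<bar>\<bar> \<le> integral\<^sup>L pos_lborel g / 2"
        by (simp add: J_def a_def b_def)
    qed
  qed (use that[of 0] in force)
qed

section \<open>The functional equation on the strip of convergence\<close>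

definition lkern :: "complex \<Rightarrow> real \<Rightarrow> complex" where
  "lkern a y = 1 / of_real y ^ 2 - cosh (a * of_real y) / of_real (y * sinh y)"

definition lam_int :: "complex \<Rightarrow> complex" where
  "lam_int a = integral\<^sup>L pos_lborel (lkern a)"

text \<open>By the addition theorem the difference of the two hyperbolic sines is
  \<open>2 * cosh (t * y * z) * sinh (t * y)\<close>; one denominator cancels and only the
  combination \<open>t * z\<close> survives.\<close>

lemma gkern_diff:
  assumes "t > 0" "y > 0"
  shows "gkern t y (z + 1) - gkern t y (z - 1) = 2 * lkern (of_real t * z) y"
proof -
  have nz: "complex_of_real (sinh y) \<noteq> 0" "complex_of_real (sinh (t * y)) \<noteq> 0" "complex_of_real y \<noteq> 0"
    using assms by auto
  have s: "sinh (of_real (t * y) * (z + 1)) - sinh (of_real (t * y) * (z - 1))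
      = 2 * cosh (of_real t * z * of_real y) * of_real (sinh (t * y))"
    by (simp add: ring_distribs sinh_add sinh_diff sinh_of_real cosh_of_real mult_ac flip: of_real_mult)
  have "gkern t y (z + 1) - gkern t y (z - 1)
      = 2 / of_real y ^ 2 - (sinh (of_real (t * y) * (z + 1)) - sinh (of_real (t * y) * (z - 1))) / of_real (y * sinh y * sinh (t * y))"
    unfolding gkern_def diff_divide_distrib by (simp add: add_divide_distrib)
  also have "\<dots> = 2 * lkern (of_real t * z) y"
    unfolding s lkern_def using nz by (simp add: field_simps)
  finally show ?thesis .
qed

text \<open>For \<open>t = 1\<close> the kernel is half a difference of two values of
  \<open>gkern\<close>, and \<open>a + 1\<close>, \<open>a - 1\<close> lie in its strip of half
  width 2, so no new estimate is needed.\<close>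

lemma lkern_integrable:
  assumes "\<bar>Re a\<bar> < 1"
  shows "integrable pos_lborel (lkern a)"
proof -
  have "integrable pos_lborel (\<lambda>y. (gkern 1 y (a + 1) - gkern 1 y (a - 1)) / 2)"
    by (intro integrable_divide Bochner_Integration.integrable_diff gkern_integrable) (use assms in auto)
  thus ?thesis
    by (subst (asm) Bochner_Integration.integrable_cong[OF refl, of _ _ "lkern a"])
       (auto simp: space_pos_lborel gkern_diff)
qed

lemma gexp_diff:
  assumes "t > 0" "\<bar>Re z\<bar> < 1 / t"
  shows "gexp t (z + 1) - gexp t (z - 1) = lam_int (of_real t * z)"
proof -
  have "gexp t (z + 1) - gexp t (z - 1) = integral\<^sup>L pos_lborel (\<lambda>y. gkern t y (z + 1) - gkern t y (z - 1)) / 2"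
    unfolding gexp_def
    by (subst Bochner_Integration.integral_diff) (use assms in \<open>auto intro!: gkern_integrable simp: diff_divide_distrib\<close>)
  also have "integral\<^sup>L pos_lborel (\<lambda>y. gkern t y (z + 1) - gkern t y (z - 1)) = integral\<^sup>L pos_lborel (\<lambda>y. 2 * lkern (of_real t * z) y)"
    by (intro Bochner_Integration.integral_cong refl gkern_diff) (use assms in \<open>auto simp: space_pos_lborel\<close>)
  finally show ?thesis by (simp add: lam_int_def)
qed

lemma norm_one_minus_cosh_le: "norm (1 - cosh (u::complex)) \<le> norm u * exp \<bar>Re u\<bar>"
proof -
  have "norm (cosh 0 - cosh u) \<le> exp \<bar>Re u\<bar> * norm (0 - u)"
  proof (rule field_differentiable_bound[of "closed_segment 0 u"])
    fix z assume "z \<in> closed_segment 0 u"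
    then obtain s where s: "0 \<le> s" "s \<le> 1" "z = of_real s * u"
      by (auto simp: closed_segment_def scaleR_conv_of_real)
    hence "\<bar>Re z\<bar> \<le> \<bar>Re u\<bar>" by (simp add: abs_mult mult_left_le_one_le)
    thus "norm (sinh z) \<le> exp \<bar>Re u\<bar>" using norm_sinh_le[of z] by (meson exp_le_cancel_iff order_trans)
  qed (auto intro!: derivative_eq_intros)
  thus ?thesis by (simp add: mult.commute)
qed

lemma integral_exp_neg:
  fixes s :: complex
  assumes "Re s > 0"
  shows "integrable pos_lborel (\<lambda>y. exp (- s * of_real y))" "integral\<^sup>L pos_lborel (\<lambda>y. exp (- s * of_real y)) = 1 / s"
proof -
  show int: "integrable pos_lborel (\<lambda>y. exp (- s * of_real y))"
  proof (rule pos_lborel_integrable)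
    show "(\<lambda>y. exp (- s * of_real y)) \<in> borel_measurable pos_lborel"
      by (intro pos_lborel_measurable continuous_intros)
    show "norm (exp (- s * of_real y)) \<le> max 1 (2 / (Re s)^2)" if "0 < y" "y \<le> 1" for y
      using that assms by (auto simp: le_max_iff_disj)
    show "norm (exp (- s * of_real y)) \<le> max 1 (2 / (Re s)^2) / y^2" if "1 \<le> y" for y
    proof -
      have "norm (exp (- s * of_real y)) \<le> 2 / (Re s)^2 / y^2"
        using exp_neg_le_inverse_square[OF assms, of y] that by simp
      also have "\<dots> \<le> max 1 (2 / (Re s)^2) / y^2" by (intro divide_right_mono) auto
      finally show ?thesis .
    qed
  qed
  have ei: "einterval 0 \<infinity> = {0<..}" by (auto simp: einterval_def)
  have s0: "s \<noteq> 0" using assms by auto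
  have "(LBINT y=0..\<infinity>. exp (- s * of_real y)) = 0 - (- 1 / s)"
  proof (rule interval_integral_FTC_integrable)
    show "((\<lambda>y. - exp (- s * of_real y) / s) has_vector_derivative exp (- s * of_real y)) (at y)" for y
      using s0 by (auto intro!: derivative_eq_intros has_vector_derivative_real_field)
    show "set_integrable lborel (einterval 0 \<infinity>) (\<lambda>y. exp (- s * of_real y))"
      unfolding ei set_integrable_def using int by (subst (asm) integrable_restrict_space) auto
    have "((\<lambda>y. - exp (- s * of_real y) / s) \<longlongrightarrow> - exp (- s * of_real 0) / s) (at_right 0)"
      by (intro tendsto_intros) (use s0 in auto)
    thus "(((\<lambda>y. - exp (- s * of_real y) / s) \<circ> real_of_ereal) \<longlongrightarrow> - 1 / s) (at_right 0)"
      by (simp add: zero_ereal_def ereal_tendsto_simps)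
    have "((\<lambda>y. exp (- Re s * y)) \<longlongrightarrow> 0) at_top"
      using assms by real_asymp
    hence "((\<lambda>y. - exp (- s * of_real y) / s) \<longlongrightarrow> 0) at_top"
      by (intro tendsto_divide_zero tendsto_minus_cancel_left[THEN iffD1])
         (auto intro!: tendsto_norm_zero_cancel[of "\<lambda>y. exp (- (s * of_real y))"])
    thus "(((\<lambda>y. - exp (- s * of_real y) / s) \<circ> real_of_ereal) \<longlongrightarrow> 0) (at_left \<infinity>)"
      by (simp add: ereal_tendsto_simps)
  qed (auto intro!: continuous_intros)
  thus "integral\<^sup>L pos_lborel (\<lambda>y. exp (- s * of_real y)) = 1 / s"
    by (subst integral_restrict_space)
       (auto simp: interval_lebesgue_integral_def ei set_lebesgue_integral_def)
qed

text \<open>Differentiation in \<open>a\<close> removes the factor \<open>1 / y\<close> and leaves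
  two elementary exponential integrals, whose sum \<open>1 / (n + a) - 1 / (n - a)\<close> is the
  logarithmic derivative of \<open>1 - a^2 / n^2\<close>.\<close>

lemma exp_frullani_cosh:
  assumes n: "n > 0" and a: "\<bar>Re a\<bar> < n"
  defines "f \<equiv> \<lambda>y a. 2 * (1 - cosh (a * of_real y)) * of_real (exp (- n * y) / y)"
  shows "integrable pos_lborel (\<lambda>y. f y a)" "exp (integral\<^sup>L pos_lborel (\<lambda>y. f y a)) = 1 - a^2 / of_real n ^ 2"
proof -
  define A where "A = {a::complex. \<bar>Re a\<bar> < n}"
  have A: "open A" "convex A"
  proof -
    show "open A" unfolding A_def by (intro open_Collect_less continuous_intros)
    have "A = {a. Re a < n} \<inter> {a. Re a > - n}" by (auto simp: A_def)
    thus "convex A" by (simp add: convex_halfspace_Re_lt convex_halfspace_Re_gt convex_Int)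
  qed
  have bd: "norm (f y b) \<le> 2 * r * exp (- (n - q) * y)" if "y > 0" "norm b \<le> r" "\<bar>Re b\<bar> \<le> q" for y b r q
  proof -
    have "norm (f y b) = 2 * norm (1 - cosh (b * of_real y)) * (exp (- n * y) / y)"
      unfolding f_def norm_mult norm_of_real using that by simp
    also have "\<dots> \<le> 2 * (norm (b * of_real y) * exp \<bar>Re (b * of_real y)\<bar>) * (exp (- n * y) / y)"
      using that by (intro mult_right_mono mult_left_mono norm_one_minus_cosh_le) auto
    also have "\<dots> = 2 * norm b * (exp \<bar>Re (b * of_real y)\<bar> * exp (- n * y))"
      using that by (simp add: norm_mult)
    also have "\<dots> \<le> 2 * r * (exp (q * y) * exp (- n * y))"
      using that by (intro mult_mono mult_right_mono) (auto simp: abs_mult intro: order_trans[OF norm_ge_zero])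
    finally show ?thesis by (simp add: algebra_simps flip: exp_add)
  qed
  have bd1: "norm (f y b) \<le> 2 * r * max 1 (2 / (n - q)^2)"
    if "0 < y" "y \<le> 1" "norm b \<le> r" "\<bar>Re b\<bar> \<le> q" "q < n" for y b r q
  proof -
    have "norm (f y b) \<le> 2 * r * exp (- (n - q) * y)" by (rule bd) (use that in auto)
    also have "\<dots> \<le> 2 * r * max 1 (2 / (n - q)^2)"
    proof (rule mult_left_mono)
      have "(n - q) * y \<ge> 0" using that by simp
      hence "exp (- (n - q) * y) \<le> 1" by (simp only: mult_minus_left exp_le_one_iff neg_le_0_iff_le)
      thus "exp (- (n - q) * y) \<le> max 1 (2 / (n - q)^2)" by (rule le_max_iff_disj[THEN iffD2, OF disjI1])
      show "0 \<le> 2 * r" using that(3) norm_ge_zero[of b] by linarith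
    qed
    finally show ?thesis .
  qed
  have bd2: "norm (f y b) \<le> 2 * r * max 1 (2 / (n - q)^2) / y^2"
    if "1 \<le> y" "norm b \<le> r" "\<bar>Re b\<bar> \<le> q" "q < n" for y b r q
  proof -
    have r: "0 \<le> r" using that(2) norm_ge_zero order_trans by blast
    have "norm (f y b) \<le> 2 * r * exp (- (n - q) * y)" by (rule bd) (use that in auto)
    also have "\<dots> \<le> 2 * r * (2 / (n - q)^2 / y^2)"
      using that r by (intro mult_left_mono exp_neg_le_inverse_square) auto
    also have "\<dots> \<le> 2 * r * (max 1 (2 / (n - q)^2) / y^2)"
      using r by (intro mult_left_mono divide_right_mono) auto
    finally show ?thesis by simp
  qed
  have meas: "(\<lambda>y. f y b) \<in> borel_measurable pos_lborel" for b
    unfolding f_def cosh_def by (intro pos_lborel_measurable continuous_intros) auto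
  show int: "integrable pos_lborel (\<lambda>y. f y a)"
    by (rule pos_lborel_integrable[OF meas, of _ "2 * norm a * max 1 (2 / (n - \<bar>Re a\<bar>)^2)"])
       (use bd1[of _ a "norm a" "\<bar>Re a\<bar>"] bd2[of _ a "norm a" "\<bar>Re a\<bar>"] a in auto)
  have fd: "(f y has_field_derivative (exp (- (of_real n + b) * of_real y) - exp (- (of_real n - b) * of_real y))) (at b)"
    if "y > 0" for y b
  proof -
    have "(f y has_field_derivative 2 * (- (sinh (b * of_real y) * of_real y)) * of_real (exp (- n * y) / y)) (at b)"
      unfolding f_def by (auto intro!: derivative_eq_intros)
    also have "2 * (- (sinh (b * of_real y) * of_real y)) * of_real (exp (- n * y) / y)
        = exp (- (of_real n + b) * of_real y) - exp (- (of_real n - b) * of_real y)"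
      using that by (simp add: sinh_def scaleR_conv_of_real field_simps exp_of_real flip: exp_add of_real_mult)
        (simp add: exp_add exp_diff exp_minus field_simps flip: exp_of_real)
    finally show ?thesis .
  qed
  have W: "((\<lambda>b. integral\<^sup>L pos_lborel (\<lambda>y. f y b)) has_field_derivative (1 / (of_real n + b) - 1 / (of_real n - b))) (at b)"
    if b: "b \<in> A" for b
  proof -
    have "((\<lambda>b. integral\<^sup>L pos_lborel (\<lambda>y. f y b)) has_field_derivative integral\<^sup>L pos_lborel (\<lambda>y. deriv (f y) b)) (at b)"
    proof (rule has_field_derivative_lebesgue_integral[OF A(1) _ meas _ b])
      show "f y holomorphic_on A" for y
        unfolding f_def cosh_def by (intro holomorphic_intros)
      fix x assume x: "x \<in> A"
      define e where "e = (n - \<bar>Re x\<bar>) / 2"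
      have e: "e > 0" using x by (simp add: e_def A_def)
      have q: "\<bar>Re x\<bar> + e < n" using e unfolding e_def by (simp add: field_simps)
      have B: "norm z' \<le> norm x + e" "\<bar>Re z'\<bar> \<le> \<bar>Re x\<bar> + e" if "z' \<in> ball x e \<inter> A" for z'
        using that norm_triangle_ineq2[of z' x] abs_Re_le_cmod[of "x - z'"] by (auto simp: dist_norm norm_minus_commute)
      have "\<exists>g. integrable pos_lborel g \<and> (\<forall>z'\<in>ball x e \<inter> A. \<forall>y\<in>space pos_lborel. norm (f y z') \<le> g y)"
      proof (rule pos_lborel_dominated)
        show "ball x e \<inter> A \<noteq> {}" using x e centre_in_ball[of x e] by blast
      qed (use B q bd1 bd2 in blast)+
      thus "\<exists>e>0. \<exists>g. integrable pos_lborel g \<and> (\<forall>z'\<in>ball x e \<inter> A. \<forall>y\<in>space pos_lborel. norm (f y z') \<le> g y)"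
        using e by blast
    qed
    also have "integral\<^sup>L pos_lborel (\<lambda>y. deriv (f y) b)
        = integral\<^sup>L pos_lborel (\<lambda>y. exp (- (of_real n + b) * of_real y) - exp (- (of_real n - b) * of_real y))"
      by (intro Bochner_Integration.integral_cong refl DERIV_imp_deriv fd) (simp add: space_pos_lborel)
    also have "\<dots> = 1 / (of_real n + b) - 1 / (of_real n - b)"
    proof -
      have "Re (of_real n + b) > 0" "Re (of_real n - b) > 0" using b by (auto simp: A_def)
      note i = this[THEN integral_exp_neg(1)] this[THEN integral_exp_neg(2)]
      show ?thesis unfolding Bochner_Integration.integral_diff[OF i(1,2)] i(3,4) ..
    qed
    finally show ?thesis .
  qed
  \<comment> \<open>Dividing by the exponential instead of taking a logarithm avoids branches:
    \<open>E\<close> has derivative 0 on the convex strip and value 1 at 0.\<close>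
  define E where "E = (\<lambda>b. exp (- integral\<^sup>L pos_lborel (\<lambda>y. f y b)) * (1 - b^2 / of_real n ^ 2))"
  have "(E has_field_derivative 0) (at b within A)" if b: "b \<in> A" for b
  proof -
    have nz: "of_real n + b \<noteq> 0" "of_real n - b \<noteq> 0" "complex_of_real n \<noteq> 0"
    proof -
      show "of_real n + b \<noteq> 0"
      proof
        assume "of_real n + b = 0"
        hence "Re (of_real n + b) = 0" by simp
        thus False using b by (simp add: A_def)
      qed
      show "of_real n - b \<noteq> 0" using b by (auto simp: A_def)
    qed (use n in auto)
    define w where "w = 1 / (of_real n + b) - 1 / (of_real n - b)"
    have "(E has_field_derivative
        exp (- integral\<^sup>L pos_lborel (\<lambda>y. f y b)) * (- w) * (1 - b^2 / of_real n ^ 2)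
        + exp (- integral\<^sup>L pos_lborel (\<lambda>y. f y b)) * (- (2 * b / of_real n ^ 2))) (at b)"
    proof -
      have d1: "((\<lambda>b. exp (- integral\<^sup>L pos_lborel (\<lambda>y. f y b))) has_field_derivative
          exp (- integral\<^sup>L pos_lborel (\<lambda>y. f y b)) * (- w)) (at b)"
        using DERIV_chain2[OF DERIV_exp DERIV_minus[OF W[OF b]]] by (simp add: w_def)
      have "((\<lambda>b. (1 - b^2 / c)) has_field_derivative - (2 * b / c)) (at b)" if "c \<noteq> 0" for c :: complex
        using that by (auto intro!: derivative_eq_intros simp: power2_eq_square)
      hence d2: "((\<lambda>b. 1 - b^2 / of_real n ^ 2) has_field_derivative - (2 * b / of_real n ^ 2)) (at b)"
        using nz by simp
      show ?thesis unfolding E_def using DERIV_mult[OF d1 d2] by (simp add: mult_ac)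
    qed
    also have "exp (- integral\<^sup>L pos_lborel (\<lambda>y. f y b)) * (- w) * (1 - b^2 / of_real n ^ 2)
        + exp (- integral\<^sup>L pos_lborel (\<lambda>y. f y b)) * (- (2 * b / of_real n ^ 2)) =
        exp (- integral\<^sup>L pos_lborel (\<lambda>y. f y b)) * (- w * (1 - b^2 / of_real n ^ 2) - 2 * b / of_real n ^ 2)"
      by (simp add: algebra_simps)
    also have "- w * (1 - b^2 / of_real n ^ 2) - 2 * b / of_real n ^ 2 = 0"
    proof -
      have "1 - b^2 / of_real n ^ 2 = (of_real n + b) * (of_real n - b) / of_real n ^ 2"
        using nz by (simp add: field_simps power2_eq_square)
      moreover have "w * ((of_real n + b) * (of_real n - b)) = - 2 * b"
      proof -
        have "(1 / u - 1 / v) * (u * v) = v - u" if "u \<noteq> 0" "v \<noteq> 0" for u v :: complex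
          using that by (simp add: field_simps)
        from this[OF nz(1,2)] show ?thesis by (simp add: w_def)
      qed
      ultimately show ?thesis by (simp flip: mult.assoc times_divide_eq_right) (simp add: divide_simps)
    qed
    finally show ?thesis by (simp add: has_field_derivative_at_within)
  qed
  from has_field_derivative_zero_constant[OF A(2) this] obtain c where c: "\<And>b. b \<in> A \<Longrightarrow> E b = c" by blast
  have "f y 0 = 0" for y by (simp add: f_def)
  hence "E 0 = 1" by (simp add: E_def)
  hence "E a = 1" using c[of 0] c[of a] a n by (simp add: A_def)
  thus "exp (integral\<^sup>L pos_lborel (\<lambda>y. f y a)) = 1 - a^2 / of_real n ^ 2"
    by (simp add: E_def exp_minus field_simps)
qed

text \<open>Partial sums of the geometric expansion of \<open>1 / sinh y\<close>; the odd exponents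
  become the odd numbers in the product formula of the cosine.\<close>

lemma sum_exp_odd:
  assumes "y > 0"
  shows "(\<Sum>k<m. 2 * exp (- real (2 * k + 1) * y)) = (1 - exp (- real (2 * m) * y)) / sinh y"
proof (induction m)
  case (Suc m)
  have "2 * exp (- real (2 * m + 1) * y) * sinh y = exp (- real (2 * m) * y) - exp (- real (2 * Suc m) * y)"
    by (simp add: sinh_def algebra_simps flip: exp_add)
  thus ?case using Suc assms by (simp add: field_simps)
qed auto

text \<open>\<open>cos (pi * a / 2) = sin (pi * a) / (2 * sin (pi * a / 2))\<close>, and in the
  quotient of the two sine products the factors with even index cancel. At \<open>a = 0\<close> the
  quotient is undefined and the claim trivial.\<close>

lemma cos_product:
  fixes a :: complex
  assumes "\<bar>Re a\<bar> < 1"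
  shows "(\<lambda>m. \<Prod>k<m. 1 - a^2 / of_nat (2 * k + 1) ^ 2) \<longlonglongrightarrow> cos (of_real pi * a / 2)"
proof (cases "a = 0")
  case False
  define P where "P = (\<lambda>m z. of_real pi * z * (\<Prod>k=1..m. 1 - z^2 / of_nat k^2 :: complex))"
  have lim: "(\<lambda>m. P m z) \<longlonglongrightarrow> sin (of_real pi * z)" for z
    unfolding P_def by (rule sin_product_formula_complex)
  have P2: "P (2 * m) a = 2 * P m (a / 2) * (\<Prod>k<m. 1 - a^2 / of_nat (2 * k + 1) ^ 2)" for m
  proof (induction m)
    case (Suc m)
    have "P (2 * Suc m) a = P (2 * m) a * (1 - a^2 / of_nat (2 * m + 1) ^ 2) * (1 - a^2 / of_nat (2 * m + 2) ^ 2)"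
      by (simp add: P_def mult_ac)
    moreover have "P (Suc m) (a / 2) = P m (a / 2) * (1 - (a / 2)^2 / of_nat (Suc m) ^ 2)"
      by (simp add: P_def)
    moreover have "(a / 2)^2 / of_nat (Suc m) ^ 2 = a^2 / of_nat (2 * m + 2) ^ 2"
    proof -
      have "complex_of_nat (2 * m + 2) = 2 * of_nat (Suc m)" by simp
      thus ?thesis by (simp only: power_mult_distrib power_divide) simp
    qed
    ultimately show ?case using Suc by simp
  qed (simp add: P_def)
  have nz: "sin (of_real pi * (a / 2)) \<noteq> 0"
  proof
    assume "sin (of_real pi * (a / 2)) = 0"
    then obtain k :: int where "of_real pi * (a / 2) = of_real (of_int k * pi)" by (auto simp: sin_eq_0)
    hence a: "a = of_int (2 * k)" by (simp add: field_simps)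
    hence "\<bar>2 * real_of_int k\<bar> < 1" using assms by simp
    hence "k = 0" by linarith
    thus False using a False by simp
  qed
  have "(\<lambda>m. P (2 * m) a) \<longlonglongrightarrow> sin (of_real pi * a)"
    using LIMSEQ_subseq_LIMSEQ[OF lim, of "\<lambda>m. 2 * m" a] by (simp add: o_def strict_mono_def)
  hence "(\<lambda>m. P (2 * m) a / (2 * P m (a / 2))) \<longlonglongrightarrow> sin (of_real pi * a) / (2 * sin (of_real pi * (a / 2)))"
    by (intro tendsto_intros lim) (use nz in auto)
  also have "sin (of_real pi * a) / (2 * sin (of_real pi * (a / 2))) = cos (of_real pi * a / 2)"
    using sin_double[of "of_real pi * (a / 2)"] nz by (simp add: field_simps)
  finally have L: "(\<lambda>m. P (2 * m) a / (2 * P m (a / 2))) \<longlonglongrightarrow> cos (of_real pi * a / 2)" .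
  have "eventually (\<lambda>m. P m (a / 2) \<noteq> 0) sequentially"
    using lim[of "a / 2"] nz by (rule tendsto_imp_eventually_ne)
  hence "eventually (\<lambda>m. P (2 * m) a / (2 * P m (a / 2)) = (\<Prod>k<m. 1 - a^2 / of_nat (2 * k + 1) ^ 2)) sequentially"
    by eventually_elim (simp add: P2)
  thus ?thesis using L by (rule Lim_transform_eventually[rotated])
qed auto

text \<open>Subtracting the value at 0 removes \<open>1 / y^2\<close>. Expanding
  \<open>1 / sinh y\<close> in odd exponentials gives Frullani integrals, whose exponentials
  multiply up to the cosine product. The partial sums are the limit \<open>D\<close> times a factor
  in \<open>[0, 1]\<close>, so \<open>D\<close> itself dominates.\<close>

lemma exp_lam_int_diff:
  assumes a: "\<bar>Re a\<bar> < 1"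
  shows "exp (lam_int a - lam_int 0) = cos (of_real pi * a / 2)"
proof -
  define W where "W = (\<lambda>k y. 2 * (1 - cosh (a * of_real y)) * of_real (exp (- real (2 * k + 1) * y) / y))"
  define D where "D = (\<lambda>y. lkern a y - lkern 0 y)"
  have D: "D y = (1 - cosh (a * of_real y)) / of_real (y * sinh y)" if "y > 0" for y
    by (simp add: D_def lkern_def diff_divide_distrib)
  have intD: "integrable pos_lborel D"
    unfolding D_def by (intro Bochner_Integration.integrable_diff lkern_integrable) (use a in auto)
  have W: "integrable pos_lborel (W k)" "exp (integral\<^sup>L pos_lborel (W k)) = 1 - a^2 / of_nat (2 * k + 1) ^ 2" for k
    using exp_frullani_cosh[of "real (2 * k + 1)" a] a unfolding W_def by auto
  have sumW: "(\<Sum>k<m. W k y) = (1 - exp (- real (2 * m) * y)) *\<^sub>R D y" if y: "y > 0" for m y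
  proof -
    have "(\<Sum>k<m. W k y) = (1 - cosh (a * of_real y)) / of_real y * of_real (\<Sum>k<m. 2 * exp (- real (2 * k + 1) * y))"
      unfolding W_def of_real_sum sum_distrib_left by (intro sum.cong) auto
    also have "\<dots> = (1 - exp (- real (2 * m) * y)) *\<^sub>R D y"
      unfolding sum_exp_odd[OF y] D[OF y] by (simp add: scaleR_conv_of_real)
    finally show ?thesis .
  qed
  have "(\<lambda>m. integral\<^sup>L pos_lborel (\<lambda>y. \<Sum>k<m. W k y)) \<longlonglongrightarrow> integral\<^sup>L pos_lborel D"
  proof (rule integral_dominated_convergence[where w = "\<lambda>y. norm (D y)"])
    show "AE y in pos_lborel. (\<lambda>m. \<Sum>k<m. W k y) \<longlonglongrightarrow> D y"
    proof (rule AE_I2)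
      fix y assume "y \<in> space pos_lborel"
      hence y: "y > 0" by (simp add: space_pos_lborel)
      have "(\<lambda>m. exp (- real (2 * m) * y)) \<longlonglongrightarrow> 0" using y by real_asymp
      hence "(\<lambda>m. (1 - exp (- real (2 * m) * y)) *\<^sub>R D y) \<longlonglongrightarrow> (1 - 0) *\<^sub>R D y" by (intro tendsto_intros)
      thus "(\<lambda>m. \<Sum>k<m. W k y) \<longlonglongrightarrow> D y" by (simp add: sumW[OF y])
    qed
    show "AE y in pos_lborel. norm (\<Sum>k<m. W k y) \<le> norm (D y)" for m
    proof (rule AE_I2)
      fix y assume "y \<in> space pos_lborel"
      hence y: "y > 0" by (simp add: space_pos_lborel)
      have "\<bar>1 - exp (- real (2 * m) * y)\<bar> \<le> 1" using y by auto
      thus "norm (\<Sum>k<m. W k y) \<le> norm (D y)" unfolding sumW[OF y] by (simp add: mult_left_le_one_le)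
    qed
    show "(\<lambda>y. \<Sum>k<m. W k y) \<in> borel_measurable pos_lborel" for m
      using W(1) by (intro borel_measurable_sum borel_measurable_integrable)
  qed (use intD in auto)
  hence "(\<lambda>m. exp (integral\<^sup>L pos_lborel (\<lambda>y. \<Sum>k<m. W k y))) \<longlonglongrightarrow> exp (integral\<^sup>L pos_lborel D)"
    by (intro tendsto_intros)
  also have "(\<lambda>m. exp (integral\<^sup>L pos_lborel (\<lambda>y. \<Sum>k<m. W k y))) = (\<lambda>m. \<Prod>k<m. 1 - a^2 / of_nat (2 * k + 1) ^ 2)"
    by (rule ext, subst Bochner_Integration.integral_sum) (use W in \<open>auto simp: exp_sum\<close>)
  finally have "exp (integral\<^sup>L pos_lborel D) = cos (of_real pi * a / 2)"
    using cos_product[OF a] LIMSEQ_unique by blast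
  moreover have "integral\<^sup>L pos_lborel D = lam_int a - lam_int 0"
    unfolding D_def lam_int_def
    by (rule Bochner_Integration.integral_diff) (use a in \<open>auto intro: lkern_integrable\<close>)
  ultimately show ?thesis by simp
qed

text \<open>Since \<open>lam_int 0 = 2 * lam_int (1 / 2)\<close> by rescaling, the constant is fixed by the value \<open>cos (pi / 4) ^ 2 = 1 / 2\<close>.\<close>

lemma exp_lam_int:
  assumes a: "\<bar>Re a\<bar> < 1"
  shows "exp (lam_int a) = 2 * cos (of_real pi * a / 2)"
proof -
  have "integral\<^sup>L lborel (\<lambda>y. indicator {0<..} y *\<^sub>R lkern 0 y)
      = \<bar>1/2\<bar> *\<^sub>R integral\<^sup>L lborel (\<lambda>y. indicator {0<..} (0 + (1/2) * y) *\<^sub>R lkern 0 (0 + (1/2) * y))"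
    by (rule lborel_integral_real_affine) auto
  also have "\<dots> = integral\<^sup>L lborel (\<lambda>y. (1/2) *\<^sub>R (indicator {0<..} (0 + (1/2) * y) *\<^sub>R lkern 0 (0 + (1/2) * y)))"
    by (subst integral_scaleR_right) auto
  also have "(\<lambda>y. (1/2) *\<^sub>R (indicator {0<..} (0 + (1/2) * y) *\<^sub>R lkern 0 (0 + (1/2) * y)))
      = (\<lambda>y. indicator {0<..} y *\<^sub>R (2 * lkern (1/2) y))"
  proof
    fix y :: real
    show "(1/2) *\<^sub>R (indicator {0<..} (0 + (1/2) * y) *\<^sub>R lkern 0 (0 + (1/2) * y)) = indicator {0<..} y *\<^sub>R (2 * lkern (1/2) y)"
    proof (cases "y > 0")
      case True
      have "sinh y = 2 * sinh (y / 2) * cosh (y / 2)" using sinh_double[of "y / 2"] by simp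
      moreover have "cosh ((1/2) * of_real y) = complex_of_real (cosh (y / 2))"
        by (simp flip: cosh_of_real)
      moreover have "complex_of_real (sinh (y / 2)) \<noteq> 0" "complex_of_real (cosh (y / 2)) \<noteq> 0" using True by auto
      ultimately show ?thesis using True
        by (simp add: lkern_def scaleR_conv_of_real field_simps power2_eq_square indicator_def)
    qed (auto simp: indicator_def)
  qed
  finally have eq: "integral\<^sup>L lborel (\<lambda>y. indicator {0<..} y *\<^sub>R lkern 0 y)
      = integral\<^sup>L lborel (\<lambda>y. indicator {0<..} y *\<^sub>R (2 * lkern (1/2) y))" .
  have "lam_int 0 = 2 * lam_int (1/2)"
  proof -
    have r: "integral\<^sup>L pos_lborel f = integral\<^sup>L lborel (\<lambda>y. indicator {0<..} y *\<^sub>R f y)" for f :: "real \<Rightarrow> complex"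
      by (rule integral_restrict_space) auto
    have "2 * lam_int (1/2) = integral\<^sup>L pos_lborel (\<lambda>y. 2 * lkern (1/2) y)" by (simp add: lam_int_def)
    thus ?thesis using eq unfolding lam_int_def r by simp
  qed
  \<comment> \<open>Once the first square is known to be 1/2, this reads \<open>E = E^2 / 2\<close>
    for \<open>E = exp (lam_int 0)\<close>, and \<open>E\<close> is not zero.\<close>
  hence "exp (lam_int 0) = exp (lam_int (1/2) - lam_int 0) ^ 2 * exp (lam_int 0) ^ 2"
    by (simp add: power2_eq_square flip: exp_add)
  also have "exp (lam_int (1/2) - lam_int 0) = of_real (cos (pi / 4))"
    by (subst exp_lam_int_diff) (auto simp flip: cos_of_real)
  also have "\<dots> ^ 2 = 1 / 2" by (simp add: cos_45 power_divide flip: of_real_power)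
  finally have "exp (lam_int 0) * 2 = exp (lam_int 0) * exp (lam_int 0)" by (simp add: power2_eq_square)
  hence "exp (lam_int 0) = 2" by (metis exp_not_eq_zero mult_left_cancel)
  thus ?thesis using exp_lam_int_diff[OF a] by (simp add: exp_diff field_simps)
qed

theorem exp_gexp_shift:
  assumes "t > 0" "\<bar>Re z\<bar> < 1 / t"
  shows "exp (gexp t (z + 1)) = 2 * cos (of_real (pi * t) * z / 2) * exp (gexp t (z - 1))"
proof -
  have "\<bar>Re (of_real t * z)\<bar> < 1" using assms by (simp add: abs_mult field_simps)
  from exp_lam_int[OF this] gexp_diff[OF assms]
  have "exp (gexp t (z + 1) - gexp t (z - 1)) = 2 * cos (of_real (pi * t) * z / 2)" by (simp add: mult.assoc)
  thus ?thesis by (simp add: exp_diff field_simps)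
qed

section \<open>Extension of the gamma function from the strip to the plane\<close>

definition cosfac :: "real \<Rightarrow> complex \<Rightarrow> complex" where
  "cosfac \<tau> u = 2 * cos (of_real pi * u * of_real \<tau> / 2)"

lemma cosfac_minus [simp]: "cosfac \<tau> (- u) = cosfac \<tau> u"
  by (simp add: cosfac_def)

lemma cosfac_holomorphic [holomorphic_intros]:
  "f holomorphic_on A \<Longrightarrow> (\<lambda>z. cosfac \<tau> (f z)) holomorphic_on A"
  unfolding cosfac_def by (intro holomorphic_intros) auto

text \<open>The zeros are the odd multiples of \<open>1 / \<tau>\<close>.\<close>

lemma cosfac_zero:
  assumes "\<tau> < 0" "cosfac \<tau> u = 0"
  shows "Im u = 0" "\<bar>Re u\<bar> \<ge> - 1 / \<tau>"
proof -
  obtain n :: int where "of_real pi * u * of_real \<tau> / 2 = of_real (of_int n * pi) + of_real pi / 2"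
    using assms(2) by (auto simp: cosfac_def cos_eq_0)
  hence "complex_of_real pi * (u * of_real \<tau>) = of_real pi * (2 * of_int n + 1)"
    by (simp add: field_simps)
  hence "u * of_real \<tau> = of_real (2 * of_int n + 1)" by simp
  hence u: "u = of_real ((2 * of_int n + 1) / \<tau>)" using assms(1) by (simp add: field_simps)
  show "Im u = 0" unfolding u by (rule Im_complex_of_real)
  have "1 \<le> \<bar>2 * n + 1\<bar>" by presburger
  hence "(1::real) \<le> \<bar>2 * of_int n + 1\<bar>" by linarith
  hence "1 / \<bar>\<tau>\<bar> \<le> \<bar>2 * of_int n + 1\<bar> / \<bar>\<tau>\<bar>" by (intro divide_right_mono) auto
  thus "\<bar>Re u\<bar> \<ge> - 1 / \<tau>" using assms(1) unfolding u by (simp add: abs_divide)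
qed

text \<open>In \<open>hyp_G\<close> the number of shifts is a rounded real part, which jumps at the
  lines where \<open>Re z\<close> is an odd integer. With \<open>n\<close> as a free parameter the
  formula can be kept fixed in a neighbourhood of such a line.\<close>

definition hyp_G_strip :: "real \<Rightarrow> int \<Rightarrow> complex \<Rightarrow> complex" where
  "hyp_G_strip \<tau> n z = exp (gexp (- \<tau>) (z - 2 * of_int n))
     * (\<Prod>k<nat n. cosfac \<tau> (z - 2 * of_int n + 2 * of_nat k + 1))
     / (\<Prod>k<nat (- n). cosfac \<tau> (z - 2 * of_int n - 2 * of_nat k - 1))"

lemma hyp_G_conv_strip: "\<tau> < 0 \<Longrightarrow> hyp_G \<tau> z = hyp_G_strip \<tau> (round (Re z / 2)) z"
  by (simp add: hyp_G_def hyp_G_strip_def Let_def hyp_gamma_eq cosfac_def)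

lemma hyp_G_strip_Suc:
  assumes \<tau>: "\<tau> < 0" and z: "\<bar>Re z - 2 * of_int n - 1\<bar> < - 1 / \<tau>"
  shows "hyp_G_strip \<tau> (n + 1) z = hyp_G_strip \<tau> n z"
proof -
  define u where "u = z - 2 * of_int n - 1"
  have g: "exp (gexp (- \<tau>) (z - 2 * of_int n)) = cosfac \<tau> u * exp (gexp (- \<tau>) (z - 2 * of_int (n + 1)))"
    using exp_gexp_shift[of "- \<tau>" u] \<tau> z cosfac_minus[of \<tau> u]
    by (simp add: u_def cosfac_def algebra_simps)
  have nz: "cosfac \<tau> u \<noteq> 0" using cosfac_zero(2)[OF \<tau>, of u] z by (auto simp: u_def)
  show ?thesis
  proof (cases "n \<ge> 0")
    case True
    hence "nat (n + 1) = Suc (nat n)" by simp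
    hence "(\<Prod>k<nat (n + 1). cosfac \<tau> (z - 2 * of_int (n + 1) + 2 * of_nat k + 1))
       = cosfac \<tau> u * (\<Prod>k<nat n. cosfac \<tau> (z - 2 * of_int n + 2 * of_nat k + 1))"
      by (simp only: prod.lessThan_Suc_shift) (simp add: u_def algebra_simps)
    thus ?thesis using True unfolding hyp_G_strip_def g by simp
  next
    case False
    hence "nat (- n) = Suc (nat (- (n + 1)))" by simp
    hence "(\<Prod>k<nat (- n). cosfac \<tau> (z - 2 * of_int n - 2 * of_nat k - 1))
       = cosfac \<tau> u * (\<Prod>k<nat (- (n + 1)). cosfac \<tau> (z - 2 * of_int (n + 1) - 2 * of_nat k - 1))"
      by (simp only: prod.lessThan_Suc_shift) (simp add: u_def algebra_simps)
    thus ?thesis using False nz unfolding hyp_G_strip_def g by simp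
  qed
qed

lemma abs_diff_round_half: "\<bar>x - 2 * of_int (round (x / 2))\<bar> \<le> (1::real)"
  using of_int_round_abs_le[of "x / 2"] by linarith

text \<open>The bound 2 in the minimum keeps \<open>n\<close> within one of the rounded index, and
  the bound \<open>- 1 / \<tau>\<close> puts \<open>z\<close> into the range where the functional
  equation identifies the two neighbouring formulas.\<close>

lemma hyp_G_eq_strip:
  assumes \<tau>: "\<tau> < 0" and z: "\<bar>Re z - 2 * of_int n\<bar> < 1 + min 2 (- 1 / \<tau>)"
  shows "hyp_G \<tau> z = hyp_G_strip \<tau> n z"
proof -
  define m where "m = round (Re z / 2)"
  have m: "\<bar>Re z - 2 * of_int m\<bar> \<le> 1"
    unfolding m_def by (rule abs_diff_round_half)
  have "\<bar>2 * real_of_int n - 2 * real_of_int m\<bar> < 4" using m z by linarith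
  hence "\<bar>real_of_int (n - m)\<bar> < 2" by simp
  hence "\<bar>n - m\<bar> < 2" by linarith
  then consider "m = n" | "m = n + 1" | "n = m + 1" by linarith
  hence "hyp_G_strip \<tau> m z = hyp_G_strip \<tau> n z"
  proof cases
    case 2
    have "\<bar>Re z - 2 * of_int n - 1\<bar> < - 1 / \<tau>" using m z \<tau> unfolding 2 by (auto simp: abs_less_iff abs_le_iff)
    thus ?thesis unfolding 2 by (rule hyp_G_strip_Suc[OF \<tau>])
  next
    case 3
    have "\<bar>Re z - 2 * of_int m - 1\<bar> < - 1 / \<tau>" using m z \<tau> unfolding 3 by (auto simp: abs_less_iff abs_le_iff)
    thus ?thesis unfolding 3 by (rule hyp_G_strip_Suc[OF \<tau>, symmetric])
  qed auto
  thus ?thesis using hyp_G_conv_strip[OF \<tau>] by (simp add: m_def)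
qed

lemma hyp_G_near:
  assumes "\<tau> < 0"
  obtains n U where "open U" "z \<in> U" "\<bar>Re z - 2 * of_int n\<bar> \<le> 1"
    "\<And>w. w \<in> U \<Longrightarrow> \<bar>Re w - 2 * of_int n\<bar> < 1 - 1 / \<tau> \<and> hyp_G \<tau> w = hyp_G_strip \<tau> n w"
proof (rule that)
  let ?n = "round (Re z / 2)"
  let ?U = "{w. \<bar>Re w - 2 * of_int ?n\<bar> < 1 + min 2 (- 1 / \<tau>)}"
  show "open ?U" by (intro open_Collect_less continuous_intros)
  show n: "\<bar>Re z - 2 * of_int ?n\<bar> \<le> 1"
    by (rule abs_diff_round_half)
  have "0 < min 2 (- 1 / \<tau>)" using assms by simp
  thus "z \<in> ?U" using n by (simp only: mem_Collect_eq)
  fix w assume "w \<in> ?U"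
  thus "\<bar>Re w - 2 * of_int ?n\<bar> < 1 - 1 / \<tau> \<and> hyp_G \<tau> w = hyp_G_strip \<tau> ?n w"
    using hyp_G_eq_strip[OF assms] by auto
qed

text \<open>The exponent is odd and the two cosine products are exchanged. Rounding is not odd at
  half integers, so the index used by \<open>hyp_G\<close> at \<open>- z\<close> need not be
  \<open>- n\<close>; the overlap of the strips takes care of this. The value 0 at poles fits
  \<open>inverse 0 = 0\<close>.\<close>

lemma hyp_G_minus:
  assumes \<tau>: "\<tau> < 0"
  shows "hyp_G \<tau> (- z) = inverse (hyp_G \<tau> z)"
proof -
  define n where "n = round (Re z / 2)"
  have n: "\<bar>Re z - 2 * of_int n\<bar> \<le> 1"
    unfolding n_def by (rule abs_diff_round_half)
  moreover have "0 < min 2 (- 1 / \<tau>)" using \<tau> by simp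
  moreover have "\<bar>Re (- z) - 2 * of_int (- n)\<bar> = \<bar>Re z - 2 * of_int n\<bar>" by simp
  ultimately have "\<bar>Re (- z) - 2 * of_int (- n)\<bar> < 1 + min 2 (- 1 / \<tau>)" by linarith
  from hyp_G_eq_strip[OF \<tau> this] have "hyp_G \<tau> (- z) = hyp_G_strip \<tau> (- n) (- z)" .
  also have "\<dots> = inverse (hyp_G_strip \<tau> n z)"
  proof -
    have "cosfac \<tau> (- z - 2 * of_int (- n) + 2 * of_nat k + 1) = cosfac \<tau> (z - 2 * of_int n - 2 * of_nat k - 1)" for k
      using cosfac_minus[of \<tau> "z - 2 * of_int n - 2 * of_nat k - 1"] by (simp add: algebra_simps)
    moreover have "cosfac \<tau> (- z - 2 * of_int (- n) - 2 * of_nat k - 1) = cosfac \<tau> (z - 2 * of_int n + 2 * of_nat k + 1)" for k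
      using cosfac_minus[of \<tau> "z - 2 * of_int n + 2 * of_nat k + 1"] by (simp add: algebra_simps)
    moreover have "gexp (- \<tau>) (- z - 2 * of_int (- n)) = - gexp (- \<tau>) (z - 2 * of_int n)"
      using gexp_minus[of "- \<tau>" "z - 2 * of_int n"] by (simp add: algebra_simps)
    ultimately show ?thesis
      by (simp add: hyp_G_strip_def exp_minus divide_inverse mult_ac)
  qed
  finally show ?thesis by (simp add: hyp_G_conv_strip[OF \<tau>] n_def)
qed

lemma hyp_G_nonzero:
  assumes \<tau>: "\<tau> < 0" and z: "Im z \<noteq> 0 \<or> \<bar>Re z\<bar> < 1 - 1 / \<tau>"
  shows "hyp_G \<tau> z \<noteq> 0"
proof -
  obtain n U where nU: "z \<in> U" "\<bar>Re z - 2 * of_int n\<bar> \<le> 1"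
    "\<And>w. w \<in> U \<Longrightarrow> \<bar>Re w - 2 * of_int n\<bar> < 1 - 1 / \<tau> \<and> hyp_G \<tau> w = hyp_G_strip \<tau> n w"
    by (rule hyp_G_near[OF \<tau>], rule that)
  have "cosfac \<tau> (z - 2 * of_int n + 2 * of_nat k + 1) \<noteq> 0" if k: "k < nat n" for k
  proof
    assume "cosfac \<tau> (z - 2 * of_int n + 2 * of_nat k + 1) = 0"
    from cosfac_zero[OF \<tau> this]
    have "Im z = 0" "\<bar>Re z - 2 * of_int n + 2 * of_nat k + 1\<bar> \<ge> - 1 / \<tau>" by simp_all
    moreover have "real k \<le> of_int n - 1" using k by linarith
    ultimately show False using z nU(2) by linarith
  qed
  moreover have "cosfac \<tau> (z - 2 * of_int n - 2 * of_nat k - 1) \<noteq> 0" if k: "k < nat (- n)" for k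
  proof
    assume "cosfac \<tau> (z - 2 * of_int n - 2 * of_nat k - 1) = 0"
    from cosfac_zero[OF \<tau> this]
    have "Im z = 0" "\<bar>Re z - 2 * of_int n - 2 * of_nat k - 1\<bar> \<ge> - 1 / \<tau>" by simp_all
    moreover have "real k \<le> - of_int n - 1" using k by linarith
    ultimately show False using z nU(2) by linarith
  qed
  ultimately have "hyp_G_strip \<tau> n z \<noteq> 0" by (auto simp: hyp_G_strip_def)
  thus ?thesis using nU by simp
qed

lemma gexp_strip_holomorphic:
  assumes "\<tau> < 0"
  shows "(\<lambda>z. exp (gexp (- \<tau>) (z - 2 * of_int n))) holomorphic_on {z. \<bar>Re z - 2 * of_int n\<bar> < 1 - 1 / \<tau>}"
proof -
  have "(\<lambda>z. gexp (- \<tau>) (z - 2 * of_int n)) holomorphic_on {z. \<bar>Re z - 2 * of_int n\<bar> < 1 - 1 / \<tau>}"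
    by (rule holomorphic_on_compose_gen[of "\<lambda>z. z - 2 * of_int n" _ "gexp (- \<tau>)" "{z. \<bar>Re z\<bar> < 1 + 1 / (- \<tau>)}", unfolded o_def])
       (use assms gexp_holomorphic[of "- \<tau>"] in \<open>auto intro!: holomorphic_intros\<close>)
  thus ?thesis by (intro holomorphic_intros)
qed

text \<open>Poles arise from the cosine factors in the denominator only. These occur for negative
  \<open>n\<close>, and their zeros are real and at most \<open>- 1 + 1 / \<tau>\<close>.\<close>

lemma hyp_G_holomorphic:
  assumes \<tau>: "\<tau> < 0"
  shows "hyp_G \<tau> holomorphic_on {z. Im z \<noteq> 0 \<or> Re z > - 1 + 1 / \<tau>}"
proof -
  have "hyp_G \<tau> field_differentiable (at z)" if z: "Im z \<noteq> 0 \<or> Re z > - 1 + 1 / \<tau>" for z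
  proof -
    obtain n U where nU: "open U" "z \<in> U" "\<bar>Re z - 2 * of_int n\<bar> \<le> 1"
      "\<And>w. w \<in> U \<Longrightarrow> \<bar>Re w - 2 * of_int n\<bar> < 1 - 1 / \<tau> \<and> hyp_G \<tau> w = hyp_G_strip \<tau> n w"
      by (rule hyp_G_near[OF \<tau>], rule that)
    define D where "D = (\<lambda>w. \<Prod>k<nat (- n). cosfac \<tau> (w - 2 * of_int n - 2 * of_nat k - 1))"
    have hD: "D holomorphic_on UNIV" unfolding D_def by (intro holomorphic_intros)
    have Dz: "D z \<noteq> 0"
    proof
      assume "D z = 0"
      then obtain k where k: "k < nat (- n)" "cosfac \<tau> (z - 2 * of_int n - 2 * of_nat k - 1) = 0" by (auto simp: D_def)
      from cosfac_zero[OF \<tau> this(2)]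
      have "Im z = 0" "\<bar>Re z - 2 * of_int n - 2 * of_nat k - 1\<bar> \<ge> - 1 / \<tau>" by simp_all
      moreover have "real k \<le> - of_int n - 1" using k by linarith
      ultimately show False using z nU(3) by linarith
    qed
    define V where "V = U \<inter> D -` (- {0})"
    have V: "open V" "z \<in> V"
    proof -
      have "open (D -` (- {0}))"
        using holomorphic_on_imp_continuous_on[OF hD] by (intro open_vimage) auto
      thus "open V" unfolding V_def using nU(1) by auto
    qed (use nU Dz in \<open>auto simp: V_def\<close>)
    have "(\<lambda>w. exp (gexp (- \<tau>) (w - 2 * of_int n)) * (\<Prod>k<nat n. cosfac \<tau> (w - 2 * of_int n + 2 * of_nat k + 1)) / D w) holomorphic_on V"
      by (intro holomorphic_intros holomorphic_on_subset[OF gexp_strip_holomorphic[OF \<tau>, of n]] holomorphic_on_subset[OF hD])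
         (use nU(4) in \<open>auto simp: V_def\<close>)
    hence "hyp_G_strip \<tau> n holomorphic_on V" unfolding hyp_G_strip_def[abs_def] D_def .
    hence "hyp_G \<tau> holomorphic_on V"
      by (rule holomorphic_transform) (use nU(4) in \<open>auto simp: V_def\<close>)
    thus ?thesis using V by (metis at_within_open holomorphic_on_def)
  qed
  thus ?thesis unfolding holomorphic_on_def by (auto intro: field_differentiable_at_within)
qed

lemma hyp_G_meromorphic:
  assumes \<tau>: "\<tau> < 0"
  shows "hyp_G \<tau> meromorphic_on UNIV"
proof -
  have "hyp_G \<tau> meromorphic_on {z}" for z
  proof -
    obtain n U where nU: "open U" "z \<in> U" "\<bar>Re z - 2 * of_int n\<bar> \<le> 1"
      "\<And>w. w \<in> U \<Longrightarrow> \<bar>Re w - 2 * of_int n\<bar> < 1 - 1 / \<tau> \<and> hyp_G \<tau> w = hyp_G_strip \<tau> n w"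
      by (rule hyp_G_near[OF \<tau>], rule that)
    have op: "open {z. \<bar>Re z - 2 * of_int n\<bar> < 1 - 1 / \<tau>}" by (intro open_Collect_less continuous_intros)
    have "(\<lambda>z. exp (gexp (- \<tau>) (z - 2 * of_int n))) meromorphic_on {z}"
    proof (rule analytic_on_imp_meromorphic_on)
      have "(\<lambda>z. exp (gexp (- \<tau>) (z - 2 * of_int n))) analytic_on {z. \<bar>Re z - 2 * of_int n\<bar> < 1 - 1 / \<tau>}"
        unfolding analytic_on_open[OF op] by (rule gexp_strip_holomorphic[OF \<tau>])
      thus "(\<lambda>z. exp (gexp (- \<tau>) (z - 2 * of_int n))) analytic_on {z}"
        by (rule analytic_on_subset) (use nU(4)[OF nU(2)] in auto)
    qed
    moreover have "(\<lambda>z. cosfac \<tau> (z - a)) meromorphic_on {z}" "(\<lambda>z. cosfac \<tau> (z - a + b + 1)) meromorphic_on {z}"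
      "(\<lambda>z. cosfac \<tau> (z - a - b - 1)) meromorphic_on {z}" for a b
      by (intro analytic_on_imp_meromorphic_on holomorphic_on_imp_analytic_at[OF _ open_UNIV] holomorphic_intros; simp)+
    ultimately have "hyp_G_strip \<tau> n meromorphic_on {z}"
      unfolding hyp_G_strip_def[abs_def] by (intro meromorphic_intros)
    moreover have "eventually (\<lambda>w. w \<in> U) (nhds z)" using nU by (intro eventually_nhds_in_open)
    hence "eventually (\<lambda>w. hyp_G_strip \<tau> n w = hyp_G \<tau> w) (at z)"
      unfolding eventually_at_filter by eventually_elim (use nU(4) in auto)
    ultimately show ?thesis by (subst (asm) meromorphic_on_cong[where g = "hyp_G \<tau>" and B = "{z}"]) auto
  qed
  thus ?thesis by (metis meromorphic_on_meromorphic_at)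
qed

text \<open>The condition on the cosine factor excludes points such as
  \<open>z = - 1 + 1 / \<tau>\<close>, a pole with assigned value 0, while the function does not
  vanish at \<open>z + 2\<close>.\<close>

lemma hyp_G_shift:
  assumes \<tau>: "\<tau> < 0" and z: "cosfac \<tau> (z + 1) \<noteq> 0"
  shows "hyp_G \<tau> (z + 2) = cosfac \<tau> (z + 1) * hyp_G \<tau> z"
proof -
  define n where "n = round (Re z / 2)"
  have "round (Re (z + 2) / 2) = n + 1"
  proof -
    have "Re (z + 2) / 2 + 1 / 2 = (Re z / 2 + 1 / 2) + of_int 1" by (simp add: add_divide_distrib)
    thus ?thesis unfolding n_def round_def by (simp only: floor_add_int)
  qed
  hence "hyp_G \<tau> (z + 2) = hyp_G_strip \<tau> (n + 1) (z + 2)" by (simp add: hyp_G_conv_strip[OF \<tau>])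
  also have "\<dots> = cosfac \<tau> (z + 1) * hyp_G_strip \<tau> n z"
  proof (cases "n \<ge> 0")
    case True
    hence "nat (n + 1) = Suc (nat n)" by simp
    thus ?thesis using True unfolding hyp_G_strip_def by (simp add: algebra_simps)
  next
    case False
    hence "nat (- n) = Suc (nat (- (n + 1)))" by simp
    moreover have "z - 2 * of_int n - 2 * of_nat (nat (- (n + 1))) - 1 = z + 1"
      using False by (simp add: of_nat_nat)
    ultimately show ?thesis using False z unfolding hyp_G_strip_def
      by (simp add: algebra_simps)
  qed
  finally show ?thesis by (simp add: hyp_G_conv_strip[OF \<tau>] n_def)
qed

section \<open>Growth of the gamma function in vertical directions\<close>

lemma norm_cosfac_bounds:
  assumes "\<tau> < 0" "\<bar>Im u\<bar> \<ge> 1"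
  shows "(1 - exp (pi * \<tau>)) * exp (- pi * \<tau> / 2 * \<bar>Im u\<bar>) \<le> norm (cosfac \<tau> u)"
    "norm (cosfac \<tau> u) \<le> 2 * exp (- pi * \<tau> / 2 * \<bar>Im u\<bar>)"
proof -
  define w where "w = \<i> * (of_real pi * u * of_real \<tau> / 2)"
  have c: "cosfac \<tau> u = exp w + exp (- w)" by (simp add: cosfac_def w_def cos_exp_eq)
  have Rw: "\<bar>Re w\<bar> = - pi * \<tau> / 2 * \<bar>Im u\<bar>" using assms(1) by (simp add: w_def abs_mult)
  have n: "norm (exp w) = exp (Re w)" "norm (exp (- w)) = exp (- Re w)" by simp_all
  have "norm (exp w + exp (- w)) \<le> norm (exp w) + norm (exp (- w))" by (rule norm_triangle_ineq)
  also have "\<dots> \<le> 2 * exp \<bar>Re w\<bar>" unfolding n by (cases "Re w \<ge> 0") auto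
  finally show "norm (cosfac \<tau> u) \<le> 2 * exp (- pi * \<tau> / 2 * \<bar>Im u\<bar>)" unfolding c Rw .
  have "norm (exp w) - norm (exp (- w)) \<le> norm (exp w + exp (- w))"
    "norm (exp (- w)) - norm (exp w) \<le> norm (exp w + exp (- w))"
    using norm_diff_ineq[of "exp w" "exp (- w)"] norm_diff_ineq[of "exp (- w)" "exp w"] by (auto simp: add.commute)
  hence 1: "exp \<bar>Re w\<bar> - exp (- \<bar>Re w\<bar>) \<le> norm (cosfac \<tau> u)" unfolding c n by (cases "Re w \<ge> 0") auto
  have "pi * \<tau> * \<bar>Im u\<bar> \<le> pi * \<tau> * 1"
    using assms by (intro mult_left_mono_neg) (auto simp: mult_nonneg_nonpos)
  hence "- \<bar>Re w\<bar> \<le> pi * \<tau> + \<bar>Re w\<bar>" unfolding Rw by simp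
  hence "exp (- \<bar>Re w\<bar>) \<le> exp (pi * \<tau>) * exp \<bar>Re w\<bar>" by (simp flip: exp_add)
  hence "(1 - exp (pi * \<tau>)) * exp \<bar>Re w\<bar> \<le> norm (cosfac \<tau> u)" using 1 by (simp add: algebra_simps)
  thus "(1 - exp (pi * \<tau>)) * exp (- pi * \<tau> / 2 * \<bar>Im u\<bar>) \<le> norm (cosfac \<tau> u)" unfolding Rw .
qed

lemma ln_norm_cosfac_bound:
  assumes "\<tau> < 0"
  obtains B where "\<And>u. \<bar>Im u\<bar> \<ge> 1 \<Longrightarrow> cosfac \<tau> u \<noteq> 0 \<and> \<bar>ln (norm (cosfac \<tau> u)) + pi * \<tau> / 2 * \<bar>Im u\<bar>\<bar> \<le> B"
proof -
  define d where "d = 1 - exp (pi * \<tau>)"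
  have d: "d > 0" using assms by (simp add: d_def mult_pos_neg)
  have "cosfac \<tau> u \<noteq> 0 \<and> \<bar>ln (norm (cosfac \<tau> u)) + pi * \<tau> / 2 * \<bar>Im u\<bar>\<bar> \<le> max (- ln d) (ln 2)" if u: "\<bar>Im u\<bar> \<ge> 1" for u
  proof -
    note b = norm_cosfac_bounds[OF assms u, folded d_def]
    have "0 < d * exp (- pi * \<tau> / 2 * \<bar>Im u\<bar>)" using d by simp
    hence pos: "norm (cosfac \<tau> u) > 0" using b(1) by linarith
    have "ln (d * exp (- pi * \<tau> / 2 * \<bar>Im u\<bar>)) \<le> ln (norm (cosfac \<tau> u))"
      using b(1) d pos by (subst ln_le_cancel_iff) auto
    moreover have "ln (norm (cosfac \<tau> u)) \<le> ln (2 * exp (- pi * \<tau> / 2 * \<bar>Im u\<bar>))"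
      using b(2) pos by (subst ln_le_cancel_iff) auto
    ultimately have "ln d - pi * \<tau> / 2 * \<bar>Im u\<bar> \<le> ln (norm (cosfac \<tau> u))"
      "ln (norm (cosfac \<tau> u)) \<le> ln 2 - pi * \<tau> / 2 * \<bar>Im u\<bar>"
      using d by (simp_all add: ln_mult)
    thus ?thesis using pos by (auto simp: abs_le_iff)
  qed
  thus ?thesis using that by blast
qed

text \<open>The integral formula gives linear growth in \<open>\<bar>Im z\<bar>\<close> with slope
  \<open>J * Re z\<close> for an unknown \<open>J\<close>. Comparing \<open>Re z = - 1\<close> with
  \<open>Re z = 1\<close> through the functional equation shows that \<open>2 * J\<close> and the
  slope \<open>- pi * \<tau> / 2\<close> of the cosine factor differ by a bounded amount divided by
  the height, hence are equal.\<close>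

lemma hyp_G_growth_base:
  assumes \<tau>: "\<tau> < 0"
  obtains B where "\<And>z. \<bar>Re z\<bar> \<le> 1 \<Longrightarrow> \<bar>Im z\<bar> \<ge> 1 \<Longrightarrow>
    \<bar>ln (norm (hyp_G \<tau> z)) + pi * \<tau> / 4 * Re z * \<bar>Im z\<bar>\<bar> \<le> B"
proof -
  define J where "J = - \<tau> * integral\<^sup>L pos_lborel (\<lambda>y. (1 - cos y) / y^2) / 2"
  have t: "- \<tau> > 0" "1 < 1 + 1 / (- \<tau>)" using \<tau> by auto
  obtain B where B': "\<And>z. \<bar>Re z\<bar> \<le> 1 \<Longrightarrow> \<bar>Re (gexp (- \<tau>) z)
      - - \<tau> * integral\<^sup>L pos_lborel (\<lambda>y. (1 - cos y) / y^2) / 2 * Re z * \<bar>Im z\<bar>\<bar> \<le> B"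
    by (rule gexp_Re_bound[OF t], rule that)
  note B = B'[folded J_def]
  have G: "hyp_G \<tau> z = exp (gexp (- \<tau>) z)" if "\<bar>Re z\<bar> \<le> 1" for z
  proof -
    have "0 < min 2 (- 1 / \<tau>)" using \<tau> by simp
    hence "\<bar>Re z - 2 * of_int 0\<bar> < 1 + min 2 (- 1 / \<tau>)" using that by linarith
    from hyp_G_eq_strip[OF \<tau> this] show ?thesis by (simp add: hyp_G_strip_def)
  qed
  have lnG: "ln (norm (hyp_G \<tau> z)) = Re (gexp (- \<tau>) z)" if "\<bar>Re z\<bar> \<le> 1" for z
    unfolding G[OF that] by simp
  obtain Bc where Bc: "\<And>u. \<bar>Im u\<bar> \<ge> 1 \<Longrightarrow> cosfac \<tau> u \<noteq> 0 \<and> \<bar>ln (norm (cosfac \<tau> u)) + pi * \<tau> / 2 * \<bar>Im u\<bar>\<bar> \<le> Bc"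
    by (rule ln_norm_cosfac_bound[OF \<tau>], rule that)
  have "J = - pi * \<tau> / 4"
  proof -
    have bd: "\<bar>2 * J + pi * \<tau> / 2\<bar> * y \<le> 2 * B + Bc" if y: "y \<ge> 1" for y
    proof -
      define z where "z = Complex (-1) y"
      have z: "Re (z + 2) = 1" "Im (z + 2) = y" "Re z = -1" "Im z = y" "Im (z + 1) = y" by (simp_all add: z_def)
      have c: "cosfac \<tau> (z + 1) \<noteq> 0" "\<bar>ln (norm (cosfac \<tau> (z + 1))) + pi * \<tau> / 2 * y\<bar> \<le> Bc"
        using Bc[of "z + 1"] y z by auto
      have nz: "hyp_G \<tau> z \<noteq> 0" using hyp_G_nonzero[OF \<tau>, of z] y z by auto
      have "ln (norm (hyp_G \<tau> (z + 2))) = ln (norm (cosfac \<tau> (z + 1))) + ln (norm (hyp_G \<tau> z))"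
        unfolding hyp_G_shift[OF \<tau> c(1)] norm_mult using c nz by (simp add: ln_mult)
      hence "ln (norm (cosfac \<tau> (z + 1))) = Re (gexp (- \<tau>) (z + 2)) - Re (gexp (- \<tau>) z)"
        using lnG[of z] lnG[of "z + 2"] z by simp
      moreover have "\<bar>Re (gexp (- \<tau>) (z + 2)) - J * y\<bar> \<le> B" "\<bar>Re (gexp (- \<tau>) z) + J * y\<bar> \<le> B"
        using B[of "z + 2"] B[of z] z y by auto
      ultimately have "\<bar>2 * (J * y) + pi * \<tau> / 2 * y\<bar> \<le> 2 * B + Bc" using c(2) by linarith
      moreover have "2 * (J * y) + pi * \<tau> / 2 * y = (2 * J + pi * \<tau> / 2) * y" by (simp add: algebra_simps)
      ultimately show ?thesis using y by (simp add: abs_mult)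
    qed
    have "\<bar>2 * J + pi * \<tau> / 2\<bar> = 0"
    proof (rule ccontr)
      assume "\<bar>2 * J + pi * \<tau> / 2\<bar> \<noteq> 0"
      hence p: "\<bar>2 * J + pi * \<tau> / 2\<bar> > 0" by simp
      define y where "y = max 1 ((2 * B + Bc + 1) / \<bar>2 * J + pi * \<tau> / 2\<bar>)"
      have "\<bar>2 * J + pi * \<tau> / 2\<bar> * ((2 * B + Bc + 1) / \<bar>2 * J + pi * \<tau> / 2\<bar>) \<le> \<bar>2 * J + pi * \<tau> / 2\<bar> * y"
        using p by (intro mult_left_mono) (auto simp: y_def)
      also have "\<dots> \<le> 2 * B + Bc" by (rule bd) (simp add: y_def)
      finally show False using p by simp
    qed
    thus ?thesis by simp
  qed
  hence "\<bar>ln (norm (hyp_G \<tau> z)) + pi * \<tau> / 4 * Re z * \<bar>Im z\<bar>\<bar> \<le> B" if "\<bar>Re z\<bar> \<le> 1" for z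
    using B[OF that] lnG[OF that] by (simp add: algebra_simps)
  thus ?thesis using that by blast
qed

text \<open>A shift by 2 changes the error term \<open>D\<close> by at most \<open>Bc\<close>, and a
  point with \<open>\<bar>Re z\<bar> \<le> K\<close> is at most \<open>\<bar>K\<bar> + 1\<close>
  shifts away from the central strip.\<close>

lemma hyp_G_growth:
  assumes \<tau>: "\<tau> < 0"
  obtains B where "\<And>z. \<bar>Re z\<bar> \<le> K \<Longrightarrow> \<bar>Im z\<bar> \<ge> 1 \<Longrightarrow>
    \<bar>ln (norm (hyp_G \<tau> z)) + pi * \<tau> / 4 * Re z * \<bar>Im z\<bar>\<bar> \<le> B"
proof -
  define D where "D = (\<lambda>z. ln (norm (hyp_G \<tau> z)) + pi * \<tau> / 4 * Re z * \<bar>Im z\<bar>)"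
  obtain B0 where B0': "\<And>z. \<bar>Re z\<bar> \<le> 1 \<Longrightarrow> \<bar>Im z\<bar> \<ge> 1 \<Longrightarrow>
      \<bar>ln (norm (hyp_G \<tau> z)) + pi * \<tau> / 4 * Re z * \<bar>Im z\<bar>\<bar> \<le> B0"
    by (rule hyp_G_growth_base[OF \<tau>], rule that)
  have B0: "\<bar>D z\<bar> \<le> B0" if "\<bar>Re z\<bar> \<le> 1" "\<bar>Im z\<bar> \<ge> 1" for z
    unfolding D_def by (rule B0'[OF that])
  obtain Bc where Bc: "\<And>u. \<bar>Im u\<bar> \<ge> 1 \<Longrightarrow> cosfac \<tau> u \<noteq> 0 \<and> \<bar>ln (norm (cosfac \<tau> u)) + pi * \<tau> / 2 * \<bar>Im u\<bar>\<bar> \<le> Bc"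
    by (rule ln_norm_cosfac_bound[OF \<tau>], rule that)
  have step: "\<bar>D (z + 2) - D z\<bar> \<le> Bc" if z: "\<bar>Im z\<bar> \<ge> 1" for z
  proof -
    have c: "cosfac \<tau> (z + 1) \<noteq> 0" "\<bar>ln (norm (cosfac \<tau> (z + 1))) + pi * \<tau> / 2 * \<bar>Im z\<bar>\<bar> \<le> Bc"
      using Bc[of "z + 1"] z by auto
    have nz: "hyp_G \<tau> z \<noteq> 0" using z by (intro hyp_G_nonzero[OF \<tau>] disjI1) auto
    have "ln (norm (hyp_G \<tau> (z + 2))) = ln (norm (cosfac \<tau> (z + 1))) + ln (norm (hyp_G \<tau> z))"
      unfolding hyp_G_shift[OF \<tau> c(1)] norm_mult using c nz by (simp add: ln_mult)
    hence "D (z + 2) - D z = ln (norm (cosfac \<tau> (z + 1))) + pi * \<tau> / 2 * \<bar>Im z\<bar>"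
      by (simp add: D_def algebra_simps)
    thus ?thesis using c(2) by simp
  qed
  have step_n: "\<bar>D (z + 2 * of_nat m) - D z\<bar> \<le> real m * Bc" if z: "\<bar>Im z\<bar> \<ge> 1" for z m
  proof (induction m)
    case (Suc m)
    have "\<bar>D (z + 2 * of_nat m + 2) - D (z + 2 * of_nat m)\<bar> \<le> Bc" using z by (intro step) auto
    moreover have "z + 2 * of_nat (Suc m) = z + 2 * of_nat m + 2" by simp
    ultimately show ?case using Suc by (simp add: algebra_simps)
  qed auto
  have Bc0: "Bc \<ge> 0" using step[of \<i>] by simp
  have "\<bar>D z\<bar> \<le> B0 + (\<bar>K\<bar> + 1) * Bc" if z: "\<bar>Re z\<bar> \<le> K" "\<bar>Im z\<bar> \<ge> 1" for z
  proof -
    define n where "n = round (Re z / 2)"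
    define w where "w = z - 2 * of_int n"
    define m where "m = nat \<bar>n\<bar>"
    have n: "\<bar>Re z - 2 * of_int n\<bar> \<le> 1" unfolding n_def by (rule abs_diff_round_half)
    have w: "\<bar>Re w\<bar> \<le> 1" "\<bar>Im w\<bar> \<ge> 1" using n z by (auto simp: w_def)
    have m: "real m \<le> \<bar>K\<bar> + 1" using n z unfolding m_def by linarith
    have "\<bar>D z - D w\<bar> \<le> real m * Bc"
    proof (cases "n \<ge> 0")
      case True
      hence "z = w + 2 * of_nat m" by (simp add: w_def m_def)
      thus ?thesis using step_n[OF w(2), of m] by simp
    next
      case False
      hence "w = z + 2 * of_nat m" by (simp add: w_def m_def)
      thus ?thesis using step_n[OF z(2), of m] by (simp add: abs_minus_commute)
    qed
    also have "\<dots> \<le> (\<bar>K\<bar> + 1) * Bc" using m Bc0 by (rule mult_right_mono)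
    finally show ?thesis using B0[OF w] by linarith
  qed
  thus ?thesis using that unfolding D_def by blast
qed

text \<open>In the quotient the contributions of \<open>Re w\<close> to the growth cancel, so the
  rate is the same in all vertical strips.\<close>

lemma hyp_G_ratio_exp_bound:
  assumes \<tau>: "\<tau> < 0"
  shows "exp_bound (pi * \<tau> / 4 * Re (u - v)) (\<lambda>z. hyp_G \<tau> (z + u) / hyp_G \<tau> (z + v))"
  unfolding exp_bound_def
proof
  fix K :: real
  define K1 where "K1 = K + \<bar>Re u\<bar> + \<bar>Re v\<bar>"
  define k where "k = pi * \<tau> / 4"
  obtain B where B': "\<And>z. \<bar>Re z\<bar> \<le> K1 \<Longrightarrow> \<bar>Im z\<bar> \<ge> 1 \<Longrightarrow> \<bar>ln (norm (hyp_G \<tau> z)) + pi * \<tau> / 4 * Re z * \<bar>Im z\<bar>\<bar> \<le> B"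
    by (rule hyp_G_growth[OF \<tau>, of K1], rule that)
  note B = B'[folded k_def]
  define Q where "Q = 2 * B + \<bar>k\<bar> * K1 * (\<bar>Im u\<bar> + \<bar>Im v\<bar>)"
  show "\<exists>B Y. \<forall>w. \<bar>Re w\<bar> \<le> K \<longrightarrow> Y \<le> \<bar>Im w\<bar> \<longrightarrow>
      norm (hyp_G \<tau> (w + u) / hyp_G \<tau> (w + v)) \<le> B * exp (- (pi * \<tau> / 4 * Re (u - v)) * \<bar>Im w\<bar>)"
  proof (intro exI allI impI)
    fix w assume w: "\<bar>Re w\<bar> \<le> K" "1 + \<bar>Im u\<bar> + \<bar>Im v\<bar> \<le> \<bar>Im w\<bar>"
    have part: "\<bar>ln (norm (hyp_G \<tau> (w + s))) + k * Re (w + s) * \<bar>Im w\<bar>\<bar> \<le> B + \<bar>k\<bar> * K1 * \<bar>Im s\<bar>"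
      if "s \<in> {u, v}" for s
    proof -
      have R: "\<bar>Re (w + s)\<bar> \<le> K1" using that w by (auto simp: K1_def)
      have "\<bar>Im (w + s)\<bar> \<ge> 1" using that w by auto
      note b = B[OF R this]
      have "\<bar>k * Re (w + s) * (\<bar>Im w\<bar> - \<bar>Im (w + s)\<bar>)\<bar> = \<bar>k\<bar> * \<bar>Re (w + s)\<bar> * \<bar>\<bar>Im w\<bar> - \<bar>Im (w + s)\<bar>\<bar>"
        by (simp only: abs_mult)
      also have "\<dots> \<le> \<bar>k\<bar> * K1 * \<bar>Im s\<bar>"
        using R by (intro mult_mono mult_left_mono) auto
      finally have d: "\<bar>k * Re (w + s) * (\<bar>Im w\<bar> - \<bar>Im (w + s)\<bar>)\<bar> \<le> \<bar>k\<bar> * K1 * \<bar>Im s\<bar>" .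
      have "k * R * Y = k * R * Y' + k * R * (Y - Y')" for R Y Y' :: real by (simp add: algebra_simps)
      from this[of "Re (w + s)" "\<bar>Im w\<bar>" "\<bar>Im (w + s)\<bar>"] show ?thesis using b d by linarith
    qed
    have "norm (hyp_G \<tau> (w + u)) > 0" "norm (hyp_G \<tau> (w + v)) > 0"
    proof -
      have "Im (w + u) \<noteq> 0" "Im (w + v) \<noteq> 0" using w by auto
      thus "norm (hyp_G \<tau> (w + u)) > 0" "norm (hyp_G \<tau> (w + v)) > 0"
        using hyp_G_nonzero[OF \<tau> disjI1] by simp_all
    qed
    hence "norm (hyp_G \<tau> (w + u) / hyp_G \<tau> (w + v)) = exp (ln (norm (hyp_G \<tau> (w + u))) - ln (norm (hyp_G \<tau> (w + v))))"
      by (simp add: norm_divide exp_diff)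
    also have "\<dots> \<le> exp (Q - k * Re (u - v) * \<bar>Im w\<bar>)"
      using part[of u] part[of v] by (simp add: Q_def algebra_simps abs_le_iff)
    also have "\<dots> = exp Q * exp (- (k * Re (u - v)) * \<bar>Im w\<bar>)" by (simp flip: exp_add)
    finally show "norm (hyp_G \<tau> (w + u) / hyp_G \<tau> (w + v)) \<le> exp Q * exp (- (pi * \<tau> / 4 * Re (u - v)) * \<bar>Im w\<bar>)"
      by (simp add: k_def)
  qed
qed

subsection \<open>The meromorphic function psi\<close>

text \<open>Common shape of both factors of the integrand. Numerators have their poles on leftward
  half lines; zeros of the denominators lie on rightward ones.\<close>

definition hyp_quot :: "real \<Rightarrow> complex \<Rightarrow> complex \<Rightarrow> complex \<Rightarrow> complex \<Rightarrow> complex \<Rightarrow> complex" where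
  "hyp_quot \<tau> u1 u2 u3 u4 w = hyp_G \<tau> (w + u1) * hyp_G \<tau> (w + u2) / (hyp_G \<tau> (w + u3) * hyp_G \<tau> (w + u4))"

lemma hyp_quot_exp_bound:
  assumes "\<tau> < 0"
  shows "exp_bound (pi * \<tau> / 4 * Re (u1 + u2 - u3 - u4)) (hyp_quot \<tau> u1 u2 u3 u4)"
proof -
  have "exp_bound (pi * \<tau> / 4 * Re (u1 - u3) + pi * \<tau> / 4 * Re (u2 - u4))
      (\<lambda>z. hyp_G \<tau> (z + u1) / hyp_G \<tau> (z + u3) * (hyp_G \<tau> (z + u2) / hyp_G \<tau> (z + u4)))"
    by (rule exp_bound_mult[OF hyp_G_ratio_exp_bound[OF assms] hyp_G_ratio_exp_bound[OF assms]])
  moreover have "pi * \<tau> / 4 * Re (u1 - u3) + pi * \<tau> / 4 * Re (u2 - u4) = pi * \<tau> / 4 * Re (u1 + u2 - u3 - u4)"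
    unfolding distrib_left[symmetric] by simp
  ultimately show ?thesis by (simp only: hyp_quot_def[abs_def] times_divide_times_eq)
qed

lemma hyp_quot_meromorphic [meromorphic_intros]:
  assumes "\<tau> < 0"
  shows "hyp_quot \<tau> u1 u2 u3 u4 meromorphic_on UNIV"
proof -
  have "(\<lambda>w. hyp_G \<tau> (w + u)) meromorphic_on UNIV" for u
    by (rule meromorphic_on_compose[OF hyp_G_meromorphic[OF assms], of "\<lambda>w. w + u", unfolded o_def])
       (auto intro!: analytic_intros)
  thus ?thesis unfolding hyp_quot_def[abs_def] by (intro meromorphic_intros)
qed

definition hyp_quot_left :: "real \<Rightarrow> complex \<Rightarrow> complex \<Rightarrow> complex set" where
  "hyp_quot_left \<tau> u1 u2 = {- 1 + 1 / of_real \<tau> - u1, - 1 + 1 / of_real \<tau> - u2}"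

definition hyp_quot_right :: "real \<Rightarrow> complex \<Rightarrow> complex \<Rightarrow> complex set" where
  "hyp_quot_right \<tau> u3 u4 = {1 - 1 / of_real \<tau> - u3, 1 - 1 / of_real \<tau> - u4}"

definition cut_domain :: "complex set \<Rightarrow> complex set \<Rightarrow> complex set" where
  "cut_domain A B = cut_plane (- 1) A \<inter> cut_plane 1 B"

lemma cut_domain_iff:
  "z \<in> cut_domain A B \<longleftrightarrow> (\<forall>a\<in>A. Im z = Im a \<longrightarrow> Re a < Re z) \<and> (\<forall>b\<in>B. Im z = Im b \<longrightarrow> Re z < Re b)"
  by (auto simp: cut_domain_def cut_plane_def)

lemma open_cut_domain: "finite A \<Longrightarrow> finite B \<Longrightarrow> open (cut_domain A B)"
  unfolding cut_domain_def by (intro open_Int open_cut_plane)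

lemma horizontally_convex_cut_domain: "horizontally_convex (cut_domain A B)"
  unfolding cut_domain_def by (intro horizontally_convex_Int horizontally_convex_cut_plane)

lemma Re_one_over_of_real [simp]: "Re (1 / complex_of_real \<tau>) = 1 / \<tau>" "Im (1 / complex_of_real \<tau>) = 0"
  by (simp_all add: Re_divide_of_real Im_divide_of_real)

text \<open>Reflection turns the denominator into a product of values at \<open>- (w + u)\<close>,
  so that only the pole half line of \<open>hyp_G\<close> has to be avoided.\<close>

lemma hyp_quot_holomorphic:
  assumes \<tau>: "\<tau> < 0"
  shows "hyp_quot \<tau> u1 u2 u3 u4 holomorphic_on cut_domain (hyp_quot_left \<tau> u1 u2) (hyp_quot_right \<tau> u3 u4)"
proof -
  let ?D = "cut_domain (hyp_quot_left \<tau> u1 u2) (hyp_quot_right \<tau> u3 u4)"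
  let ?H = "{z. Im z \<noteq> 0 \<or> Re z > - 1 + 1 / \<tau>}"
  have 1: "(\<lambda>w. hyp_G \<tau> (w + u)) holomorphic_on ?D" if "u = u1 \<or> u = u2" for u
    by (rule holomorphic_on_compose_gen[of "\<lambda>w. w + u" _ "hyp_G \<tau>" ?H, unfolded o_def, OF _ hyp_G_holomorphic[OF \<tau>]])
       (use that in \<open>auto intro!: holomorphic_intros simp: cut_domain_iff hyp_quot_left_def\<close>)
  have 2: "(\<lambda>w. hyp_G \<tau> (- (w + u))) holomorphic_on ?D" if "u = u3 \<or> u = u4" for u
    by (rule holomorphic_on_compose_gen[of "\<lambda>w. - (w + u)" _ "hyp_G \<tau>" ?H, unfolded o_def, OF _ hyp_G_holomorphic[OF \<tau>]])
       (use that in \<open>auto intro!: holomorphic_intros simp: cut_domain_iff hyp_quot_right_def\<close>)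
  have eq: "hyp_quot \<tau> u1 u2 u3 u4 = (\<lambda>w. hyp_G \<tau> (w + u1) * hyp_G \<tau> (w + u2) * (hyp_G \<tau> (- (w + u3)) * hyp_G \<tau> (- (w + u4))))"
    unfolding hyp_G_minus[OF \<tau>] by (auto simp: hyp_quot_def divide_inverse)
  show ?thesis unfolding eq by (intro holomorphic_on_mult 1 2) auto
qed

section \<open>Cancelling the poles in a vertical strip\<close>

fun lin_prod :: "complex list \<Rightarrow> complex \<Rightarrow> complex" where
  "lin_prod [] w = 1"
| "lin_prod (p # ps) w = (w - p) * lin_prod ps w"

lemma lin_prod_append [simp]: "lin_prod (ps @ qs) w = lin_prod ps w * lin_prod qs w"
  by (induction ps) auto

lemma lin_prod_replicate [simp]: "lin_prod (replicate n p) w = (w - p) ^ n"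
  by (induction n) auto

lemma lin_prod_eq_0_iff: "lin_prod ps w = 0 \<longleftrightarrow> w \<in> set ps"
  by (induction ps) auto

lemma lin_prod_holomorphic [holomorphic_intros]: "lin_prod ps holomorphic_on A"
  by (induction ps) (auto intro!: holomorphic_intros)

lemma lin_prod_tendsto: "(lin_prod ps \<longlongrightarrow> lin_prod ps p) (at p)"
  using holomorphic_on_imp_continuous_on[OF lin_prod_holomorphic[of ps UNIV]]
  by (simp add: continuous_on_eq_continuous_at isCont_def)

lemma lin_prod_partition: "lin_prod ps w = lin_prod (filter P ps) w * lin_prod (filter (\<lambda>p. \<not> P p) ps) w"
  by (induction ps) auto

lemma exp_bound_lin_prod: "\<epsilon> > 0 \<Longrightarrow> exp_bound (- \<epsilon>) (lin_prod ps)"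
proof (induction ps arbitrary: \<epsilon>)
  case Nil
  show ?case using exp_bound_mono[OF exp_bound_const[of 1], of "- \<epsilon>"] Nil by simp
next
  case (Cons p ps)
  have "exp_bound (- (\<epsilon> / 2) + - (\<epsilon> / 2)) (\<lambda>z. (z - p) * lin_prod ps z)"
    by (intro exp_bound_mult exp_bound_linear Cons.IH) (use Cons.prems in auto)
  thus ?case by simp
qed

text \<open>The exponent is the pole order, which the truncation by \<open>nat\<close> makes 0 if
  there is no pole; a function vanishing near \<open>p\<close> has no order and is treated
  apart.\<close>

lemma meromorphic_pole_cancel:
  assumes "f meromorphic_on {p}"
  shows "\<exists>n c. ((\<lambda>w. (w - p) ^ n * f w) \<longlongrightarrow> c) (at p)"
proof (cases "\<exists>\<^sub>Fw in at p. f w \<noteq> 0")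
  case False
  hence "\<forall>\<^sub>Fw in at p. f w = 0" by (simp add: not_frequently)
  hence "(f \<longlongrightarrow> 0) (at p)" by (rule tendsto_eventually)
  thus ?thesis by (intro exI[of _ 0]) auto
next
  case True
  define n where "n = zorder f p"
  define g where "g = zor_poly f p"
  have "isolated_singularity_at f p" "not_essential f p" using assms by (auto simp: meromorphic_at_iff)
  from zorder_exist[OF this True] obtain r where r: "r > 0" "g holomorphic_on cball p r"
    "\<And>w. w \<in> cball p r - {p} \<Longrightarrow> f w = g w * (w - p) powi n"
    unfolding n_def g_def by blast
  define N where "N = nat (- n)"
  define M where "M = nat n"
  have eq: "(w - p) ^ N * f w = g w * (w - p) ^ M" if "w \<in> cball p r - {p}" for w
  proof -
    have nz: "w - p \<noteq> 0" using that by auto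
    have "(w - p) ^ N * (w - p) powi n = (w - p) powi (int N + n)"
      using nz by (simp add: power_int_add)
    also have "int N + n = int M" by (simp add: N_def M_def)
    finally show ?thesis using r(3)[OF that] by (simp add: mult_ac)
  qed
  have "isCont g p"
    using holomorphic_on_imp_continuous_on[OF r(2)] r(1)
    by (intro continuous_on_interior[of "cball p r"]) auto
  hence "((\<lambda>w. g w * (w - p) ^ M) \<longlongrightarrow> g p * (p - p) ^ M) (at p)"
    by (intro tendsto_intros) (simp add: isCont_def)
  moreover have "eventually (\<lambda>w. w \<in> ball p r - {p}) (at p)"
    using r(1) by (intro eventually_at_in_open) auto
  hence "eventually (\<lambda>w. g w * (w - p) ^ M = (w - p) ^ N * f w) (at p)"
    by eventually_elim (use eq in auto)
  ultimately have "((\<lambda>w. (w - p) ^ N * f w) \<longlongrightarrow> g p * (p - p) ^ M) (at p)"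
    by (rule Lim_transform_eventually)
  thus ?thesis by blast
qed

lemma meromorphic_poles_cancel:
  assumes "finite S" "\<And>p. p \<in> S \<Longrightarrow> f meromorphic_on {p}"
  shows "\<exists>ps. set ps \<subseteq> S \<and> (\<forall>p\<in>S. \<exists>c. ((\<lambda>w. lin_prod ps w * f w) \<longlongrightarrow> c) (at p))"
  using assms
proof (induction S rule: finite_induct)
  case (insert p S)
  then obtain ps where ps: "set ps \<subseteq> S" "\<And>q. q \<in> S \<Longrightarrow> \<exists>c. ((\<lambda>w. lin_prod ps w * f w) \<longlongrightarrow> c) (at q)" by auto
  obtain n c where n: "((\<lambda>w. (w - p) ^ n * f w) \<longlongrightarrow> c) (at p)"
    using meromorphic_pole_cancel[of f p] insert.prems by auto
  let ?ps = "replicate n p @ ps"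
  have "\<exists>c. ((\<lambda>w. lin_prod ?ps w * f w) \<longlongrightarrow> c) (at q)" if "q \<in> S" for q
  proof -
    obtain c' where "((\<lambda>w. lin_prod ps w * f w) \<longlongrightarrow> c') (at q)" using ps(2)[OF \<open>q \<in> S\<close>] by blast
    hence "((\<lambda>w. (w - p) ^ n * (lin_prod ps w * f w)) \<longlongrightarrow> (q - p) ^ n * c') (at q)"
      by (intro tendsto_intros)
    thus ?thesis by (auto simp: mult_ac)
  qed
  moreover have "\<exists>c. ((\<lambda>w. lin_prod ?ps w * f w) \<longlongrightarrow> c) (at p)"
  proof -
    have "((\<lambda>w. lin_prod ps w * ((w - p) ^ n * f w)) \<longlongrightarrow> lin_prod ps p * c) (at p)"
      by (intro tendsto_mult lin_prod_tendsto n)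
    thus ?thesis by (auto simp: mult_ac)
  qed
  ultimately show ?case using ps(1) by (intro exI[of _ ?ps]) auto
qed (auto intro: exI[of _ "[]"])

text \<open>Singularities occur only at the heights of \<open>A\<close> and \<open>B\<close>, so
  those in the strip lie in a compact box and are finitely many. \<open>remove_sings\<close> fills
  in the cancelled points, and the polynomial costs the rate \<open>\<epsilon>\<close>.\<close>

lemma strip_factorization:
  assumes mero: "f meromorphic_on UNIV" and hol: "f holomorphic_on cut_domain A B"
    and fin: "finite A" "finite B" and bd: "exp_bound \<kappa> f" and \<epsilon>: "\<epsilon> > 0"
  obtains F ps where "F holomorphic_on {w. \<bar>Re w\<bar> < M}" "exp_bound (\<kappa> - \<epsilon>) F"
    "\<And>p. p \<in> set ps \<Longrightarrow> p \<notin> cut_domain A B"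
    "\<And>w. w \<in> cut_domain A B \<Longrightarrow> F w = lin_prod ps w * f w"
proof -
  let ?D = "cut_domain A B"
  define Y where "Y = Max (insert 0 ((\<lambda>e. \<bar>Im e\<bar>) ` (A \<union> B)))"
  have Y: "\<bar>Im e\<bar> \<le> Y" if "e \<in> A \<union> B" for e
    unfolding Y_def using that fin by (intro Max_ge) auto
  have in_D: "w \<in> ?D" if "\<bar>Im w\<bar> > Y" for w
    using Y that by (fastforce simp: cut_domain_iff)
  define S where "S = {w. \<not> f analytic_on {w}} \<inter> cbox (Complex (-M) (-Y)) (Complex M Y)"
  have "{w. \<not> f analytic_on {w}} sparse_in UNIV"
    by (rule meromorphic_on_imp_sparse_singularities[OF mero])
  hence "{w. \<not> f analytic_on {w}} sparse_in cbox (Complex (-M) (-Y)) (Complex M Y)"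
    by (rule sparse_in_subset) auto
  hence finS: "finite S" unfolding S_def Int_commute[of "{w. \<not> f analytic_on {w}}"]
    by (intro sparse_in_compact_finite) auto
  have anaD: "f analytic_on {w}" if "w \<in> ?D" for w
    using hol that open_cut_domain[OF fin] by (simp add: analytic_on_open analytic_on_subset[of f ?D] holomorphic_on_imp_analytic_at)
  have "\<exists>ps. set ps \<subseteq> S \<and> (\<forall>p\<in>S. \<exists>c. ((\<lambda>w. lin_prod ps w * f w) \<longlongrightarrow> c) (at p))"
    by (rule meromorphic_poles_cancel[OF finS]) (use mero meromorphic_on_subset in blast)
  then obtain ps where ps: "set ps \<subseteq> S" "\<And>p. p \<in> S \<Longrightarrow> \<exists>c. ((\<lambda>w. lin_prod ps w * f w) \<longlongrightarrow> c) (at p)" by blast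
  define g where "g = (\<lambda>w. lin_prod ps w * f w)"
  define F where "F = remove_sings g"
  have ana_lin: "lin_prod ps analytic_on X" for X
    using lin_prod_holomorphic[of ps UNIV] analytic_on_subset by (auto simp: analytic_on_open[symmetric])
  have ana_g: "g analytic_on {w}" if "f analytic_on {w}" for w
    unfolding g_def by (intro analytic_on_mult ana_lin that)
  have mero_g: "g meromorphic_on UNIV"
    unfolding g_def by (intro meromorphic_on_mult mero analytic_on_imp_meromorphic_on ana_lin)
  have eq: "F w = lin_prod ps w * f w" if "w \<in> ?D" for w
    using ana_g[OF anaD[OF that]] by (simp add: F_def g_def)
  show ?thesis
  proof (rule that[of F ps])
    have "F analytic_on {w}" if w: "\<bar>Re w\<bar> < M" for w
    proof (cases "w \<in> S")
      case True
      then obtain c where "g \<midarrow>w\<rightarrow> c" using ps(2) unfolding g_def by blast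
      moreover have "isolated_singularity_at g w"
        using mero_g by (auto simp: meromorphic_on_altdef)
      ultimately show ?thesis unfolding F_def by (intro remove_sings_analytic_at)
    next
      case False
      hence "f analytic_on {w}"
        using anaD[OF in_D[of w]] w by (cases "\<bar>Im w\<bar> > Y") (auto simp: S_def in_cbox_complex_iff)
      thus ?thesis unfolding F_def by (intro remove_sings_analytic_on ana_g)
    qed
    hence "F analytic_on {w. \<bar>Re w\<bar> < M}" by (subst analytic_on_analytic_at) auto
    thus "F holomorphic_on {w. \<bar>Re w\<bar> < M}" by (rule analytic_imp_holomorphic)
    show "exp_bound (\<kappa> - \<epsilon>) F" unfolding exp_bound_def
    proof
      fix K
      have e: "exp_bound (- \<epsilon> + \<kappa>) g" unfolding g_def by (intro exp_bound_mult exp_bound_lin_prod \<epsilon> bd)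
      obtain B0 Y0 where b: "B0 > 0" "Y0 > 0"
        "\<And>w. \<bar>Re w\<bar> \<le> K \<Longrightarrow> \<bar>Im w\<bar> \<ge> Y0 \<Longrightarrow> norm (g w) \<le> B0 * exp (- (- \<epsilon> + \<kappa>) * \<bar>Im w\<bar>)"
        by (rule exp_boundE[OF e, of K], rule that)
      have "norm (F w) \<le> B0 * exp (- (\<kappa> - \<epsilon>) * \<bar>Im w\<bar>)" if "\<bar>Re w\<bar> \<le> K" "\<bar>Im w\<bar> \<ge> max Y0 (Y + 1)" for w
        using b(3)[of w] that eq[OF in_D[of w]] by (simp add: g_def)
      thus "\<exists>B Y. \<forall>w. \<bar>Re w\<bar> \<le> K \<longrightarrow> Y \<le> \<bar>Im w\<bar> \<longrightarrow> norm (F w) \<le> B * exp (- (\<kappa> - \<epsilon>) * \<bar>Im w\<bar>)" by blast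
    qed
    show "p \<notin> ?D" if "p \<in> set ps" for p using that ps(1) anaD by (auto simp: S_def)
  qed (use eq in auto)
qed

lemma has_line_integral_unique: "has_line_integral f I C \<Longrightarrow> has_line_integral f J C \<Longrightarrow> I = J"
  unfolding has_line_integral_def by (rule has_bochner_integral_eq)

section \<open>The two factors of the integrand\<close>

definition psi_phi :: "real \<Rightarrow> complex \<Rightarrow> complex \<Rightarrow> complex \<Rightarrow> complex \<Rightarrow> complex" where
  "psi_phi \<tau> lam \<beta> \<sigma> = (let h = 1 / (2 * of_real \<tau>) in
     hyp_quot (2 * \<tau>) (h + \<beta> + \<sigma> - \<i> * lam) (h - \<beta> - \<sigma> - \<i> * lam) (- h + 1 - \<sigma> + \<i> * lam) (- h + 1 + \<sigma> + \<i> * lam))"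

definition psi_theta :: "real \<Rightarrow> complex \<Rightarrow> complex \<Rightarrow> complex \<Rightarrow> complex \<Rightarrow> complex" where
  "psi_theta \<tau> lam \<alpha> \<rho> = (let h = 1 / (2 * of_real \<tau>) in
     hyp_quot (2 * \<tau>) (- h + \<rho> + \<i> * lam) (h - \<rho> + \<i> * lam) (- h + 1 + \<alpha> + \<rho> - \<i> * lam) (h + 1 - \<alpha> - \<rho> - \<i> * lam))"

text \<open>The four gamma functions whose argument contains \<open>- z\<close> change between
  numerator and denominator by reflection. Afterwards each factor has two poles' half lines and two
  zeros' half lines of the expected directions.\<close>

lemma psi_integrand_eq:
  assumes "\<tau> < 0"
  shows "psi_integrand \<tau> lam \<alpha> \<rho> \<beta> \<sigma> x z = psi_phi \<tau> lam \<beta> \<sigma> (x + z) * psi_theta \<tau> lam \<alpha> \<rho> z"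
proof -
  have m: "hyp_G (2 * \<tau>) w = inverse (hyp_G (2 * \<tau>) (- w))" for w
    using hyp_G_minus[of "2 * \<tau>" w] assms by simp
  define h where "h = 1 / (2 * complex_of_real \<tau>)"
  have e: "hyp_G (2 * \<tau>) (h - 1 + \<sigma> - \<i> * lam - x - z) = inverse (hyp_G (2 * \<tau>) (x + z + (- h + 1 - \<sigma> + \<i> * lam)))"
    "hyp_G (2 * \<tau>) (- h + \<beta> + \<sigma> + \<i> * lam - x - z) = inverse (hyp_G (2 * \<tau>) (x + z + (h - \<beta> - \<sigma> - \<i> * lam)))"
    "hyp_G (2 * \<tau>) (- h - 1 + \<alpha> + \<rho> + \<i> * lam - z) = inverse (hyp_G (2 * \<tau>) (z + (h + 1 - \<alpha> - \<rho> - \<i> * lam)))"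
    "hyp_G (2 * \<tau>) (- h + \<rho> - \<i> * lam - z) = inverse (hyp_G (2 * \<tau>) (z + (h - \<rho> + \<i> * lam)))"
    by (subst m, simp add: algebra_simps)+
  show ?thesis
    unfolding psi_integrand_def Let_def psi_phi_def psi_theta_def hyp_quot_def h_def[symmetric] e
    by (simp add: divide_inverse inverse_mult_distrib add_ac mult_ac)
qed

definition phi_left where "phi_left lam \<beta> \<sigma> = {- 1 - \<beta> - \<sigma> + \<i> * lam, - 1 + \<beta> + \<sigma> + \<i> * lam}"
definition phi_right where "phi_right lam \<sigma> = {\<sigma> - \<i> * lam, - \<sigma> - \<i> * lam}"
definition theta_left where
  "theta_left \<tau> lam \<rho> = {- 1 + 1 / of_real \<tau> - \<rho> - \<i> * lam, - 1 + \<rho> - \<i> * lam :: complex}"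
definition theta_right where
  "theta_right \<tau> lam \<alpha> \<rho> = {- \<alpha> - \<rho> + \<i> * lam, - 1 / of_real \<tau> + \<alpha> + \<rho> + \<i> * lam :: complex}"

lemma half_sum: "1 / (2 * complex_of_real \<tau>) + 1 / (2 * complex_of_real \<tau>) = 1 / of_real \<tau>"
  by (cases "\<tau> = 0") (simp_all add: field_simps)

text \<open>In the rate, \<sigma> and \<open>\<beta> + \<sigma>\<close> cancel in pairs; what
  remains of the parameters is \<open>4 * h - 2 - 4 * \<i> * lam\<close>.\<close>

lemma psi_phi_facts:
  assumes "\<tau> < 0"
  shows "psi_phi \<tau> lam \<beta> \<sigma> meromorphic_on UNIV"
    "psi_phi \<tau> lam \<beta> \<sigma> holomorphic_on cut_domain (phi_left lam \<beta> \<sigma>) (phi_right lam \<sigma>)"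
    "exp_bound (pi * \<tau> * (1 / \<tau> - 1 + 2 * Im lam)) (psi_phi \<tau> lam \<beta> \<sigma>)"
proof -
  have t: "2 * \<tau> < 0" using assms by simp
  define h where "h = 1 / (2 * complex_of_real \<tau>)"
  have h: "1 / complex_of_real (2 * \<tau>) = h" by (simp add: h_def)
  have hR: "Re h = 1 / (2 * \<tau>)" unfolding h[symmetric] by (rule Re_one_over_of_real)
  show "psi_phi \<tau> lam \<beta> \<sigma> meromorphic_on UNIV"
    unfolding psi_phi_def Let_def by (rule hyp_quot_meromorphic[OF t])
  have "phi_left lam \<beta> \<sigma> = hyp_quot_left (2 * \<tau>) (h + \<beta> + \<sigma> - \<i> * lam) (h - \<beta> - \<sigma> - \<i> * lam)"
    unfolding phi_left_def hyp_quot_left_def h by (simp add: algebra_simps)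
  moreover have "phi_right lam \<sigma> = hyp_quot_right (2 * \<tau>) (- h + 1 - \<sigma> + \<i> * lam) (- h + 1 + \<sigma> + \<i> * lam)"
    unfolding phi_right_def hyp_quot_right_def h by (simp add: algebra_simps)
  ultimately show "psi_phi \<tau> lam \<beta> \<sigma> holomorphic_on cut_domain (phi_left lam \<beta> \<sigma>) (phi_right lam \<sigma>)"
    unfolding psi_phi_def Let_def h_def[symmetric] by (simp only: hyp_quot_holomorphic[OF t])
  have "pi * (2 * \<tau>) / 4 * Re ((h + \<beta> + \<sigma> - \<i> * lam) + (h - \<beta> - \<sigma> - \<i> * lam) - (- h + 1 - \<sigma> + \<i> * lam) - (- h + 1 + \<sigma> + \<i> * lam))
      = pi * \<tau> * (1 / \<tau> - 1 + 2 * Im lam)"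
    using assms by (simp add: hR field_simps)
  with hyp_quot_exp_bound[OF t] show "exp_bound (pi * \<tau> * (1 / \<tau> - 1 + 2 * Im lam)) (psi_phi \<tau> lam \<beta> \<sigma>)"
    unfolding psi_phi_def Let_def h_def[symmetric] by metis
qed

lemma psi_theta_facts:
  assumes "\<tau> < 0"
  shows "psi_theta \<tau> lam \<alpha> \<rho> meromorphic_on UNIV"
    "psi_theta \<tau> lam \<alpha> \<rho> holomorphic_on cut_domain (theta_left \<tau> lam \<rho>) (theta_right \<tau> lam \<alpha> \<rho>)"
    "exp_bound (pi * \<tau> * (- 1 - 2 * Im lam)) (psi_theta \<tau> lam \<alpha> \<rho>)"
proof -
  have t: "2 * \<tau> < 0" using assms by simp
  define h where "h = 1 / (2 * complex_of_real \<tau>)"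
  have h: "1 / complex_of_real (2 * \<tau>) = h" "1 / complex_of_real \<tau> = h + h" "- 1 / complex_of_real \<tau> = - h - h"
    using half_sum[of \<tau>] by (simp_all add: h_def)
  show "psi_theta \<tau> lam \<alpha> \<rho> meromorphic_on UNIV"
    unfolding psi_theta_def Let_def by (rule hyp_quot_meromorphic[OF t])
  have "theta_left \<tau> lam \<rho> = hyp_quot_left (2 * \<tau>) (- h + \<rho> + \<i> * lam) (h - \<rho> + \<i> * lam)"
    unfolding theta_left_def hyp_quot_left_def h by (simp add: algebra_simps)
  moreover have "theta_right \<tau> lam \<alpha> \<rho> = hyp_quot_right (2 * \<tau>) (- h + 1 + \<alpha> + \<rho> - \<i> * lam) (h + 1 - \<alpha> - \<rho> - \<i> * lam)"
    unfolding theta_right_def hyp_quot_right_def h by (auto simp: algebra_simps)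
  ultimately show "psi_theta \<tau> lam \<alpha> \<rho> holomorphic_on cut_domain (theta_left \<tau> lam \<rho>) (theta_right \<tau> lam \<alpha> \<rho>)"
    unfolding psi_theta_def Let_def h_def[symmetric] by (simp only: hyp_quot_holomorphic[OF t])
  have "pi * (2 * \<tau>) / 4 * Re ((- h + \<rho> + \<i> * lam) + (h - \<rho> + \<i> * lam) - (- h + 1 + \<alpha> + \<rho> - \<i> * lam) - (h + 1 - \<alpha> - \<rho> - \<i> * lam))
      = pi * \<tau> * (- 1 - 2 * Im lam)"
    by (simp add: algebra_simps)
  with hyp_quot_exp_bound[OF t] show "exp_bound (pi * \<tau> * (- 1 - 2 * Im lam)) (psi_theta \<tau> lam \<alpha> \<rho>)"
    unfolding psi_theta_def Let_def h_def[symmetric] by metis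
qed

lemma set_left_ends: "set (left_ends \<tau> lam \<alpha> \<rho> \<beta> \<sigma> x) = (\<lambda>p. p - x) ` phi_left lam \<beta> \<sigma> \<union> theta_left \<tau> lam \<rho>"
  by (auto simp: left_ends_def phi_left_def theta_left_def)

lemma set_right_ends: "set (right_ends \<tau> lam \<alpha> \<rho> \<beta> \<sigma> x) = (\<lambda>p. p - x) ` phi_right lam \<sigma> \<union> theta_right \<tau> lam \<alpha> \<rho>"
  by (auto simp: right_ends_def phi_right_def theta_right_def)

lemma generic_arg_heights:
  assumes "generic_arg \<tau> lam \<alpha> \<rho> \<beta> \<sigma> x" "a \<in> set (left_ends \<tau> lam \<alpha> \<rho> \<beta> \<sigma> x)" "b \<in> set (right_ends \<tau> lam \<alpha> \<rho> \<beta> \<sigma> x)"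
  shows "Im a \<noteq> Im b"
proof -
  have "Im ` set (left_ends \<tau> lam \<alpha> \<rho> \<beta> \<sigma> x) \<inter> Im ` set (right_ends \<tau> lam \<alpha> \<rho> \<beta> \<sigma> x) = {}"
    using assms(1) by (simp only: generic_arg_def map_append distinct_append set_map)
  thus ?thesis using assms(2,3) by blast
qed

text \<open>A contour has exactly one point at each height, so separating half lines amounts to the
  right inequality at their end points.\<close>

lemma psi_contour_iff:
  "psi_contour \<tau> lam \<alpha> \<rho> \<beta> \<sigma> x C \<longleftrightarrow> vertical_deformation 0 C \<and>
    (\<forall>c. C c \<in> cut_domain (set (left_ends \<tau> lam \<alpha> \<rho> \<beta> \<sigma> x)) (set (right_ends \<tau> lam \<alpha> \<rho> \<beta> \<sigma> x)))"
proof -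
  let ?L = "set (left_ends \<tau> lam \<alpha> \<rho> \<beta> \<sigma> x)" and ?R = "set (right_ends \<tau> lam \<alpha> \<rho> \<beta> \<sigma> x)"
  have "separates C (\<Union>p\<in>?L. left_half_line p) (\<Union>p\<in>?R. right_half_line p) \<longleftrightarrow> (\<forall>c. C c \<in> cut_domain ?L ?R)"
    if C: "vertical_deformation 0 C"
  proof
    assume s: "separates C (\<Union>p\<in>?L. left_half_line p) (\<Union>p\<in>?R. right_half_line p)"
    have self: "p \<in> left_half_line p" "p \<in> right_half_line p" for p
      unfolding left_half_line_def right_half_line_def by (auto intro: exI[of _ 0])
    have "Re a < Re (C (Im a))" if "a \<in> ?L" for a
      using s self(1)[of a] that unfolding separates_def by blast
    moreover have "Re (C (Im b)) < Re b" if "b \<in> ?R" for b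
      using s self(2)[of b] that unfolding separates_def by blast
    ultimately show "\<forall>c. C c \<in> cut_domain ?L ?R" using C by (auto simp: cut_domain_iff)
  next
    assume c: "\<forall>c. C c \<in> cut_domain ?L ?R"
    have "Re a < Re (C (Im a))" if "a \<in> ?L" for a
      using c[rule_format, of "Im a"] that C by (auto simp: cut_domain_iff)
    moreover have "Re (C (Im b)) < Re b" if "b \<in> ?R" for b
      using c[rule_format, of "Im b"] that C by (auto simp: cut_domain_iff)
    ultimately show "separates C (\<Union>p\<in>?L. left_half_line p) (\<Union>p\<in>?R. right_half_line p)"
      unfolding separates_def left_half_line_def right_half_line_def by (force)
  qed
  thus ?thesis unfolding psi_contour_def imaginary_axis_deformation_iff by blast
qed

section \<open>Convolution integrals of functions on cut domains\<close>

lemma shifted_holomorphic: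
  assumes "f holomorphic_on cut_domain A B"
  shows "(\<lambda>z. f (x + z)) holomorphic_on cut_domain ((\<lambda>p. p - x) ` A) ((\<lambda>p. p - x) ` B)"
  by (rule holomorphic_on_compose_gen[of "\<lambda>z. x + z" _ f, unfolded o_def, OF _ assms])
     (auto intro!: holomorphic_intros simp: cut_domain_iff algebra_simps)

lemma cut_domain_mono: "A' \<subseteq> A \<Longrightarrow> B' \<subseteq> B \<Longrightarrow> cut_domain A B \<subseteq> cut_domain A' B'"
  unfolding cut_domain_iff subset_iff by blast

lemma cut_domain_shift_Un:
  "z \<in> cut_domain ((\<lambda>p. p - x) ` A \<union> A') ((\<lambda>p. p - x) ` B \<union> B') \<longleftrightarrow> x + z \<in> cut_domain A B \<and> z \<in> cut_domain A' B'"
  by (auto simp: cut_domain_iff ball_Un algebra_simps)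

lemma product_facts:
  assumes f: "f holomorphic_on cut_domain A B" "exp_bound \<kappa> f" and g: "g holomorphic_on cut_domain A' B'" "exp_bound \<mu> g"
  shows "(\<lambda>z. f (x + z) * g z) holomorphic_on cut_domain ((\<lambda>p. p - x) ` A \<union> A') ((\<lambda>p. p - x) ` B \<union> B')"
    "exp_bound (\<kappa> + \<mu>) (\<lambda>z. f (x + z) * g z)"
proof -
  show "(\<lambda>z. f (x + z) * g z) holomorphic_on cut_domain ((\<lambda>p. p - x) ` A \<union> A') ((\<lambda>p. p - x) ` B \<union> B')"
    by (intro holomorphic_on_mult holomorphic_on_subset[OF shifted_holomorphic[OF f(1)]] holomorphic_on_subset[OF g(1)] cut_domain_mono) auto
  show "exp_bound (\<kappa> + \<mu>) (\<lambda>z. f (x + z) * g z)" by (intro exp_bound_mult exp_bound_shift f g)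
qed

lemma end_prod_map_0: "end_prod (map (\<lambda>p. (p, 0)) ps) x z = lin_prod ps z"
  and end_prod_map_1: "end_prod (map (\<lambda>p. (p, 1)) ps) x z = lin_prod ps (x + z)"
  by (induction ps) (auto simp: algebra_simps)

lemma end_prod_append: "end_prod (E @ E') x z = end_prod E x z * end_prod E' x z"
  by (induction E x z rule: end_prod.induct) auto

text \<open>After cancellation in a wide strip, \<open>f (x + z) * g z\<close> is a product of
  holomorphic functions divided by linear factors, whose zeros inherit a side from the half lines
  they lie on. Different heights of left and right ends keep the two kinds of zeros apart, hence
  \<open>h\<close> is analytic there.\<close>

lemma convolution_continuation:
  assumes f: "f meromorphic_on UNIV" "f holomorphic_on cut_domain A B" "exp_bound \<kappa> f"
    and g: "g meromorphic_on UNIV" "g holomorphic_on cut_domain A' B'" "exp_bound \<mu> g"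
    and fin: "finite A" "finite B" "finite A'" "finite B'" and \<kappa>\<mu>: "\<kappa> + \<mu> > 0" and N: "N > 0"
  defines "L \<equiv> \<lambda>x. (\<lambda>p. p - x) ` A \<union> A'" and "R \<equiv> \<lambda>x. (\<lambda>p. p - x) ` B \<union> B'"
  shows "\<exists>h. h meromorphic_on {x. \<bar>Re x\<bar> < N} \<and>
    (\<forall>x. \<bar>Re x\<bar> < N \<longrightarrow> Im ` L x \<inter> Im ` R x = {} \<longrightarrow> h analytic_on {x} \<and>
      (\<forall>C. vertical_deformation 0 C \<longrightarrow> (\<forall>c. C c \<in> cut_domain (L x) (R x)) \<longrightarrow>
        has_line_integral (\<lambda>z. f (x + z) * g z) (h x) C))"
proof -
  define K where "K = 1 + (\<Sum>e\<in>A \<union> B \<union> A' \<union> B'. \<bar>Re e\<bar>)"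
  have K: "\<bar>Re e\<bar> < K" if "e \<in> A \<union> B \<union> A' \<union> B'" for e
  proof -
    have "\<bar>Re e\<bar> \<le> (\<Sum>e\<in>A \<union> B \<union> A' \<union> B'. \<bar>Re e\<bar>)" by (rule member_le_sum) (use that fin in auto)
    thus ?thesis by (simp add: K_def)
  qed
  have K0: "K > 0" by (simp add: K_def add_pos_nonneg sum_nonneg)
  define M where "M = K + 2 * N + 1"
  \<comment> \<open>Each factor gives up a quarter of the total rate, so half of it remains.\<close>
  define \<epsilon> where "\<epsilon> = (\<kappa> + \<mu>) / 4"
  have \<epsilon>: "\<epsilon> > 0" "(\<kappa> - \<epsilon>) + (\<mu> - \<epsilon>) > 0" using \<kappa>\<mu> by (auto simp: \<epsilon>_def field_simps)
  obtain F ps where F: "F holomorphic_on {w. \<bar>Re w\<bar> < M}" "exp_bound (\<kappa> - \<epsilon>) F"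
    "\<And>p. p \<in> set ps \<Longrightarrow> p \<notin> cut_domain A B" "\<And>w. w \<in> cut_domain A B \<Longrightarrow> F w = lin_prod ps w * f w"
    by (rule strip_factorization[OF f(1,2) fin(1,2) f(3) \<epsilon>(1), of M], rule that)
  obtain G qs where G: "G holomorphic_on {w. \<bar>Re w\<bar> < M}" "exp_bound (\<mu> - \<epsilon>) G"
    "\<And>p. p \<in> set qs \<Longrightarrow> p \<notin> cut_domain A' B'" "\<And>w. w \<in> cut_domain A' B' \<Longrightarrow> G w = lin_prod qs w * g w"
    by (rule strip_factorization[OF g(1,2) fin(3,4) g(3) \<epsilon>(1), of M], rule that)
  define lft where "lft = (\<lambda>E p. \<exists>e\<in>E. Im p = Im e \<and> Re p \<le> Re e)"
  define rgt where "rgt = (\<lambda>E p. \<exists>e\<in>E. Im p = Im e \<and> Re e \<le> Re p)"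
  \<comment> \<open>A cancelled pole lies outside the cut domain, hence on some half line; if not on
    a left one, then on a right one.\<close>
  have lr: "rgt B p" if "p \<in> set ps" "\<not> lft A p" for p
    using F(3)[OF that(1)] that(2) by (auto simp: cut_domain_iff lft_def rgt_def not_less)
  have lr': "rgt B' p" if "p \<in> set qs" "\<not> lft A' p" for p
    using G(3)[OF that(1)] that(2) by (auto simp: cut_domain_iff lft_def rgt_def not_less)
  define Ls where "Ls = map (\<lambda>p. (p, 1::complex)) (filter (lft A) ps) @ map (\<lambda>p. (p, 0)) (filter (lft A') qs)"
  define Rs where "Rs = map (\<lambda>p. (p, 1::complex)) (filter (\<lambda>p. \<not> lft A p) ps) @ map (\<lambda>p. (p, 0)) (filter (\<lambda>p. \<not> lft A' p) qs)"
  have prodLR: "end_prod Ls x z * end_prod Rs x z = lin_prod ps (x + z) * lin_prod qs z" for x z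
    unfolding Ls_def Rs_def end_prod_append end_prod_map_0 end_prod_map_1
    using lin_prod_partition[of ps "x + z" "lft A"] lin_prod_partition[of qs z "lft A'"] by simp
  have Ls: "(b = 0 \<or> b = 1) \<and> Re p < K" if pb: "(p, b) \<in> set Ls" for p b
  proof -
    have "lft A p \<or> lft A' p" "b = 0 \<or> b = 1" using pb by (auto simp: Ls_def)
    then obtain e where "e \<in> A \<union> A'" "Re p \<le> Re e" by (auto simp: lft_def)
    thus ?thesis using K[of e] \<open>b = 0 \<or> b = 1\<close> by auto
  qed
  have Rs: "(b = 0 \<or> b = 1) \<and> - K < Re p" if pb: "(p, b) \<in> set Rs" for p b
  proof -
    have "rgt B p \<or> rgt B' p" "b = 0 \<or> b = 1" using pb lr lr' by (auto simp: Rs_def)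
    then obtain e where "e \<in> B \<union> B'" "Re e \<le> Re p" by (auto simp: rgt_def)
    thus ?thesis using K[of e] \<open>b = 0 \<or> b = 1\<close> by auto
  qed
  have endL: "\<exists>a\<in>L x. Im e = Im a \<and> Re e \<le> Re a" if "e \<in> moving_ends Ls x" for e x
  proof -
    from that consider p where "lft A p" "e = p - x" | "lft A' e"
      by (auto simp: moving_ends_def Ls_def)
    thus ?thesis
    proof cases
      case 1
      then obtain a where "a \<in> A" "Im p = Im a" "Re p \<le> Re a" by (auto simp: lft_def)
      thus ?thesis using 1 by (intro bexI[of _ "a - x"]) (auto simp: L_def)
    qed (auto simp: lft_def L_def)
  qed
  have endR: "\<exists>b\<in>R x. Im e = Im b \<and> Re b \<le> Re e" if e: "e \<in> moving_ends Rs x" for e x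
  proof -
    obtain p b where pb: "(p, b) \<in> set Rs" "e = p - b * x" using e by (auto simp: moving_ends_def)
    hence "(rgt B p \<and> b = 1) \<or> (rgt B' p \<and> b = 0)" using lr lr' by (auto simp: Rs_def)
    then consider "rgt B p" "e = p - x" | "rgt B' e" using pb(2) by auto
    thus ?thesis
    proof cases
      case 1
      then obtain a where "a \<in> B" "Im p = Im a" "Re a \<le> Re p" by (auto simp: rgt_def)
      thus ?thesis using 1 by (intro bexI[of _ "a - x"]) (auto simp: R_def)
    qed (auto simp: rgt_def R_def)
  qed
  have cutLR: "w \<in> cut_plane (- 1) (moving_ends Ls x)" "w \<in> cut_plane 1 (moving_ends Rs x)"
    if "w \<in> cut_domain (L x) (R x)" for w x
    using endL[of _ x] endR[of _ x] that unfolding cut_domain_iff cut_plane_def by fastforce+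
  have MK: "K + 2 * N + 1 \<le> M" by (simp add: M_def)
  from two_sided_continuation[OF F(1,2) G(1,2) \<epsilon>(2) N K0 MK Ls Rs]
  obtain h where h: "h meromorphic_on {x. \<bar>Re x\<bar> < N} \<and>
    (\<forall>x. \<bar>Re x\<bar> < N \<longrightarrow> moving_ends Ls x \<inter> moving_ends Rs x = {} \<longrightarrow> h analytic_on {x}) \<and>
    (\<forall>x C. \<bar>Re x\<bar> < N \<longrightarrow> vertical_deformation 0 C \<longrightarrow> (\<forall>c. \<bar>Re (C c)\<bar> \<le> K + N) \<longrightarrow>
      (\<forall>c. C c \<in> cut_plane (-1) (moving_ends Ls x)) \<longrightarrow> (\<forall>c. C c \<in> cut_plane 1 (moving_ends Rs x)) \<longrightarrow>
      has_line_integral (\<lambda>z. F (x + z) * G z * inverse (end_prod Ls x z * end_prod Rs x z)) (h x) C)"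
    by (rule exE)
  have h_analytic: "h analytic_on {x}" if x: "\<bar>Re x\<bar> < N" "Im ` L x \<inter> Im ` R x = {}" for x
  proof -
    have "moving_ends Ls x \<inter> moving_ends Rs x = {}"
    proof (rule ccontr)
      assume "moving_ends Ls x \<inter> moving_ends Rs x \<noteq> {}"
      then obtain e where "e \<in> moving_ends Ls x" "e \<in> moving_ends Rs x" by blast
      with endL[of e x] endR[of e x] x(2) show False by fastforce
    qed
    thus ?thesis using h x(1) by blast
  qed
  have h_integral: "has_line_integral (\<lambda>z. f (x + z) * g z) (h x) C"
    if x: "\<bar>Re x\<bar> < N" "Im ` L x \<inter> Im ` R x = {}" and C: "vertical_deformation 0 C" "\<forall>c. C c \<in> cut_domain (L x) (R x)" for x C
  proof -
    have finLR: "finite (L x)" "finite (R x)" using fin by (auto simp: L_def R_def)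
    \<comment> \<open>The value of \<open>h\<close> is tied to contours in the strip
      \<open>\<bar>Re z\<bar> \<le> K + N\<close>. An auxiliary contour of this kind is found first,
      and the given \<open>C\<close>, which may leave the strip, is reached from it by
      deformation.\<close>
    obtain C' where C': "vertical_deformation 0 C'" "\<And>c. \<bar>Re (C' c)\<bar> \<le> K + N" "\<And>c. C' c \<in> cut_plane (- 1) (L x) \<inter> cut_plane 1 (R x)"
    proof (rule separating_contour[OF finLR])
      show "Im a \<noteq> Im b" if "a \<in> L x" "b \<in> R x" for a b using x(2) that by blast
      show "0 \<le> K + N" using K0 N by simp
      show "Re a < K + N" if "a \<in> L x" for a
        using that unfolding L_def
      proof (elim UnE imageE)
        fix p assume "a = p - x" "p \<in> A"
        thus ?thesis using K[of p] x(1) by auto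
      next
        assume "a \<in> A'"
        thus ?thesis using K[of a] N by auto
      qed
      show "- (K + N) < Re b" if "b \<in> R x" for b
        using that unfolding R_def
      proof (elim UnE imageE)
        fix p assume "b = p - x" "p \<in> B"
        thus ?thesis using K[of p] x(1) by auto
      next
        assume "b \<in> B'"
        thus ?thesis using K[of b] N by auto
      qed
    qed (rule that)
    have dom: "C' c \<in> cut_domain (L x) (R x)" for c using C'(3) by (simp add: cut_domain_def)
    have "has_line_integral (\<lambda>z. F (x + z) * G z * inverse (end_prod Ls x z * end_prod Rs x z)) (h x) C'"
      using h x(1) C' cutLR[OF dom] by blast
    hence "has_line_integral (\<lambda>z. f (x + z) * g z) (h x) C'"
    proof (rule has_line_integral_cong[rotated])
      fix c
      have "x + C' c \<in> cut_domain A B" "C' c \<in> cut_domain A' B'"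
        using dom[of c] by (simp_all only: L_def R_def cut_domain_shift_Un)
      thus "F (x + C' c) * G (C' c) * inverse (end_prod Ls x (C' c) * end_prod Rs x (C' c)) = f (x + C' c) * g (C' c)"
        unfolding prodLR using F(3,4) G(3,4) lin_prod_eq_0_iff[of ps "x + C' c"] lin_prod_eq_0_iff[of qs "C' c"]
        by (auto simp: field_simps)
    qed
    moreover have LR: "(\<lambda>p. p - x) ` A \<union> A' = L x" "(\<lambda>p. p - x) ` B \<union> B' = R x"
      by (simp_all add: L_def R_def)
    moreover note pf = product_facts[OF f(2,3) g(2,3), of x, unfolded LR]
    ultimately show ?thesis
      by (intro has_line_integral_deform[OF open_cut_domain[OF finLR] horizontally_convex_cut_domain pf \<kappa>\<mu> C'(1) dom C(1)])
         (use C(2) in auto)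
  qed
  show ?thesis
    by (rule exI[of _ h], intro conjI allI impI)
       ((rule h[THEN conjunct1] h_analytic h_integral; assumption)+)
qed

section \<open>Existence and uniqueness of the continuation\<close>

lemma frequently_Im_notin:
  assumes "finite S"
  shows "\<exists>\<^sub>F w in at z. Im w \<notin> S"
  unfolding frequently_at
proof (intro allI impI)
  fix d :: real assume d: "d > 0"
  have "infinite {Im z<..<Im z + d}" using d by (simp add: infinite_Ioo)
  hence "{Im z<..<Im z + d} - S \<noteq> {}" by (intro infinite_imp_nonempty Diff_infinite_finite assms)
  then obtain t where t: "t \<in> {Im z<..<Im z + d}" "t \<notin> S" by blast
  show "\<exists>w\<in>UNIV. w \<noteq> z \<and> dist w z < d \<and> Im w \<notin> S"
  proof (intro bexI[of _ "Complex (Re z) t"] conjI)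
    show "Complex (Re z) t \<noteq> z" using t by (auto simp: complex_eq_iff)
    have "dist (Complex (Re z) t) z = \<bar>t - Im z\<bar>" by (simp add: dist_norm cmod_def)
    thus "dist (Complex (Re z) t) z < d" using t by auto
  qed (use t in auto)
qed

lemma psi_local:
  assumes \<tau>: "\<tau> < 0" and N: "N > 0"
  shows "\<exists>h. h meromorphic_on {x. \<bar>Re x\<bar> < N} \<and>
    (\<forall>x. \<bar>Re x\<bar> < N \<longrightarrow> generic_arg \<tau> lam \<alpha> \<rho> \<beta> \<sigma> x \<longrightarrow> h analytic_on {x} \<and>
      (\<forall>C. psi_contour \<tau> lam \<alpha> \<rho> \<beta> \<sigma> x C \<longrightarrow>
        has_line_integral (psi_integrand \<tau> lam \<alpha> \<rho> \<beta> \<sigma> x) (h x) C))"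
proof -
  \<comment> \<open>Here \<open>lam\<close> drops out and the total rate becomes positive for every
    negative \<tau>.\<close>
  have sum: "pi * \<tau> * (1 / \<tau> - 1 + 2 * Im lam) + pi * \<tau> * (- 1 - 2 * Im lam) = pi * (1 - 2 * \<tau>)"
    using \<tau> by (simp add: field_simps)
  have "0 < pi * (1 - 2 * \<tau>)" using \<tau> by simp
  hence pos: "0 < pi * \<tau> * (1 / \<tau> - 1 + 2 * Im lam) + pi * \<tau> * (- 1 - 2 * Im lam)" unfolding sum .
  have fin: "finite (phi_left lam \<beta> \<sigma>)" "finite (phi_right lam \<sigma>)" "finite (theta_left \<tau> lam \<rho>)" "finite (theta_right \<tau> lam \<alpha> \<rho>)"
    by (auto simp: phi_left_def phi_right_def theta_left_def theta_right_def)
  from convolution_continuation[OF psi_phi_facts[OF \<tau>] psi_theta_facts[OF \<tau>] fin pos N]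
  obtain h where h: "h meromorphic_on {x. \<bar>Re x\<bar> < N} \<and>
    (\<forall>x. \<bar>Re x\<bar> < N \<longrightarrow>
      Im ` ((\<lambda>p. p - x) ` phi_left lam \<beta> \<sigma> \<union> theta_left \<tau> lam \<rho>) \<inter>
      Im ` ((\<lambda>p. p - x) ` phi_right lam \<sigma> \<union> theta_right \<tau> lam \<alpha> \<rho>) = {} \<longrightarrow> h analytic_on {x} \<and>
      (\<forall>C. vertical_deformation 0 C \<longrightarrow>
        (\<forall>c. C c \<in> cut_domain ((\<lambda>p. p - x) ` phi_left lam \<beta> \<sigma> \<union> theta_left \<tau> lam \<rho>)
                               ((\<lambda>p. p - x) ` phi_right lam \<sigma> \<union> theta_right \<tau> lam \<alpha> \<rho>)) \<longrightarrow>
        has_line_integral (\<lambda>z. psi_phi \<tau> lam \<beta> \<sigma> (x + z) * psi_theta \<tau> lam \<alpha> \<rho> z) (h x) C))"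
    by (rule exE)
  have "h analytic_on {x} \<and> (\<forall>C. psi_contour \<tau> lam \<alpha> \<rho> \<beta> \<sigma> x C \<longrightarrow>
      has_line_integral (psi_integrand \<tau> lam \<alpha> \<rho> \<beta> \<sigma> x) (h x) C)"
    if x: "\<bar>Re x\<bar> < N" "generic_arg \<tau> lam \<alpha> \<rho> \<beta> \<sigma> x" for x
  proof -
    have "Im ` set (left_ends \<tau> lam \<alpha> \<rho> \<beta> \<sigma> x) \<inter> Im ` set (right_ends \<tau> lam \<alpha> \<rho> \<beta> \<sigma> x) = {}"
      using generic_arg_heights[OF x(2)] by blast
    moreover have "psi_integrand \<tau> lam \<alpha> \<rho> \<beta> \<sigma> x = (\<lambda>z. psi_phi \<tau> lam \<beta> \<sigma> (x + z) * psi_theta \<tau> lam \<alpha> \<rho> z)"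
      using psi_integrand_eq[OF \<tau>] by blast
    ultimately show ?thesis
      using h[THEN conjunct2, rule_format, OF x(1)] unfolding psi_contour_iff set_left_ends set_right_ends by simp
  qed
  thus ?thesis using h by blast
qed

text \<open>The ends are pushed by 2 towards the contour before it is separated from them. Heights
  are unchanged, so genericity still applies, and all horizontal translates by at most 2 remain
  admissible.\<close>

lemma psi_contour_wide:
  assumes "generic_arg \<tau> lam \<alpha> \<rho> \<beta> \<sigma> x"
  obtains C where "vertical_deformation 0 C"
    "\<And>c t. \<bar>t\<bar> \<le> 2 \<Longrightarrow> x + C c + of_real t \<in> cut_domain (phi_left lam \<beta> \<sigma>) (phi_right lam \<sigma>)"
    "\<And>c t. \<bar>t\<bar> \<le> 2 \<Longrightarrow> C c + of_real t \<in> cut_domain (theta_left \<tau> lam \<rho>) (theta_right \<tau> lam \<alpha> \<rho>)"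
proof -
  let ?L = "set (left_ends \<tau> lam \<alpha> \<rho> \<beta> \<sigma> x)" and ?R = "set (right_ends \<tau> lam \<alpha> \<rho> \<beta> \<sigma> x)"
  define V where "V = 3 + (\<Sum>e\<in>?L \<union> ?R. \<bar>Re e\<bar>)"
  have V: "\<bar>Re e\<bar> + 2 < V" if "e \<in> ?L \<union> ?R" for e
  proof -
    have "\<bar>Re e\<bar> \<le> (\<Sum>e\<in>?L \<union> ?R. \<bar>Re e\<bar>)" by (rule member_le_sum) (use that in auto)
    thus ?thesis by (simp add: V_def)
  qed
  let ?A = "(\<lambda>p. p + 2) ` ?L" and ?B = "(\<lambda>p. p - 2) ` ?R"
  have fin: "finite ?A" "finite ?B" by auto
  obtain C where C: "vertical_deformation 0 C" "\<And>c. \<bar>Re (C c)\<bar> \<le> V" "\<And>c. C c \<in> cut_plane (- 1) ?A \<inter> cut_plane 1 ?B"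
  proof (rule separating_contour[OF fin])
    show "0 \<le> V" by (simp add: V_def sum_nonneg)
    show "Im a \<noteq> Im b" if a: "a \<in> ?A" and b: "b \<in> ?B" for a b
      using generic_arg_heights[OF assms] a b by auto
    show "Re a < V" if a: "a \<in> ?A" for a
    proof -
      obtain p where "p \<in> ?L" "a = p + 2" using a by (rule imageE)
      thus ?thesis using V[of p] by auto
    qed
    show "- V < Re b" if b: "b \<in> ?B" for b
    proof -
      obtain p where "p \<in> ?R" "b = p - 2" using b by (rule imageE)
      thus ?thesis using V[of p] by auto
    qed
  qed (rule that)
  have dom: "C c + of_real t \<in> cut_domain ?L ?R" if "\<bar>t\<bar> \<le> 2" for c t
    unfolding cut_domain_iff
  proof (intro conjI ballI impI)
    have Cc: "C c \<in> cut_domain ?A ?B" using C(3) by (simp add: cut_domain_def)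
    fix e
    { assume "e \<in> ?L" and i: "Im (C c + of_real t) = Im e"
      hence "Re (e + 2) < Re (C c)" using Cc by (simp add: cut_domain_iff)
      thus "Re e < Re (C c + of_real t)" using that by auto }
    { assume "e \<in> ?R" and i: "Im (C c + of_real t) = Im e"
      hence "Re (C c) < Re (e - 2)" using Cc by (simp add: cut_domain_iff)
      thus "Re (C c + of_real t) < Re e" using that by auto }
  qed
  show ?thesis
  proof (rule that[OF C(1)])
    fix c t :: real assume t: "\<bar>t\<bar> \<le> 2"
    note d = dom[OF t, of c, unfolded set_left_ends set_right_ends cut_domain_shift_Un]
    show "x + C c + of_real t \<in> cut_domain (phi_left lam \<beta> \<sigma>) (phi_right lam \<sigma>)" using d[THEN conjunct1] by (simp add: add.assoc)
    show "C c + of_real t \<in> cut_domain (theta_left \<tau> lam \<rho>) (theta_right \<tau> lam \<alpha> \<rho>)" using d by (rule conjunct2)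
  qed
qed

lemma psi_contour_exists:
  assumes "generic_arg \<tau> lam \<alpha> \<rho> \<beta> \<sigma> x"
  obtains C where "psi_contour \<tau> lam \<alpha> \<rho> \<beta> \<sigma> x C"
proof -
  obtain C where C: "vertical_deformation 0 C"
    "\<And>c t. \<bar>t\<bar> \<le> 2 \<Longrightarrow> x + C c + of_real t \<in> cut_domain (phi_left lam \<beta> \<sigma>) (phi_right lam \<sigma>)"
    "\<And>c t. \<bar>t\<bar> \<le> 2 \<Longrightarrow> C c + of_real t \<in> cut_domain (theta_left \<tau> lam \<rho>) (theta_right \<tau> lam \<alpha> \<rho>)"
    by (rule psi_contour_wide[OF assms], rule that)
  have "psi_contour \<tau> lam \<alpha> \<rho> \<beta> \<sigma> x C"
    unfolding psi_contour_iff set_left_ends set_right_ends cut_domain_shift_Un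
    using C(1) C(2,3)[of 0] by simp
  thus ?thesis by (rule that)
qed

text \<open>A separate local continuation exists on each strip
  \<open>\<bar>Re x\<bar> < n + 1\<close>. At generic points they all equal the same integral, and
  such points accumulate everywhere, so their normalised versions agree on overlaps and
  glue.\<close>

lemma psi_exists:
  assumes \<tau>: "\<tau> < 0" and gen: "generic_params \<tau> lam \<alpha> \<rho> \<beta> \<sigma>"
  shows "\<exists>F. F nicely_meromorphic_on UNIV \<and>
        (\<forall>x C. generic_arg \<tau> lam \<alpha> \<rho> \<beta> \<sigma> x \<longrightarrow> psi_contour \<tau> lam \<alpha> \<rho> \<beta> \<sigma> x C \<longrightarrow>
           has_line_integral (psi_integrand \<tau> lam \<alpha> \<rho> \<beta> \<sigma> x) (F x) C)"
proof -
  let ?gen = "generic_arg \<tau> lam \<alpha> \<rho> \<beta> \<sigma>" and ?con = "psi_contour \<tau> lam \<alpha> \<rho> \<beta> \<sigma>" and ?f = "psi_integrand \<tau> lam \<alpha> \<rho> \<beta> \<sigma>"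
  obtain S where S: "finite S" "\<And>x. Im x \<notin> S \<Longrightarrow> ?gen x" using gen unfolding generic_params_def by blast
  define D where "D = (\<lambda>n::nat. {x::complex. \<bar>Re x\<bar> < real n + 1})"
  have "\<exists>h. h meromorphic_on D n \<and> (\<forall>x. \<bar>Re x\<bar> < real n + 1 \<longrightarrow> ?gen x \<longrightarrow> h analytic_on {x} \<and>
      (\<forall>C. ?con x C \<longrightarrow> has_line_integral (?f x) (h x) C))" for n
    unfolding D_def by (rule psi_local[OF \<tau>]) auto
  then obtain h where h: "\<And>n. h n meromorphic_on D n"
    "\<And>n x. x \<in> D n \<Longrightarrow> ?gen x \<Longrightarrow> h n analytic_on {x}"
    "\<And>n x C. x \<in> D n \<Longrightarrow> ?gen x \<Longrightarrow> ?con x C \<Longrightarrow> has_line_integral (?f x) (h n x) C"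
    unfolding D_def mem_Collect_eq by metis
  define H where "H = (\<lambda>n. remove_sings (h n))"
  have opD: "open (D n)" for n unfolding D_def by (rule open_strip)
  have H: "H n nicely_meromorphic_on D n" for n
    unfolding H_def by (rule remove_sings_nicely_meromorphic[OF h(1)])
  \<comment> \<open>At generic points the local continuation is analytic already, hence
    normalisation does not change the value of the integral.\<close>
  have Hh: "H n x = h n x" if "x \<in> D n" "?gen x" for n x
    unfolding H_def using h(2)[OF that] by (rule remove_sings_at_analytic)
  have HH: "H n x = H m x" if x: "x \<in> D n" "x \<in> D m" for n m x
  proof (rule nicely_meromorphic_eqI[of "H n" "D n \<inter> D m" "H m" x])
    show "H n nicely_meromorphic_on D n \<inter> D m" "H m nicely_meromorphic_on D n \<inter> D m"
      by (rule nicely_meromorphic_on_subset[OF H]; simp)+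
    have "eventually (\<lambda>w. w \<in> D n \<inter> D m) (at x)"
      by (rule eventually_at_in_open') (use x opD in auto)
    with frequently_Im_notin[OF S(1)] have "\<exists>\<^sub>F w in at x. Im w \<notin> S \<and> w \<in> D n \<inter> D m"
      by (rule frequently_eventually_frequently)
    moreover have "H n w = H m w" if w: "Im w \<notin> S \<and> w \<in> D n \<inter> D m" for w
    proof -
      have g: "?gen w" using w S(2) by blast
      obtain C where C: "?con w C" by (rule psi_contour_exists[OF g])
      have "h n w = h m w" using h(3)[OF _ g C, of n] h(3)[OF _ g C, of m] w has_line_integral_unique by blast
      thus "H n w = H m w" using Hh[OF _ g, of n] Hh[OF _ g, of m] w by simp
    qed
    ultimately show "\<exists>\<^sub>F w in at x. H n w = H m w" by (rule frequently_elim1)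
  qed (use x in auto)
  define N where "N = (\<lambda>x::complex. nat \<lceil>\<bar>Re x\<bar>\<rceil>)"
  have N: "x \<in> D (N x)" for x unfolding D_def N_def mem_Collect_eq by linarith
  define F where "F = (\<lambda>x. H (N x) x)"
  have FH: "F x = H n x" if "x \<in> D n" for x n unfolding F_def by (rule HH[OF N that])
  have "F nicely_meromorphic_on UNIV" unfolding nicely_meromorphic_on_def
  proof (intro conjI ballI)
    have ev: "eventually (\<lambda>w. F w = H (N z) w) (at z)" for z
      using eventually_at_in_open'[OF opD N[of z]] by eventually_elim (rule FH)
    have "F meromorphic_on {z}" for z
    proof -
      have "H (N z) meromorphic_on {z}"
        using H[of "N z"] N[of z] meromorphic_on_subset unfolding nicely_meromorphic_on_def by blast
      thus ?thesis by (subst meromorphic_on_cong[where g = "H (N z)" and B = "{z}"]) (use ev in auto)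
    qed
    thus "F meromorphic_on UNIV" by (metis meromorphic_on_meromorphic_at)
    fix z :: complex
    have "is_pole F z \<longleftrightarrow> is_pole (H (N z)) z" by (intro is_pole_cong ev refl)
    moreover have "F \<midarrow>z\<rightarrow> c \<longleftrightarrow> H (N z) \<midarrow>z\<rightarrow> c" for c by (intro tendsto_cong ev)
    moreover have "F z = H (N z) z" by (rule FH[OF N])
    ultimately show "is_pole F z \<and> F z = 0 \<or> F \<midarrow>z\<rightarrow> F z"
      using H[of "N z"] N[of z] unfolding nicely_meromorphic_on_def by metis
  qed
  moreover have "has_line_integral (?f x) (F x) C" if "?gen x" "?con x C" for x C
    using h(3)[OF N that] FH[OF N, of x] Hh[OF N that(1)] by simp
  ultimately show ?thesis by blast
qed

text \<open>Two candidates agree at all generic heights, because an admissible contour exists there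
  and determines the value; the identity theorem makes the description definite.\<close>

lemma psi_spec:
  assumes \<tau>: "\<tau> < 0" and gen: "generic_params \<tau> lam \<alpha> \<rho> \<beta> \<sigma>"
  shows "psi \<tau> lam \<alpha> \<rho> \<beta> \<sigma> nicely_meromorphic_on UNIV"
    "\<And>x C. generic_arg \<tau> lam \<alpha> \<rho> \<beta> \<sigma> x \<Longrightarrow> psi_contour \<tau> lam \<alpha> \<rho> \<beta> \<sigma> x C \<Longrightarrow>
      has_line_integral (psi_integrand \<tau> lam \<alpha> \<rho> \<beta> \<sigma> x) (psi \<tau> lam \<alpha> \<rho> \<beta> \<sigma> x) C"
proof -
  let ?P = "\<lambda>F. F nicely_meromorphic_on UNIV \<and>
        (\<forall>x C. generic_arg \<tau> lam \<alpha> \<rho> \<beta> \<sigma> x \<longrightarrow> psi_contour \<tau> lam \<alpha> \<rho> \<beta> \<sigma> x C \<longrightarrow>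
           has_line_integral (psi_integrand \<tau> lam \<alpha> \<rho> \<beta> \<sigma> x) (F x) C)"
  obtain S where S: "finite S" "\<And>x. Im x \<notin> S \<Longrightarrow> generic_arg \<tau> lam \<alpha> \<rho> \<beta> \<sigma> x" using gen unfolding generic_params_def by blast
  have uniq: "F = G" if F: "?P F" and G: "?P G" for F G
  proof
    fix x show "F x = G x"
    proof (rule nicely_meromorphic_eqI[of F UNIV G x])
      have "F w = G w" if "Im w \<notin> S" for w
      proof -
        have g: "generic_arg \<tau> lam \<alpha> \<rho> \<beta> \<sigma> w" by (rule S(2)[OF that])
        obtain C where C: "psi_contour \<tau> lam \<alpha> \<rho> \<beta> \<sigma> w C" by (rule psi_contour_exists[OF g])
        show "F w = G w" using F G g C has_line_integral_unique by blast
      qed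
      with frequently_Im_notin[OF S(1)] show "\<exists>\<^sub>F w in at x. F w = G w" by (rule frequently_elim1)
    qed (use F G in auto)
  qed
  obtain F where F: "?P F" using psi_exists[OF assms] by blast
  have "?P (psi \<tau> lam \<alpha> \<rho> \<beta> \<sigma>)"
    unfolding psi_def by (rule theI[of ?P, OF F uniq[OF _ F]])
  thus "psi \<tau> lam \<alpha> \<rho> \<beta> \<sigma> nicely_meromorphic_on UNIV"
    "\<And>x C. generic_arg \<tau> lam \<alpha> \<rho> \<beta> \<sigma> x \<Longrightarrow> psi_contour \<tau> lam \<alpha> \<rho> \<beta> \<sigma> x C \<Longrightarrow>
      has_line_integral (psi_integrand \<tau> lam \<alpha> \<rho> \<beta> \<sigma> x) (psi \<tau> lam \<alpha> \<rho> \<beta> \<sigma> x) C" by blast+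
qed

subsection \<open>The difference equation\<close>

text \<open>The half power \<open>q^(u/2)\<close>. In these terms \<open>qsum\<close> and
  \<open>qdiff\<close> are \<open>2 * cos\<close> and \<open>2 * \<i> * sin\<close> of
  \<open>pi * \<tau> * u\<close>.\<close>

definition qexp :: "real \<Rightarrow> complex \<Rightarrow> complex" where
  "qexp \<tau> u = exp (\<i> * of_real pi * of_real \<tau> * u)"

definition qsum :: "real \<Rightarrow> complex \<Rightarrow> complex" where
  "qsum \<tau> u = qexp \<tau> u + qexp \<tau> (- u)"

definition qdiff :: "real \<Rightarrow> complex \<Rightarrow> complex" where
  "qdiff \<tau> u = qexp \<tau> u - qexp \<tau> (- u)"

lemma qexp_nonzero [simp]: "qexp \<tau> u \<noteq> 0"
  by (simp add: qexp_def)

lemma qexp_add: "qexp \<tau> (u + v) = qexp \<tau> u * qexp \<tau> v"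
  by (simp add: qexp_def exp_add[symmetric] algebra_simps)

lemma qexp_minus: "qexp \<tau> (- u) = inverse (qexp \<tau> u)"
  by (simp add: qexp_def exp_minus[symmetric])

lemma qexp_diff: "qexp \<tau> (u - v) = qexp \<tau> u / qexp \<tau> v"
  using qexp_add[of \<tau> u "- v"] by (simp add: qexp_minus divide_inverse)

lemma qexp_holomorphic [holomorphic_intros]:
  "f holomorphic_on A \<Longrightarrow> (\<lambda>z. qexp \<tau> (f z)) holomorphic_on A"
  unfolding qexp_def by (intro holomorphic_intros)

lemma qdiff_minus [simp]: "qdiff \<tau> (- u) = - qdiff \<tau> u"
  by (simp add: qdiff_def)

text \<open>Product-to-sum formula. It separates the variable from the parameters: a pair of cosine
  factors depends on its parameter through a single sum only.\<close>

lemma qdiff_mult_qdiff: "qdiff \<tau> (u + v) * qdiff \<tau> (u - v) = qsum \<tau> (2 * u) - qsum \<tau> (2 * v)"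
proof -
  have "qexp \<tau> (2 * w) = qexp \<tau> w ^ 2" for w using qexp_add[of \<tau> w w] by (simp add: power2_eq_square)
  thus ?thesis
    unfolding qdiff_def qsum_def by (simp add: qexp_minus qexp_add qexp_diff field_simps power2_eq_square)
qed

lemma qpow_eq_qexp: "qpow \<tau> u = qexp \<tau> (2 * u)"
  by (simp add: qpow_def qexp_def mult_ac)

lemma one_minus_qpow: "1 - qpow \<tau> u = - (qexp \<tau> u * qdiff \<tau> u)"
proof -
  have "qexp \<tau> (2 * u) = qexp \<tau> u * qexp \<tau> u" using qexp_add[of \<tau> u u] by simp
  thus ?thesis by (simp add: qpow_eq_qexp qdiff_def qexp_minus algebra_simps)
qed

text \<open>\<open>1 / (2 * \<tau>)\<close> is a quarter period of
  \<open>cosfac (2 * \<tau>)\<close>, that is, \<open>qexp \<tau>\<close> takes the value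
  \<open>\<i>\<close> there; this shift turns cosines into sines.\<close>

lemma cosfac_half:
  assumes "\<tau> < 0"
  shows "cosfac (2 * \<tau>) (u + 1 / (2 * of_real \<tau>)) = \<i> * qdiff \<tau> u"
    and "cosfac (2 * \<tau>) (u - 1 / (2 * of_real \<tau>)) = - (\<i> * qdiff \<tau> u)"
proof -
  define h where "h = 1 / (2 * complex_of_real \<tau>)"
  have c: "cosfac (2 * \<tau>) v = qexp \<tau> v + inverse (qexp \<tau> v)" for v
    unfolding cosfac_def qexp_def cos_exp_eq by (simp add: exp_minus[symmetric] mult_ac)
  have "\<i> * of_real pi * of_real \<tau> * h = \<i> * of_real (pi / 2)"
    using assms by (simp add: h_def)
  hence "qexp \<tau> h = cis (pi / 2)" unfolding qexp_def cis_conv_exp by (rule arg_cong)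
  hence "qexp \<tau> h = \<i>" by simp
  thus "cosfac (2 * \<tau>) (u + 1 / (2 * of_real \<tau>)) = \<i> * qdiff \<tau> u"
    "cosfac (2 * \<tau>) (u - 1 / (2 * of_real \<tau>)) = - (\<i> * qdiff \<tau> u)"
    unfolding h_def[symmetric] c qdiff_def by (simp_all add: qexp_add qexp_diff qexp_minus field_simps)
qed

lemma qdiff_nonzero:
  assumes "\<tau> < 0" "Im u \<noteq> 0"
  shows "qdiff \<tau> u \<noteq> 0"
proof
  assume "qdiff \<tau> u = 0"
  hence "cosfac (2 * \<tau>) (u + 1 / (2 * of_real \<tau>)) = 0" using cosfac_half(1)[OF assms(1)] by simp
  hence "Im (u + 1 / (2 * of_real \<tau>)) = 0" using assms(1) by (intro cosfac_zero(1)[of "2 * \<tau>"]) auto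
  moreover have "Im (1 / complex_of_real (2 * \<tau>)) = 0" by (rule Re_one_over_of_real)
  ultimately show False using assms(2) by simp
qed

lemma hyp_G_shift_down:
  assumes "\<tau> < 0" "Im z \<noteq> 0"
  shows "hyp_G \<tau> z = cosfac \<tau> (z - 1) * hyp_G \<tau> (z - 2)"
  using hyp_G_shift[of \<tau> "z - 2"] cosfac_zero(1)[of \<tau> "z - 1"] assms by auto

lemma exp_bound_qexp_laurent:
  assumes "\<tau> < 0"
  shows "exp_bound (2 * pi * \<tau>) (\<lambda>z. a * qexp \<tau> (2 * z) + b + c / qexp \<tau> (2 * z))"
  unfolding exp_bound_def
proof (intro allI exI impI)
  fix K z assume "\<bar>Re z\<bar> \<le> K" "0 \<le> \<bar>Im z\<bar>"
  let ?E = "exp (- (2 * pi * \<tau>) * \<bar>Im z\<bar>)"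
  have p: "2 * pi * \<tau> \<le> 0" using assms by (simp add: mult_le_0_iff)
  have n: "norm (qexp \<tau> (2 * z)) = exp (- (2 * pi * \<tau>) * Im z)" "norm (inverse (qexp \<tau> (2 * z))) = exp (- (2 * pi * \<tau>) * - Im z)"
    by (simp_all add: qexp_def norm_inverse exp_minus)
  have "norm (qexp \<tau> (2 * z)) \<le> ?E"
    unfolding n exp_le_cancel_iff using p by (intro mult_left_mono) auto
  moreover have "norm (inverse (qexp \<tau> (2 * z))) \<le> ?E"
    unfolding n exp_le_cancel_iff using p by (intro mult_left_mono) auto
  moreover have "1 \<le> ?E" using p by (simp only: one_le_exp_iff) (rule mult_nonneg_nonneg; simp)
  ultimately have bnd: "norm (qexp \<tau> (2 * z)) \<le> ?E" "norm (inverse (qexp \<tau> (2 * z))) \<le> ?E" "1 \<le> ?E" .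
  have "norm a * norm (qexp \<tau> (2 * z)) + norm b * 1 + norm c * norm (inverse (qexp \<tau> (2 * z)))
      \<le> norm a * ?E + norm b * ?E + norm c * ?E"
    by (intro add_mono mult_left_mono bnd norm_ge_zero)
  moreover have "norm (a * qexp \<tau> (2 * z) + b + c / qexp \<tau> (2 * z)) \<le>
      norm (a * qexp \<tau> (2 * z)) + norm b + norm (c / qexp \<tau> (2 * z))"
    by (rule order_trans[OF norm_triangle_ineq add_mono[OF norm_triangle_ineq order_refl]])
  ultimately show "norm (a * qexp \<tau> (2 * z) + b + c / qexp \<tau> (2 * z)) \<le> (norm a + norm b + norm c) * ?E"
    by (simp only: norm_mult divide_inverse distrib_right)
qed

text \<open>Shift relations are available off finitely many heights. A contour meets each height
  once, so the exceptions are a null set of parameters.\<close>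

lemma has_line_integral_AE_unique:
  assumes "has_line_integral f I C" "has_line_integral g J C" "finite S" "\<And>c. c \<notin> S \<Longrightarrow> f (C c) = g (C c)"
  shows "I = J"
proof (rule has_bochner_integral_eq_AE[OF assms(1,2)[unfolded has_line_integral_def]])
  have "AE c in lborel. c \<notin> S"
    by (intro AE_not_in finite_imp_null_set_lborel assms(3))
  thus "AE c in lborel. f (C c) * vector_derivative C (at c) = g (C c) * vector_derivative C (at c)"
    by eventually_elim (simp add: assms(4))
qed

lemma vector_derivative_add_const: "vector_derivative (\<lambda>t. C t + z) (at c) = vector_derivative C (at c)"
  by (simp add: vector_derivative_def has_vector_derivative_add_const)

lemma has_line_integral_translate:
  "has_line_integral f I (\<lambda>c. C c + z) \<longleftrightarrow> has_line_integral (\<lambda>w. f (w + z)) I C"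
  by (simp add: has_line_integral_def vector_derivative_add_const)

lemma vertical_deformation_translate:
  assumes "vertical_deformation m C"
  shows "vertical_deformation (m + t) (\<lambda>c. C c + of_real t)"
proof -
  obtain R where "\<forall>c. \<bar>c\<bar> \<ge> R \<longrightarrow> C c = of_real m + \<i> * of_real c" "C piecewise_C1_differentiable_on {- R..R}"
    "(\<lambda>c. vector_derivative C (at c)) absolutely_integrable_on {- R..R}" "\<forall>c. Im (C c) = c"
    using assms unfolding vertical_deformation_def by blast
  thus ?thesis
    unfolding vertical_deformation_def vector_derivative_add_const
    by (intro conjI allI exI[of _ R] piecewise_C1_differentiable_add piecewise_C1_differentiable_const) auto
qed

section \<open>Shift relations of the two factors\<close>

lemma hyp_quot_shift_numerator:
  assumes "\<tau> < 0" "Im (w + u1) \<noteq> 0" "Im (w + u2) \<noteq> 0"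
  shows "hyp_quot \<tau> u1 u2 u3 u4 w = cosfac \<tau> (w + u1 - 1) * cosfac \<tau> (w + u2 - 1) * hyp_quot \<tau> (u1 - 2) (u2 - 2) u3 u4 w"
  unfolding hyp_quot_def hyp_G_shift_down[OF assms(1,2)] hyp_G_shift_down[OF assms(1,3)]
  by (simp add: algebra_simps)

lemma hyp_quot_shift:
  assumes \<tau>: "\<tau> < 0" and w: "Im (w + u1) \<noteq> 0" "Im (w + u2) \<noteq> 0" "Im (w + u3) \<noteq> 0" "Im (w + u4) \<noteq> 0"
  shows "hyp_quot \<tau> u1 u2 u3 u4 (w + 2) * (cosfac \<tau> (w + u3 + 1) * cosfac \<tau> (w + u4 + 1)) =
    cosfac \<tau> (w + u1 + 1) * cosfac \<tau> (w + u2 + 1) * hyp_quot \<tau> u1 u2 u3 u4 w"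
proof -
  have G: "hyp_G \<tau> (w + 2 + u) = cosfac \<tau> (w + u + 1) * hyp_G \<tau> (w + u)" and nz: "cosfac \<tau> (w + u + 1) \<noteq> 0"
    if "Im (w + u) \<noteq> 0" for u
  proof -
    show "cosfac \<tau> (w + u + 1) \<noteq> 0" using cosfac_zero(1)[OF \<tau>, of "w + u + 1"] that by auto
    from hyp_G_shift[OF \<tau> this] show "hyp_G \<tau> (w + 2 + u) = cosfac \<tau> (w + u + 1) * hyp_G \<tau> (w + u)"
      by (simp add: add_ac)
  qed
  show ?thesis
    unfolding hyp_quot_def using w G nz by simp
qed

lemma hyp_quot_shift_denominator:
  assumes \<tau>: "\<tau> < 0" and w: "Im (w + u3) \<noteq> 0" "Im (w + u4) \<noteq> 0"
  shows "hyp_quot \<tau> u1 u2 u3 u4 (w - 2) = cosfac \<tau> (w + u3 - 1) * cosfac \<tau> (w + u4 - 1) * hyp_quot \<tau> (u1 - 2) (u2 - 2) u3 u4 w"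
proof -
  have G: "hyp_G \<tau> (w + u) = cosfac \<tau> (w + u - 1) * hyp_G \<tau> (w - 2 + u)" and nz: "cosfac \<tau> (w + u - 1) \<noteq> 0"
    if "Im (w + u) \<noteq> 0" for u
  proof -
    show "cosfac \<tau> (w + u - 1) \<noteq> 0" using cosfac_zero(1)[OF \<tau>, of "w + u - 1"] that by auto
    show "hyp_G \<tau> (w + u) = cosfac \<tau> (w + u - 1) * hyp_G \<tau> (w - 2 + u)"
      using hyp_G_shift_down[OF \<tau> that] by (simp add: algebra_simps)
  qed
  have e: "w - 2 + u = w + (u - 2)" for u :: complex by simp
  show ?thesis
    unfolding hyp_quot_def using w G[of u3] G[of u4] nz[of u3] nz[of u4] unfolding e[of u1] e[of u2] by simp
qed

text \<open>
  \<open>psi_phi w\<close>, \<open>psi_phi (w - 2)\<close> and \<open>psi_phi (w + 2)\<close> are all trigonometric multiples of this function,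
  which makes it the natural building block of the telescoping antidifference.
\<close>

definition psi_phi_half :: "real \<Rightarrow> complex \<Rightarrow> complex \<Rightarrow> complex \<Rightarrow> complex \<Rightarrow> complex" where
  "psi_phi_half \<tau> lam \<beta> \<sigma> = (let h = 1 / (2 * of_real \<tau>) in
     hyp_quot (2 * \<tau>) (h + \<beta> + \<sigma> - \<i> * lam - 2) (h - \<beta> - \<sigma> - \<i> * lam - 2) (- h + 1 - \<sigma> + \<i> * lam) (- h + 1 + \<sigma> + \<i> * lam))"

text \<open>Lowering the two numerator parameters by 2 moves the left ends by 2 towards the contour
  and raises the rate by \<open>- 2 * pi * \<tau>\<close>.\<close>

lemma psi_phi_half_facts:
  assumes "\<tau> < 0"
  shows "psi_phi_half \<tau> lam \<beta> \<sigma> holomorphic_on cut_domain ((\<lambda>p. p + 2) ` phi_left lam \<beta> \<sigma>) (phi_right lam \<sigma>)"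
    "exp_bound (pi * \<tau> * (1 / \<tau> - 3 + 2 * Im lam)) (psi_phi_half \<tau> lam \<beta> \<sigma>)"
proof -
  have t: "2 * \<tau> < 0" using assms by simp
  define h where "h = 1 / (2 * complex_of_real \<tau>)"
  have h: "1 / complex_of_real (2 * \<tau>) = h" by (simp add: h_def)
  have hR: "Re h = 1 / (2 * \<tau>)" unfolding h[symmetric] by (rule Re_one_over_of_real)
  have "(\<lambda>p. p + 2) ` phi_left lam \<beta> \<sigma> = hyp_quot_left (2 * \<tau>) (h + \<beta> + \<sigma> - \<i> * lam - 2) (h - \<beta> - \<sigma> - \<i> * lam - 2)"
    unfolding phi_left_def hyp_quot_left_def h by (simp add: algebra_simps)
  moreover have "phi_right lam \<sigma> = hyp_quot_right (2 * \<tau>) (- h + 1 - \<sigma> + \<i> * lam) (- h + 1 + \<sigma> + \<i> * lam)"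
    unfolding phi_right_def hyp_quot_right_def h by (simp add: algebra_simps)
  ultimately show "psi_phi_half \<tau> lam \<beta> \<sigma> holomorphic_on cut_domain ((\<lambda>p. p + 2) ` phi_left lam \<beta> \<sigma>) (phi_right lam \<sigma>)"
    unfolding psi_phi_half_def Let_def h_def[symmetric] by (simp only: hyp_quot_holomorphic[OF t])
  have "pi * (2 * \<tau>) / 4 * Re ((h + \<beta> + \<sigma> - \<i> * lam - 2) + (h - \<beta> - \<sigma> - \<i> * lam - 2) - (- h + 1 - \<sigma> + \<i> * lam) - (- h + 1 + \<sigma> + \<i> * lam))
      = pi * \<tau> * (1 / \<tau> - 3 + 2 * Im lam)"
    using assms by (simp add: hR field_simps)
  with hyp_quot_exp_bound[OF t] show "exp_bound (pi * \<tau> * (1 / \<tau> - 3 + 2 * Im lam)) (psi_phi_half \<tau> lam \<beta> \<sigma>)"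
    unfolding psi_phi_half_def Let_def h_def[symmetric] by metis
qed

text \<open>\<open>n1\<close>, \<open>n2\<close>, \<open>d1\<close>, \<open>d2\<close> are, up to
  sign, products of the two cosine factors met when shifting numerators and denominators. The
  relations at \<open>w + 2\<close> are multiplied by \<open>d2\<close> so that no quotient appears;
  \<open>d2 \<noteq> 0\<close> allows cancelling it later.\<close>

lemma psi_phi_shifts:
  fixes lam \<beta> \<sigma> w :: complex
  assumes \<tau>: "\<tau> < 0" and w: "Im w \<notin> Im ` (phi_left lam \<beta> \<sigma> \<union> phi_right lam \<sigma>)"
  defines "n1 \<equiv> qsum \<tau> (2 * (w - 1 - \<i> * lam)) - qsum \<tau> (2 * (\<beta> + \<sigma>))"
    and "n2 \<equiv> qsum \<tau> (2 * (w + 1 - \<i> * lam)) - qsum \<tau> (2 * (\<beta> + \<sigma>))"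
    and "d1 \<equiv> qsum \<tau> (2 * (w + \<i> * lam)) - qsum \<tau> (2 * \<sigma>)"
    and "d2 \<equiv> qsum \<tau> (2 * (w + 2 + \<i> * lam)) - qsum \<tau> (2 * \<sigma>)"
  shows "psi_phi \<tau> lam \<beta> \<sigma> w = - n1 * psi_phi_half \<tau> lam \<beta> \<sigma> w"
    "psi_phi \<tau> lam \<beta> \<sigma> (w - 2) = - d1 * psi_phi_half \<tau> lam \<beta> \<sigma> w"
    "psi_phi \<tau> lam \<beta> \<sigma> (w + 2) * d2 = - n2 * n1 * psi_phi_half \<tau> lam \<beta> \<sigma> w"
    "psi_phi_half \<tau> lam \<beta> \<sigma> (w + 2) * d2 = n1 * psi_phi_half \<tau> lam \<beta> \<sigma> w"
    "d2 \<noteq> 0"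
proof -
  have t: "2 * \<tau> < 0" using \<tau> by simp
  define h where "h = 1 / (2 * complex_of_real \<tau>)"
  have h: "1 / complex_of_real (2 * \<tau>) = h" by (simp add: h_def)
  have [simp]: "Im h = 0" unfolding h[symmetric] by (rule Re_one_over_of_real)
  note c = cosfac_half[OF \<tau>, folded h_def]
  have im: "Im (w + (\<beta> + \<sigma> - \<i> * lam)) \<noteq> 0" "Im (w + (- \<beta> - \<sigma> - \<i> * lam)) \<noteq> 0"
    "Im (w + (- \<sigma> + \<i> * lam)) \<noteq> 0" "Im (w + (\<sigma> + \<i> * lam)) \<noteq> 0"
    using w by (auto simp: phi_left_def phi_right_def)
  have N: "qdiff \<tau> (u + (\<beta> + \<sigma>)) * qdiff \<tau> (u - (\<beta> + \<sigma>)) = qsum \<tau> (2 * u) - qsum \<tau> (2 * (\<beta> + \<sigma>))"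
    and D: "qdiff \<tau> (u + \<sigma>) * qdiff \<tau> (u - \<sigma>) = qsum \<tau> (2 * u) - qsum \<tau> (2 * \<sigma>)" for u
    by (rule qdiff_mult_qdiff)+
  have cn1: "cosfac (2 * \<tau>) (w + (h + \<beta> + \<sigma> - \<i> * lam) - 1) * cosfac (2 * \<tau>) (w + (h - \<beta> - \<sigma> - \<i> * lam) - 1) = - n1"
    using c(1)[of "w - 1 - \<i> * lam + (\<beta> + \<sigma>)"] c(1)[of "w - 1 - \<i> * lam - (\<beta> + \<sigma>)"] N[of "w - 1 - \<i> * lam"]
    unfolding n1_def by (simp add: algebra_simps)
  have cn2: "cosfac (2 * \<tau>) (w + 2 + (h + \<beta> + \<sigma> - \<i> * lam) - 1) * cosfac (2 * \<tau>) (w + 2 + (h - \<beta> - \<sigma> - \<i> * lam) - 1) = - n2"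
    using c(1)[of "w + 1 - \<i> * lam + (\<beta> + \<sigma>)"] c(1)[of "w + 1 - \<i> * lam - (\<beta> + \<sigma>)"] N[of "w + 1 - \<i> * lam"]
    unfolding n2_def by (simp add: algebra_simps)
  have cd1: "cosfac (2 * \<tau>) (w + (- h + 1 - \<sigma> + \<i> * lam) - 1) * cosfac (2 * \<tau>) (w + (- h + 1 + \<sigma> + \<i> * lam) - 1) = - d1"
    using c(2)[of "w + \<i> * lam + \<sigma>"] c(2)[of "w + \<i> * lam - \<sigma>"] D[of "w + \<i> * lam"]
    unfolding d1_def by (simp add: algebra_simps)
  have cd2: "cosfac (2 * \<tau>) (w + (- h + 1 - \<sigma> + \<i> * lam) + 1) * cosfac (2 * \<tau>) (w + (- h + 1 + \<sigma> + \<i> * lam) + 1) = - d2"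
    using c(2)[of "w + 2 + \<i> * lam + \<sigma>"] c(2)[of "w + 2 + \<i> * lam - \<sigma>"] D[of "w + 2 + \<i> * lam"]
    unfolding d2_def by (simp add: algebra_simps)
  let ?u1 = "h + \<beta> + \<sigma> - \<i> * lam" and ?u2 = "h - \<beta> - \<sigma> - \<i> * lam"
    and ?u3 = "- h + 1 - \<sigma> + \<i> * lam" and ?u4 = "- h + 1 + \<sigma> + \<i> * lam"
  have imu: "Im (w + ?u1) \<noteq> 0" "Im (w + ?u2) \<noteq> 0" "Im (w + ?u3) \<noteq> 0" "Im (w + ?u4) \<noteq> 0" using im by simp_all
  hence im2: "Im (w + 2 + ?u1) \<noteq> 0" "Im (w + 2 + ?u2) \<noteq> 0" "Im (w + (?u1 - 2)) \<noteq> 0" "Im (w + (?u2 - 2)) \<noteq> 0" by simp_all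
  have d: "psi_phi \<tau> lam \<beta> \<sigma> = hyp_quot (2 * \<tau>) ?u1 ?u2 ?u3 ?u4"
    "psi_phi_half \<tau> lam \<beta> \<sigma> = hyp_quot (2 * \<tau>) (?u1 - 2) (?u2 - 2) ?u3 ?u4"
    unfolding psi_phi_def psi_phi_half_def Let_def h_def[symmetric] by rule+
  show p0: "psi_phi \<tau> lam \<beta> \<sigma> w = - n1 * psi_phi_half \<tau> lam \<beta> \<sigma> w"
    unfolding d cn1[symmetric] by (rule hyp_quot_shift_numerator[OF t imu(1,2)])
  show "psi_phi \<tau> lam \<beta> \<sigma> (w - 2) = - d1 * psi_phi_half \<tau> lam \<beta> \<sigma> w"
    unfolding d cd1[symmetric] by (rule hyp_quot_shift_denominator[OF t imu(3,4)])
  have e: "w + (?u1 - 2) + 1 = w + ?u1 - 1" "w + (?u2 - 2) + 1 = w + ?u2 - 1" by simp_all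
  have "psi_phi_half \<tau> lam \<beta> \<sigma> (w + 2) * (- d2) = - n1 * psi_phi_half \<tau> lam \<beta> \<sigma> w"
    using hyp_quot_shift[OF t im2(3,4) imu(3,4)] unfolding d e cn1 cd2 .
  thus p1: "psi_phi_half \<tau> lam \<beta> \<sigma> (w + 2) * d2 = n1 * psi_phi_half \<tau> lam \<beta> \<sigma> w" by simp
  have "psi_phi \<tau> lam \<beta> \<sigma> (w + 2) = - n2 * psi_phi_half \<tau> lam \<beta> \<sigma> (w + 2)"
    unfolding d cn2[symmetric] by (rule hyp_quot_shift_numerator[OF t im2(1,2)])
  thus "psi_phi \<tau> lam \<beta> \<sigma> (w + 2) * d2 = - n2 * n1 * psi_phi_half \<tau> lam \<beta> \<sigma> w"
    using p1 by (simp add: mult.assoc)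
  have "qdiff \<tau> (w + 2 + \<i> * lam + \<sigma>) \<noteq> 0" "qdiff \<tau> (w + 2 + \<i> * lam - \<sigma>) \<noteq> 0"
    using im(3,4) by (intro qdiff_nonzero[OF \<tau>]; simp)+
  thus "d2 \<noteq> 0" using D[of "w + 2 + \<i> * lam"] unfolding d2_def by (metis mult_eq_0_iff)
qed

lemma psi_theta_shift:
  fixes lam \<alpha> \<rho> z :: complex
  assumes \<tau>: "\<tau> < 0" and z: "Im z \<notin> Im ` (theta_left \<tau> lam \<rho> \<union> theta_right \<tau> lam \<alpha> \<rho>)"
  shows "psi_theta \<tau> lam \<alpha> \<rho> (z + 2) * (qsum \<tau> (2 * (z + 2 - \<i> * lam)) - qsum \<tau> (2 * (\<alpha> + \<rho>)))
    = (qsum \<tau> (2 * (z + 1 + \<i> * lam)) - qsum \<tau> (2 * \<rho>)) * psi_theta \<tau> lam \<alpha> \<rho> z"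
proof -
  have t: "2 * \<tau> < 0" using \<tau> by simp
  define h where "h = 1 / (2 * complex_of_real \<tau>)"
  have h: "1 / complex_of_real (2 * \<tau>) = h" by (simp add: h_def)
  have [simp]: "Im h = 0" unfolding h[symmetric] by (rule Re_one_over_of_real)
  have hh: "1 / complex_of_real \<tau> = h + h" "- 1 / complex_of_real \<tau> = - h - h"
    using half_sum[of \<tau>] by (simp_all add: h_def)
  note c = cosfac_half[OF \<tau>, folded h_def]
  let ?u1 = "- h + \<rho> + \<i> * lam" and ?u2 = "h - \<rho> + \<i> * lam"
    and ?u3 = "- h + 1 + \<alpha> + \<rho> - \<i> * lam" and ?u4 = "h + 1 - \<alpha> - \<rho> - \<i> * lam"
  have imu: "Im (z + ?u1) \<noteq> 0" "Im (z + ?u2) \<noteq> 0" "Im (z + ?u3) \<noteq> 0" "Im (z + ?u4) \<noteq> 0"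
    using z by (auto simp: theta_left_def theta_right_def hh)
  have "cosfac (2 * \<tau>) (z + ?u3 + 1) * cosfac (2 * \<tau>) (z + ?u4 + 1) = qsum \<tau> (2 * (z + 2 - \<i> * lam)) - qsum \<tau> (2 * (\<alpha> + \<rho>))"
    using c(2)[of "z + 2 - \<i> * lam + (\<alpha> + \<rho>)"] c(1)[of "z + 2 - \<i> * lam - (\<alpha> + \<rho>)"]
      qdiff_mult_qdiff[of \<tau> "z + 2 - \<i> * lam" "\<alpha> + \<rho>"]
    by (simp add: algebra_simps)
  moreover have "cosfac (2 * \<tau>) (z + ?u1 + 1) * cosfac (2 * \<tau>) (z + ?u2 + 1) = qsum \<tau> (2 * (z + 1 + \<i> * lam)) - qsum \<tau> (2 * \<rho>)"
    using c(2)[of "z + 1 + \<i> * lam + \<rho>"] c(1)[of "z + 1 + \<i> * lam - \<rho>"]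
      qdiff_mult_qdiff[of \<tau> "z + 1 + \<i> * lam" "\<rho>"]
    by (simp add: algebra_simps)
  moreover have "psi_theta \<tau> lam \<alpha> \<rho> = hyp_quot (2 * \<tau>) ?u1 ?u2 ?u3 ?u4"
    unfolding psi_theta_def Let_def h_def[symmetric] by rule
  ultimately show ?thesis using hyp_quot_shift[OF t imu] by metis
qed

lemma generic_arg_real_shift: "Im x = Im y \<Longrightarrow> generic_arg \<tau> lam \<alpha> \<rho> \<beta> \<sigma> x = generic_arg \<tau> lam \<alpha> \<rho> \<beta> \<sigma> y"
  by (simp add: generic_arg_def left_ends_def right_ends_def)

text \<open>Comparison of coefficients in \<open>Z\<close>. The hypotheses on \<open>r2\<close> and
  \<open>p2\<close> cancel the powers \<open>Z^3\<close> and \<open>Z^(-3)\<close>, leaving five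
  coefficients.\<close>

lemma laurent_combination:
  fixes Z T :: complex
  assumes "Z \<noteq> 0" "T \<noteq> 0" "r2 = q2 * T^2" "p2 = s2 * T^2"
  shows "Z^2 * (tp * (T^2 * q1 + r1) + t0 * (q2 - r2)) + Z * (tp * (T^2 * q0 - r0) + t0 * (q1 + r1) + tm * (q2/T^2 - r2))
    + (tp * (T^2 * p1 + s1) + t0 * (q0 - r0) + tm * (q1/T^2 + r1))
    + (tm * (1/T^2 * q0 - r0) + t0 * (p1 + s1) + tp * (T^2*p2 - s2)) / Z
    + (tm * (1/T^2 * p1 + s1) + t0 * (p2 - s2)) / Z^2
   = (tp * (Z*T^2) + t0 + tm / (Z*T^2)) * (Z^2 * q2 + Z * q1 + q0 + p1/Z + p2/Z^2)
     - (tp * Z + t0 + tm / Z) * (Z^2 * r2 + Z * (-r1) + r0 + (-s1)/Z + s2/Z^2)"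
  using assms(1,2) unfolding assms(3,4) by (simp add: divide_simps) algebra

text \<open>
  With \<open>e u = qexp \<tau> (2 * u)\<close>, the letters stand for \<open>X = e x\<close>, \<open>L = e (\<i> * lam)\<close>, \<open>T = e 1\<close>,
  \<open>U = e \<sigma>\<close>, \<open>V = e (\<beta> + \<sigma>)\<close>, \<open>Z = e z\<close>, \<open>R = e \<rho> + e (- \<rho>)\<close> and \<open>P = e (\<alpha> + \<rho>) + e (- \<alpha> - \<rho>)\<close>;
  \<open>Np\<close>, \<open>Nm\<close> and \<open>DD\<close> are the coefficients of the three term relation, cleared of denominators.
  The ansatz of a Laurent polynomial \<open>tp * Z + t0 + tm / Z\<close> in the telescoping identity gives an
  overdetermined linear system for \<open>tp\<close>, \<open>t0\<close>, \<open>tm\<close>; its solution is recorded here, and \<open>c2\<close>, \<open>c1\<close>,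
  \<open>c0\<close>, \<open>cm1\<close>, \<open>cm2\<close> compare the coefficients of the powers of \<open>Z\<close>.
\<close>

locale aw_cert =
  fixes X L T U V R P :: complex
  assumes nz: "X \<noteq> 0" "L \<noteq> 0" "T \<noteq> 0" "U \<noteq> 0" "V \<noteq> 0"
begin
text \<open>For the intended letters \<open>s2\<close>, \<open>sp\<close>, \<open>sm\<close> are
  \<open>qdiff \<tau>\<close> at \<open>2 * x\<close>, \<open>2 * x + 2\<close>,
  \<open>2 * x - 2\<close>, while \<open>S\<close> and \<open>M\<close> are
  \<open>qsum \<tau>\<close> at \<open>2 * \<sigma>\<close> and
  \<open>2 * (\<beta> + \<sigma>)\<close>.\<close>

definition "s2 = X - 1/X"
definition "sp = X * T - 1/(X * T)"
definition "sm = X/T - T/X"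
definition "S = U + 1/U"
definition "M = V + 1/V"
definition "a1 = S * X/L^2 - M * X * T - R/(T * L^2)"
definition "a0 = X * T^2 * L^2 + 1/(X * T^2 * L^2) + R * M - X/L^2 - L^2/X"
definition "am = S * L^2/X - M/(X * T) - R * T * L^2"
definition "k = P * sp - M * (T^2 - 1/T^2)"
definition "tp = (a1 * sm + k) * X * L"
definition "t0 = a0 * sm - k * S"
definition "tm = (am * sm + k)/(X * L)"
definition "Np = (X * T * U+1/(X * T * U)-R) * (X * T/U+U/(X * T)-R)"
definition "Nm = (T * V/X+X/(T * V)-P) * (T/(X * V)+X * V/T-P)"
definition "DD = (X * T * U+1/(X * T * U)-R) * (X * T/V+V/(X * T)-P) * sm + (T * U/X+X/(T * U)-R) * (T/(X * V)+X * V/T-P) * sp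
    + (L^2+1/L^2-T * U/V-V/(T * U)) * (s2 * sp * sm)"

lemmas defs = s2_def sp_def sm_def S_def M_def a1_def a0_def am_def k_def tp_def t0_def tm_def Np_def Nm_def DD_def

lemma c2: "Np * sm * (X^2/L^2) + Nm * sp * (X^2*T^2*L^2) - DD * (X^2*T)
   = tp * (T^2 * (-(T*L*M + X/(T*L)*R)) + (1/L*S + X*T^2*L*P)) + t0 * (X - X*T^2)"
  using nz unfolding defs by (simp add: divide_simps) algebra

lemma c1: "Np * sm * (-(X/(T*L) + X*T/L)*M) + Nm * sp * (-(X*L + X*T^2*L)*S) - DD * (-(X/(T*L)*S + X*T^2*L*M))
   = tp * (T^2 * (T^2*L^2/X + X/(T^2*L^2) + R*M) - (1/(X*T^2*L^2) + X*T^2*L^2 + P*S))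
    + t0 * (-(T*L*M + X/(T*L)*R) + (1/L*S + X*T^2*L*P)) + tm * (X/T^2 - X*T^2)"
  using nz unfolding defs by (simp add: divide_simps) algebra

lemma c0: "Np * sm * (T^2 + 1/T^2 + M^2) + Nm * sp * (T^2 + 1/T^2 + S^2) - DD * (1/(T^3*L^2) + T^3*L^2 + M*S)
   = tp * (T^2 * (-(M/(T*L) + R*(T*L)/X)) + (L*S + P/(X*T^2*L)))
    + t0 * ((T^2*L^2/X + X/(T^2*L^2) + R*M) - (1/(X*T^2*L^2) + X*T^2*L^2 + P*S))
    + tm * ((-(T*L*M + X/(T*L)*R))/T^2 + (1/L*S + X*T^2*L*P))"
  using nz unfolding defs by (simp add: divide_simps) algebra

lemma cm1: "Np * sm * (-(T*L/X + L/(X*T))*M) + Nm * sp * (-(1/(X*L) + 1/(X*T^2*L))*S) - DD * (-(T*L/X*S + M/(X*T^2*L)))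
   = tm * (1/T^2 * (T^2*L^2/X + X/(T^2*L^2) + R*M) - (1/(X*T^2*L^2) + X*T^2*L^2 + P*S))
    + t0 * (-(M/(T*L) + R*(T*L)/X) + (L*S + P/(X*T^2*L))) + tp * (T^2 * (1/X) - 1/(X*T^2))"
  using nz unfolding defs by (simp add: divide_simps) algebra

lemma cm2: "Np * sm * (L^2/X^2) + Nm * sp / (X^2*T^2*L^2) - DD / (X^2*T)
   = tm * (1/T^2 * (-(M/(T*L) + R*(T*L)/X)) + (L*S + P/(X*T^2*L))) + t0 * (1/X - 1/(X*T^2))"
  using nz unfolding defs by (simp add: divide_simps) algebra

text \<open>The pointwise relation between the three integrands, multiplied by \<open>d2\<close> and
  divided by the common factor \<open>- psi_phi_half (x + z) * psi_theta z\<close>. What is left is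
  an identity of Laurent polynomials in \<open>Z\<close>.\<close>

lemma telescoping:
  assumes "Z \<noteq> 0"
  defines "n1 \<equiv> Z*X/(T*L) + T*L/(Z*X) - M" and "n2 \<equiv> Z*X*T/L + L/(Z*X*T) - M"
    and "d1 \<equiv> Z*X*L + 1/(Z*X*L) - S" and "d2 \<equiv> Z*X*T^2*L + 1/(Z*X*T^2*L) - S"
    and "n3 \<equiv> Z*T*L + 1/(Z*T*L) - R" and "d3 \<equiv> Z/L + L/Z - P"
  shows "Np * sm * n2 * n1 + Nm * sp * d1 * d2 - DD * n1 * d2
    = (tp * (Z*T^2) + t0 + tm / (Z*T^2)) * n3 * n1 - (tp * Z + t0 + tm / Z) * d3 * d2"
proof -
  have e1: "n2 * n1 = Z^2 * (X^2/L^2) + Z * (-(X/(T*L) + X*T/L)*M) + (T^2 + 1/T^2 + M^2)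
      + (-(T*L/X + L/(X*T))*M) / Z + (L^2/X^2) / Z^2"
    unfolding n1_def n2_def using nz assms(1) by (simp add: divide_simps) algebra
  have e2: "d1 * d2 = Z^2 * (X^2*T^2*L^2) + Z * (-(X*L + X*T^2*L)*S) + (T^2 + 1/T^2 + S^2)
      + (-(1/(X*L) + 1/(X*T^2*L))*S) / Z + 1/(X^2*T^2*L^2) / Z^2"
    unfolding d1_def d2_def using nz assms(1) by (simp add: divide_simps) algebra
  have e3: "n1 * d2 = Z^2 * (X^2*T) + Z * (-(X/(T*L)*S + X*T^2*L*M)) + (1/(T^3*L^2) + T^3*L^2 + M*S)
      + (-(T*L/X*S + M/(X*T^2*L))) / Z + 1/(X^2*T) / Z^2"
    unfolding n1_def d2_def using nz assms(1) by (simp add: divide_simps) algebra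
  have e4: "n3 * n1 = Z^2 * X + Z * (-(T*L*M + X/(T*L)*R)) + (T^2*L^2/X + X/(T^2*L^2) + R*M)
      + (-(M/(T*L) + R*(T*L)/X)) / Z + 1/X / Z^2"
    unfolding n1_def n3_def using nz assms(1) by (simp add: divide_simps) algebra
  have e5: "d3 * d2 = Z^2 * (X*T^2) + Z * (-(1/L*S + X*T^2*L*P)) + (1/(X*T^2*L^2) + X*T^2*L^2 + P*S)
      + (-(L*S + P/(X*T^2*L))) / Z + 1/(X*T^2) / Z^2"
    unfolding d2_def d3_def using nz assms(1) by (simp add: divide_simps) algebra
  have "Np * sm * (n2 * n1) + Nm * sp * (d1 * d2) - DD * (n1 * d2)
    = Z^2 * (Np * sm * (X^2/L^2) + Nm * sp * (X^2*T^2*L^2) - DD * (X^2*T))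
    + Z * (Np * sm * (-(X/(T*L) + X*T/L)*M) + Nm * sp * (-(X*L + X*T^2*L)*S) - DD * (-(X/(T*L)*S + X*T^2*L*M)))
    + (Np * sm * (T^2 + 1/T^2 + M^2) + Nm * sp * (T^2 + 1/T^2 + S^2) - DD * (1/(T^3*L^2) + T^3*L^2 + M*S))
    + (Np * sm * (-(T*L/X + L/(X*T))*M) + Nm * sp * (-(1/(X*L) + 1/(X*T^2*L))*S) - DD * (-(T*L/X*S + M/(X*T^2*L)))) / Z
    + (Np * sm * (L^2/X^2) + Nm * sp / (X^2*T^2*L^2) - DD / (X^2*T)) / Z^2"
    unfolding e1 e2 e3 by (simp only: diff_divide_distrib add_divide_distrib) (simp add: algebra_simps)
  also have "\<dots> = (tp * (Z*T^2) + t0 + tm / (Z*T^2)) * (n3 * n1) - (tp * Z + t0 + tm / Z) * (d3 * d2)"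
    unfolding c2 c1 c0 cm1 cm2 e4 e5
    by (rule laurent_combination) (use assms(1) nz in auto)
  finally show ?thesis by (simp only: mult.assoc)
qed

end

section \<open>The three term relation for the integral\<close>

lemma qsum_eq: "qsum \<tau> u = qexp \<tau> u + 1 / qexp \<tau> u"
  by (simp add: qsum_def qexp_minus divide_inverse)

text \<open>The telescoping identity is integrated over one wide contour, where \<open>K\<close> and
  its translate have equal integrals. Keeping \<delta> and all denominators out makes the relation
  valid at every generic \<open>x\<close>.\<close>

lemma psi_three_term:
  fixes lam \<alpha> \<rho> \<beta> \<sigma> x a b c d :: complex
  assumes \<tau>: "\<tau> < 0" and gen: "generic_params \<tau> lam \<alpha> \<rho> \<beta> \<sigma>" and x: "generic_arg \<tau> lam \<alpha> \<rho> \<beta> \<sigma> x"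
    and abcd: "a = 1 + \<rho> + \<sigma>" "b = 1 - \<rho> + \<sigma>" "c = 1 + \<alpha> + \<rho> - \<beta> - \<sigma>" "d = 1 - \<alpha> - \<rho> - \<beta> - \<sigma>"
  defines "s \<equiv> qdiff \<tau>" and "\<psi> \<equiv> psi \<tau> lam \<alpha> \<rho> \<beta> \<sigma>"
  shows "s (a + x) * s (b + x) * s (x + 2 - a) * s (x + 2 - b) * s (2 * x - 2) * \<psi> (x + 2)
    + s (c - x) * s (d - x) * s (2 - c - x) * s (2 - d - x) * s (2 * x + 2) * \<psi> (x - 2)
    = (s (a + x) * s (b + x) * s (c + x) * s (d + x) * s (2 * x - 2)
       + s (a - x) * s (b - x) * s (c - x) * s (d - x) * s (2 * x + 2)
       + (qsum \<tau> (4 * \<i> * lam) - qsum \<tau> (2 - 2 * \<beta>)) * s (2 * x) * s (2 * x + 2) * s (2 * x - 2)) * \<psi> x"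
proof -
  define X where "X = qexp \<tau> (2 * x)"
  define L where "L = qexp \<tau> (2 * \<i> * lam)"
  define T where "T = qexp \<tau> 2"
  define U where "U = qexp \<tau> (2 * \<sigma>)"
  define V where "V = qexp \<tau> (2 * (\<beta> + \<sigma>))"
  define R where "R = qsum \<tau> (2 * \<rho>)"
  define P where "P = qsum \<tau> (2 * (\<alpha> + \<rho>))"
  interpret cert: aw_cert X L T U V R P
    by unfold_locales (simp_all add: X_def L_def T_def U_def V_def)
  let ?\<phi> = "psi_phi \<tau> lam \<beta> \<sigma>" and ?\<theta> = "psi_theta \<tau> lam \<alpha> \<rho>" and ?\<chi> = "psi_phi_half \<tau> lam \<beta> \<sigma>"
  let ?D\<phi> = "cut_domain (phi_left lam \<beta> \<sigma>) (phi_right lam \<sigma>)" and ?D\<theta> = "cut_domain (theta_left \<tau> lam \<rho>) (theta_right \<tau> lam \<alpha> \<rho>)"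
  obtain C where C: "vertical_deformation 0 C" "\<And>c t. \<bar>t\<bar> \<le> 2 \<Longrightarrow> x + C c + of_real t \<in> ?D\<phi>" "\<And>c t. \<bar>t\<bar> \<le> 2 \<Longrightarrow> C c + of_real t \<in> ?D\<theta>"
    by (rule psi_contour_wide[OF x], rule that)
  have \<psi>: "has_line_integral (\<lambda>z. ?\<phi> (x + of_real t + z) * ?\<theta> z) (\<psi> (x + of_real t)) C" if t: "\<bar>t\<bar> \<le> 2" for t
  proof -
    have "generic_arg \<tau> lam \<alpha> \<rho> \<beta> \<sigma> (x + of_real t)"
      using x by (subst generic_arg_real_shift[of _ x]) auto
    moreover have "psi_contour \<tau> lam \<alpha> \<rho> \<beta> \<sigma> (x + of_real t) C"
      unfolding psi_contour_iff set_left_ends set_right_ends cut_domain_shift_Un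
    proof (intro conjI allI C(1))
      fix c
      show "x + of_real t + C c \<in> ?D\<phi>" using C(2)[OF t, of c] by (simp add: add_ac)
      show "C c \<in> ?D\<theta>" using C(3)[of 0 c] by simp
    qed
    ultimately have "has_line_integral (psi_integrand \<tau> lam \<alpha> \<rho> \<beta> \<sigma> (x + of_real t)) (\<psi> (x + of_real t)) C"
      unfolding \<psi>_def by (rule psi_spec(2)[OF \<tau> gen])
    thus ?thesis by (rule has_line_integral_cong[rotated]) (rule psi_integrand_eq[OF \<tau>])
  qed
  define t where "t = (\<lambda>z. cert.tp * qexp \<tau> (2 * z) + cert.t0 + cert.tm / qexp \<tau> (2 * z))"
  define d3 where "d3 = (\<lambda>z. 1 / L * qexp \<tau> (2 * z) + - P + L / qexp \<tau> (2 * z))"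
  \<comment> \<open>\<open>d3\<close> is placed so that
    \<open>d3 (z + 2) * psi_theta (z + 2)\<close> is a trigonometric multiple of
    \<open>psi_theta z\<close>; with \<open>D2\<close> doing the same for
    \<open>psi_phi_half\<close>, \<open>K z\<close> and \<open>K (z + 2)\<close> become
    comparable.\<close>
  define K where "K = (\<lambda>z. t z * d3 z * (?\<chi> (x + z) * ?\<theta> z))"
  let ?A = "(\<lambda>p. p - x) ` (\<lambda>p. p + 2) ` phi_left lam \<beta> \<sigma> \<union> theta_left \<tau> lam \<rho>"
    and ?B = "(\<lambda>p. p - x) ` phi_right lam \<sigma> \<union> theta_right \<tau> lam \<alpha> \<rho>"
  have fin: "finite ?A" "finite ?B" by (simp_all add: phi_left_def phi_right_def theta_left_def theta_right_def)
  note pf = product_facts[where x = x, OF psi_phi_half_facts[where lam = lam and \<beta> = \<beta> and \<sigma> = \<sigma>, OF \<tau>]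
      psi_theta_facts(2,3)[where lam = lam and \<alpha> = \<alpha> and \<rho> = \<rho>, OF \<tau>]]
  have hol: "K holomorphic_on cut_domain ?A ?B"
    unfolding K_def
  proof (rule holomorphic_on_mult[OF _ pf(1)])
    show "(\<lambda>z. t z * d3 z) holomorphic_on cut_domain ?A ?B"
      unfolding t_def d3_def by (intro holomorphic_intros) auto
  qed
  have "exp_bound (2 * pi * \<tau> + 2 * pi * \<tau> + (pi * \<tau> * (1 / \<tau> - 3 + 2 * Im lam) + pi * \<tau> * (- 1 - 2 * Im lam))) K"
    unfolding K_def t_def d3_def by (intro exp_bound_mult exp_bound_qexp_laurent \<tau> pf(2))
  moreover have "2 * pi * \<tau> + 2 * pi * \<tau> + (pi * \<tau> * (1 / \<tau> - 3 + 2 * Im lam) + pi * \<tau> * (- 1 - 2 * Im lam)) = pi"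
    using \<tau> by (simp add: field_simps)
  ultimately have bd: "exp_bound pi K" by simp
  \<comment> \<open>The left ends of \<open>psi_phi_half\<close> are those of \<open>psi_phi\<close>
    moved by 2, hence the condition at \<open>x + z - 2\<close>. For the contour and its translate
    this uses the offsets -2, 0 and 2.\<close>
  have ends: "z \<in> cut_domain ?A ?B" if "x + z - 2 \<in> ?D\<phi>" "x + z \<in> ?D\<phi>" "z \<in> ?D\<theta>" for z
    using that unfolding cut_domain_shift_Un by (auto simp: cut_domain_iff algebra_simps)
  have dom: "C c \<in> cut_domain ?A ?B" "C c + of_real 2 \<in> cut_domain ?A ?B" for c
    using C(2)[of "- 2" c] C(2)[of 0 c] C(2)[of 2 c] C(3)[of 0 c] C(3)[of 2 c]
    by (intro ends; simp add: algebra_simps)+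
  obtain I where I: "has_line_integral K I C"
    by (rule has_line_integral_exists[OF C(1) hol dom(1) bd pi_gt_zero], rule that)
  have "has_line_integral K I (\<lambda>c. C c + of_real 2)"
    by (rule has_line_integral_deform[OF open_cut_domain[OF fin] horizontally_convex_cut_domain hol bd pi_gt_zero
          C(1) dom(1) vertical_deformation_translate[OF C(1)] dom(2) I])
  hence "has_line_integral (\<lambda>z. K (z + 2)) I C"
    by (simp only: has_line_integral_translate of_real_numeral)
  note KI = has_line_integral_diff[OF I this]
  let ?f = "\<lambda>t z. ?\<phi> (x + of_real t + z) * ?\<theta> z"
  have LI: "has_line_integral (\<lambda>z. cert.Np * cert.sm * ?f 2 z - (- (cert.Nm * cert.sp)) * ?f (-2) z - cert.DD * ?f 0 z)
      (cert.Np * cert.sm * \<psi> (x + of_real 2) - (- (cert.Nm * cert.sp)) * \<psi> (x + of_real (- 2)) - cert.DD * \<psi> (x + of_real 0)) C"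
    by (intro has_line_integral_diff has_line_integral_cmult \<psi>) auto
  \<comment> \<open>Heights at which some gamma function in the integrands may have a zero or pole
    on the contour's horizontal line; the values assigned there need not satisfy the shift
    relations.\<close>
  define S where "S = (\<lambda>t. t - Im x) ` Im ` (phi_left lam \<beta> \<sigma> \<union> phi_right lam \<sigma>) \<union> Im ` (theta_left \<tau> lam \<rho> \<union> theta_right \<tau> lam \<alpha> \<rho>)"
  have S: "finite S" by (simp add: S_def phi_left_def phi_right_def theta_left_def theta_right_def)
  have main: "cert.Np * cert.sm * ?f 2 z - (- (cert.Nm * cert.sp)) * ?f (-2) z - cert.DD * ?f 0 z = K z - K (z + 2)"
    if z: "Im z \<notin> S" for z
  proof -
    define Z where "Z = qexp \<tau> (2 * z)"
    have Z0: "Z \<noteq> 0" by (simp add: Z_def)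
    have w: "Im (x + z) \<notin> Im ` (phi_left lam \<beta> \<sigma> \<union> phi_right lam \<sigma>)"
    proof
      assume "Im (x + z) \<in> Im ` (phi_left lam \<beta> \<sigma> \<union> phi_right lam \<sigma>)"
      hence "Im (x + z) - Im x \<in> S" unfolding S_def by blast
      thus False using z by simp
    qed
    have z\<theta>: "Im z \<notin> Im ` (theta_left \<tau> lam \<rho> \<union> theta_right \<tau> lam \<alpha> \<rho>)" using z unfolding S_def by blast
    have n1: "qsum \<tau> (2 * (x + z - 1 - \<i> * lam)) - qsum \<tau> (2 * (\<beta> + \<sigma>)) = Z * X / (T * L) + T * L / (Z * X) - cert.M"
      and n2: "qsum \<tau> (2 * (x + z + 1 - \<i> * lam)) - qsum \<tau> (2 * (\<beta> + \<sigma>)) = Z * X * T / L + L / (Z * X * T) - cert.M"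
      and d1: "qsum \<tau> (2 * (x + z + \<i> * lam)) - qsum \<tau> (2 * \<sigma>) = Z * X * L + 1 / (Z * X * L) - cert.S"
      and n3: "qsum \<tau> (2 * (z + 1 + \<i> * lam)) - qsum \<tau> (2 * \<rho>) = Z * T * L + 1 / (Z * T * L) - R"
      unfolding qsum_eq cert.M_def cert.S_def V_def[symmetric] U_def[symmetric] R_def
      by (simp_all add: ring_distribs qexp_add qexp_diff X_def Z_def L_def T_def mult_ac)
    have T2: "qexp \<tau> 4 = T * T" using qexp_add[of \<tau> 2 2] by (simp add: T_def)
    have Z2: "qexp \<tau> (2 * (z + 2)) = Z * T ^ 2"
      by (simp add: ring_distribs qexp_add T2 Z_def power2_eq_square)
    have d2: "qsum \<tau> (2 * (x + z + 2 + \<i> * lam)) - qsum \<tau> (2 * \<sigma>) = Z * X * T ^ 2 * L + 1 / (Z * X * T ^ 2 * L) - cert.S"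
      unfolding qsum_eq cert.S_def U_def[symmetric]
      by (simp add: ring_distribs qexp_add T2 X_def Z_def L_def power2_eq_square mult_ac)
    have d3': "qsum \<tau> (2 * (z + 2 - \<i> * lam)) - qsum \<tau> (2 * (\<alpha> + \<rho>)) = d3 (z + 2)"
      unfolding qsum_eq[of \<tau> "2 * (z + 2 - \<i> * lam)"] d3_def Z2 P_def[symmetric]
      by (simp add: ring_distribs qexp_add qexp_diff T2 Z_def L_def power2_eq_square mult_ac)
    have d3z: "d3 z = Z / L + L / Z - P" by (simp add: d3_def Z_def)
    note ph = psi_phi_shifts[OF \<tau> w, unfolded n1 n2 d1 d2]
    note th = psi_theta_shift[OF \<tau> z\<theta>, unfolded n3 d3']
    note tele = cert.telescoping[OF Z0]
    have tz: "t z = cert.tp * Z + cert.t0 + cert.tm / Z" "t (z + 2) = cert.tp * (Z * T ^ 2) + cert.t0 + cert.tm / (Z * T ^ 2)"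
      by (simp_all only: t_def Z_def Z2)
    define N1 where "N1 = Z * X / (T * L) + T * L / (Z * X) - cert.M"
    define N2 where "N2 = Z * X * T / L + L / (Z * X * T) - cert.M"
    define D1 where "D1 = Z * X * L + 1 / (Z * X * L) - cert.S"
    define D2 where "D2 = Z * X * T ^ 2 * L + 1 / (Z * X * T ^ 2 * L) - cert.S"
    define N3 where "N3 = Z * T * L + 1 / (Z * T * L) - R"
    note ph = ph[folded N1_def N2_def D1_def D2_def] and th = th[folded N3_def]
    note tele = tele[folded N1_def N2_def D1_def D2_def N3_def tz d3z]
    have f: "?f 2 z = ?\<phi> (x + z + 2) * ?\<theta> z" "?f (-2) z = ?\<phi> (x + z - 2) * ?\<theta> z" "?f 0 z = ?\<phi> (x + z) * ?\<theta> z"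
      by (simp_all add: algebra_simps)
    have "(cert.Np * cert.sm * ?f 2 z - (- (cert.Nm * cert.sp)) * ?f (-2) z - cert.DD * ?f 0 z) * D2
        = cert.Np * cert.sm * (?\<phi> (x + z + 2) * D2) * ?\<theta> z + cert.Nm * cert.sp * ?\<phi> (x + z - 2) * D2 * ?\<theta> z
          - cert.DD * ?\<phi> (x + z) * D2 * ?\<theta> z"
      unfolding f by (simp add: algebra_simps)
    also have "\<dots> = - (cert.Np * cert.sm * N2 * N1 + cert.Nm * cert.sp * D1 * D2 - cert.DD * N1 * D2) * (?\<chi> (x + z) * ?\<theta> z)"
      unfolding ph(1-3) by (simp add: algebra_simps)
    also have "\<dots> = - (t (z + 2) * N3 * N1 - t z * d3 z * D2) * (?\<chi> (x + z) * ?\<theta> z)"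
      unfolding tele ..
    also have "\<dots> = t z * d3 z * (?\<chi> (x + z) * ?\<theta> z) * D2 - t (z + 2) * (N1 * ?\<chi> (x + z)) * (N3 * ?\<theta> z)"
      by (simp add: algebra_simps)
    also have "\<dots> = (K z - K (z + 2)) * D2"
      unfolding ph(4)[symmetric] th[symmetric] K_def by (simp add: algebra_simps)
    finally show ?thesis using ph(5) by simp
  qed
  have "cert.Np * cert.sm * \<psi> (x + of_real 2) - (- (cert.Nm * cert.sp)) * \<psi> (x + of_real (- 2)) - cert.DD * \<psi> (x + of_real 0) = I - I"
    by (rule has_line_integral_AE_unique[OF LI KI S]) (rule main, simp add: vertical_deformation_Im[OF C(1)])
  hence rel: "cert.Np * cert.sm * \<psi> (x + 2) + cert.Nm * cert.sp * \<psi> (x - 2) = cert.DD * \<psi> x" by simp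
  have sq: "L\<^sup>2 = qexp \<tau> (4 * \<i> * lam)" using qexp_add[of \<tau> "2 * \<i> * lam" "2 * \<i> * lam"] by (simp add: L_def power2_eq_square mult.assoc)
  \<comment> \<open>The product-to-sum formula read backwards: each bracket of the certificate
    splits into two sines, and the letters give way to \<open>a\<close>, \<open>b\<close>,
    \<open>c\<close>, \<open>d\<close>.\<close>
  have q: "X * T * U + 1 / (X * T * U) - R = s (a + x) * s (b + x)"
    "X * T / U + U / (X * T) - R = s (x + 2 - a) * s (x + 2 - b)"
    "T * V / X + X / (T * V) - P = s (2 - c - x) * s (2 - d - x)"
    "T / (X * V) + X * V / T - P = s (c - x) * s (d - x)"
    "X * T / V + V / (X * T) - P = s (c + x) * s (d + x)"
    "T * U / X + X / (T * U) - R = s (a - x) * s (b - x)"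
    "T * U / V + V / (T * U) = qsum \<tau> (2 - 2 * \<beta>)"
    "X - 1 / X = s (2 * x)" "X * T - 1 / (X * T) = s (2 * x + 2)" "X / T - T / X = s (2 * x - 2)"
  proof -
    have m: "s (u + v) * s (u - v) = qexp \<tau> (2 * u) + 1 / qexp \<tau> (2 * u) - qsum \<tau> (2 * v)" for u v
      unfolding s_def qdiff_mult_qdiff qsum_eq[of \<tau> "2 * u"] ..
    have V: "V = qexp \<tau> (2 * \<beta>) * U" by (simp add: V_def U_def distrib_left qexp_add)
    note e = ring_distribs qexp_add qexp_diff X_def T_def U_def V
    have m': "s (u - v) * s (u + v) = qexp \<tau> (2 * u) + 1 / qexp \<tau> (2 * u) - qsum \<tau> (2 * v)" for u v
      using m[of u v] by (simp only: mult.commute)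
    have u: "qexp \<tau> (2 * (x + 1 + \<sigma>)) = X * T * U"
      "qexp \<tau> (2 * (x + 1 - \<sigma>)) = X * T / U"
      "qexp \<tau> (2 * (1 + \<beta> + \<sigma> - x)) = T * V / X"
      "qexp \<tau> (2 * (1 - \<beta> - \<sigma> - x)) = T / (X * V)"
      "qexp \<tau> (2 * (x + 1 - \<beta> - \<sigma>)) = X * T / V"
      "qexp \<tau> (2 * (1 + \<sigma> - x)) = T * U / X"
      by (simp_all add: e)
    have arg1: "a + x = x + 1 + \<sigma> + \<rho>" "b + x = x + 1 + \<sigma> - \<rho>" by (simp_all add: abcd)
    show "X * T * U + 1 / (X * T * U) - R = s (a + x) * s (b + x)"
      unfolding arg1 m u R_def by simp
    have arg2: "x + 2 - b = x + 1 - \<sigma> + \<rho>" "x + 2 - a = x + 1 - \<sigma> - \<rho>" by (simp_all add: abcd)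
    show "X * T / U + U / (X * T) - R = s (x + 2 - a) * s (x + 2 - b)"
      unfolding arg2 m' u R_def by simp
    have arg3: "2 - d - x = 1 + \<beta> + \<sigma> - x + (\<alpha> + \<rho>)" "2 - c - x = 1 + \<beta> + \<sigma> - x - (\<alpha> + \<rho>)" by (simp_all add: abcd)
    show "T * V / X + X / (T * V) - P = s (2 - c - x) * s (2 - d - x)"
      unfolding arg3 m' u P_def by simp
    have arg4: "c - x = 1 - \<beta> - \<sigma> - x + (\<alpha> + \<rho>)" "d - x = 1 - \<beta> - \<sigma> - x - (\<alpha> + \<rho>)" by (simp_all add: abcd)
    show "T / (X * V) + X * V / T - P = s (c - x) * s (d - x)"
      unfolding arg4 m u P_def by simp
    have arg5: "c + x = x + 1 - \<beta> - \<sigma> + (\<alpha> + \<rho>)" "d + x = x + 1 - \<beta> - \<sigma> - (\<alpha> + \<rho>)" by (simp_all add: abcd)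
    show "X * T / V + V / (X * T) - P = s (c + x) * s (d + x)"
      unfolding arg5 m u P_def by simp
    have arg6: "a - x = 1 + \<sigma> - x + \<rho>" "b - x = 1 + \<sigma> - x - \<rho>" by (simp_all add: abcd)
    show "T * U / X + X / (T * U) - R = s (a - x) * s (b - x)"
      unfolding arg6 m u R_def by simp
    show "T * U / V + V / (T * U) = qsum \<tau> (2 - 2 * \<beta>)"
      using cert.nz(4) unfolding qsum_eq V by (simp add: qexp_diff T_def)
    show "X - 1 / X = s (2 * x)" "X * T - 1 / (X * T) = s (2 * x + 2)" "X / T - T / X = s (2 * x - 2)"
      unfolding s_def qdiff_def by (simp_all add: qexp_add qexp_diff qexp_minus X_def T_def divide_simps)
  qed
  have N: "cert.Np = s (a + x) * s (b + x) * (s (x + 2 - a) * s (x + 2 - b))"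
    "cert.Nm = s (2 - c - x) * s (2 - d - x) * (s (c - x) * s (d - x))"
    "cert.sm = s (2 * x - 2)" "cert.sp = s (2 * x + 2)"
    unfolding cert.Np_def cert.Nm_def cert.sm_def cert.sp_def q by (rule refl)+
  have DD: "cert.DD = s (a + x) * s (b + x) * (s (c + x) * s (d + x)) * s (2 * x - 2)
    + s (a - x) * s (b - x) * (s (c - x) * s (d - x)) * s (2 * x + 2)
    + (qsum \<tau> (4 * \<i> * lam) - qsum \<tau> (2 - 2 * \<beta>)) * (s (2 * x) * s (2 * x + 2) * s (2 * x - 2))"
    unfolding cert.DD_def cert.s2_def cert.sm_def cert.sp_def q qsum_eq[of \<tau> "4 * \<i> * lam"] sq[symmetric]
    by (simp add: q(7)[symmetric] diff_diff_eq)
  show ?thesis using rel unfolding N DD by (simp only: mult_ac)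
qed

text \<open>This is the reason for the choice of \<delta>: passing from \<psi> to \<open>H\<close>
  trades the factors at \<open>x + 2 - a\<close> and \<open>x + 2 - b\<close> for those at
  \<open>c + x\<close> and \<open>d + x\<close>, which completes the numerator of
  \<open>A(x)\<close>.\<close>

lemma delta_shift:
  assumes \<tau>: "\<tau> < 0" and x: "Im (a - x) \<noteq> 0" "Im (b - x) \<noteq> 0" "Im (c + x) \<noteq> 0" "Im (d + x) \<noteq> 0"
  shows "delta \<tau> a b c d x * (qdiff \<tau> (c + x) * qdiff \<tau> (d + x))
      = qdiff \<tau> (x + 2 - a) * qdiff \<tau> (x + 2 - b) * delta \<tau> a b c d (x + 2)"
    and "delta \<tau> a b c d x \<noteq> 0"
proof -
  have t: "2 * \<tau> < 0" using \<tau> by simp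
  define h where "h = 1 / (2 * complex_of_real \<tau>)"
  have h: "1 / complex_of_real (2 * \<tau>) = h" by (simp add: h_def)
  have Imh [simp]: "Im h = 0" unfolding h[symmetric] by (rule Re_one_over_of_real)
  note cf = cosfac_half(1)[OF \<tau>, folded h_def]
  have num: "hyp_G (2 * \<tau>) (- 1 + h + u - x) = - \<i> * qdiff \<tau> (x + 2 - u) * hyp_G (2 * \<tau>) (- 1 + h + u - (x + 2))"
    if "Im (u - x) \<noteq> 0" for u
  proof -
    have e: "- 1 + h + u - x - 1 = - (x + 2 - u) + h" "- 1 + h + u - x - 2 = - 1 + h + u - (x + 2)" by simp_all
    have "Im (- 1 + h + u - x) \<noteq> 0" using that by simp
    from hyp_G_shift_down[OF t this] show ?thesis unfolding e cf qdiff_minus by simp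
  qed
  have den: "hyp_G (2 * \<tau>) (1 + h - u - x) = - \<i> * qdiff \<tau> (u + x) * hyp_G (2 * \<tau>) (1 + h - u - (x + 2))"
    if "Im (u + x) \<noteq> 0" for u
  proof -
    have e: "1 + h - u - x - 1 = - (u + x) + h" "1 + h - u - x - 2 = 1 + h - u - (x + 2)" by simp_all
    have "Im (1 + h - u - x) \<noteq> 0" using that by simp
    from hyp_G_shift_down[OF t this] show ?thesis unfolding e cf qdiff_minus by simp
  qed
  have nz: "hyp_G (2 * \<tau>) (- 1 + h + u - x) \<noteq> 0" if "Im (u - x) \<noteq> 0" for u
    using that by (intro hyp_G_nonzero[OF t] disjI1) simp
  have nz': "hyp_G (2 * \<tau>) (1 + h - u - x) \<noteq> 0" if "Im (u + x) \<noteq> 0" for u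
    using that by (intro hyp_G_nonzero[OF t] disjI1) simp
  show "delta \<tau> a b c d x \<noteq> 0"
    unfolding delta_def Let_def h_def[symmetric] using nz[OF x(1)] nz[OF x(2)] nz'[OF x(3)] nz'[OF x(4)] by simp
  have s0: "qdiff \<tau> (c + x) \<noteq> 0" "qdiff \<tau> (d + x) \<noteq> 0" using x(3,4) by (intro qdiff_nonzero[OF \<tau>]; simp)+
  have g0: "hyp_G (2 * \<tau>) (1 + h - c - (x + 2)) \<noteq> 0" "hyp_G (2 * \<tau>) (1 + h - d - (x + 2)) \<noteq> 0"
    using den[OF x(3)] nz'[OF x(3)] den[OF x(4)] nz'[OF x(4)] by auto
  show "delta \<tau> a b c d x * (qdiff \<tau> (c + x) * qdiff \<tau> (d + x))
      = qdiff \<tau> (x + 2 - a) * qdiff \<tau> (x + 2 - b) * delta \<tau> a b c d (x + 2)"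
    unfolding delta_def Let_def h_def[symmetric] num[OF x(1)] num[OF x(2)] den[OF x(3)] den[OF x(4)]
    using s0 g0 by (simp add: divide_simps)
qed

text \<open>Each \<open>1 - q^u\<close> is a half power times a sine. Because of the sum of the
  parameters the half powers collapse to the constant \<open>q^(1-\<beta>)\<close>, which is also a
  factor of the eigenvalue.\<close>

lemma AW_coeff_eq:
  assumes "a + b + c + d = 4 - 2 * \<beta>"
  shows "AW_coeff \<tau> a b c d x = qpow \<tau> (1 - \<beta>) *
    (qdiff \<tau> (a + x) * qdiff \<tau> (b + x) * qdiff \<tau> (c + x) * qdiff \<tau> (d + x)) / (qdiff \<tau> (2 * x) * qdiff \<tau> (2 * x + 2))"
proof -
  have "qexp \<tau> (a + x) * qexp \<tau> (b + x) * qexp \<tau> (c + x) * qexp \<tau> (d + x) = qexp \<tau> ((a + b + c + d) + 4 * x)"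
    unfolding qexp_add[symmetric] by (simp add: algebra_simps)
  also have "\<dots> = qpow \<tau> (1 - \<beta>) * (qexp \<tau> (2 * x) * qexp \<tau> (2 * x + 2))"
    unfolding assms qpow_eq_qexp qexp_add[symmetric] by (simp add: algebra_simps)
  finally have e: "qexp \<tau> (a + x) * qexp \<tau> (b + x) * qexp \<tau> (c + x) * qexp \<tau> (d + x)
    = qpow \<tau> (1 - \<beta>) * (qexp \<tau> (2 * x) * qexp \<tau> (2 * x + 2))" .
  have "AW_coeff \<tau> a b c d x = (qexp \<tau> (a + x) * qexp \<tau> (b + x) * qexp \<tau> (c + x) * qexp \<tau> (d + x)) *
      (qdiff \<tau> (a + x) * qdiff \<tau> (b + x) * qdiff \<tau> (c + x) * qdiff \<tau> (d + x)) /
      ((qexp \<tau> (2 * x) * qexp \<tau> (2 * x + 2)) * (qdiff \<tau> (2 * x) * qdiff \<tau> (2 * x + 2)))"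
    unfolding AW_coeff_def one_minus_qpow add.commute[of 2 "2 * x"] by (simp add: mult_ac)
  thus ?thesis unfolding e by simp
qed

lemma AW_eigenvalue_eq:
  "AW_eigenvalue \<tau> \<beta> lam = qpow \<tau> (1 - \<beta>) * (qsum \<tau> (4 * \<i> * lam) - qsum \<tau> (2 - 2 * \<beta>))"
proof -
  define w where "w = 2 - 2 * \<beta>"
  have "qpow \<tau> (1 - \<beta>) = qexp \<tau> w" "qpow \<tau> w = qexp \<tau> w * qexp \<tau> w"
    "qpow \<tau> (2 * \<i> * lam) = qexp \<tau> (4 * \<i> * lam)" "qpow \<tau> (- 2 * \<i> * lam) = inverse (qexp \<tau> (4 * \<i> * lam))"
    unfolding qpow_eq_qexp qexp_add[symmetric] qexp_minus[symmetric] by (simp_all add: w_def algebra_simps)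
  thus ?thesis
    unfolding AW_eigenvalue_def qsum_def w_def[symmetric] qexp_minus by (simp add: ring_distribs)
qed

text \<open>Field arithmetic isolated from its meaning: subscripted \<open>s\<close>,
  \<open>t\<close> and \<open>u\<close> are sines at \<open>a + x\<close> etc., at
  \<open>a - x\<close> etc., and at \<open>x + 2 - a\<close>, \<open>x + 2 - b\<close>,
  \<open>2 - c - x\<close>, \<open>2 - d - x\<close>; \<open>D\<close> is the inverse of \<delta>
  and \<open>Q\<close> is \<open>q^(1-\<beta>)\<close>.\<close>

lemma AW_algebra:
  fixes \<psi> \<psi>p \<psi>m :: complex
  assumes nz: "s2 \<noteq> 0" "sp \<noteq> 0" "sm \<noteq> 0" "sc \<noteq> 0" "sd \<noteq> 0" "ta \<noteq> 0" "tb \<noteq> 0"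
    and rel: "sa * sb * ua * ub * sm * \<psi>p + tc * td * uc * ud * sp * \<psi>m
      = (sa * sb * sc * sd * sm + ta * tb * tc * td * sp + E * s2 * sp * sm) * \<psi>"
  shows "Q * (sa * sb * sc * sd) / (s2 * sp) * (ua * ub / (sc * sd) * D * \<psi>p - D * \<psi>)
    + Q * (ta * tb * tc * td) / (s2 * sm) * (uc * ud / (ta * tb) * D * \<psi>m - D * \<psi>) = Q * E * (D * \<psi>)"
proof -
  have "Q * (sa * sb * sc * sd) / (s2 * sp) * (ua * ub / (sc * sd) * D * \<psi>p - D * \<psi>)
      = Q * D * (sa * sb * ua * ub * sm * \<psi>p - sa * sb * sc * sd * sm * \<psi>) / (s2 * sp * sm)"
    using nz by (simp add: divide_simps) (simp add: algebra_simps)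
  moreover have "Q * (ta * tb * tc * td) / (s2 * sm) * (uc * ud / (ta * tb) * D * \<psi>m - D * \<psi>)
      = Q * D * (tc * td * uc * ud * sp * \<psi>m - ta * tb * tc * td * sp * \<psi>) / (s2 * sp * sm)"
    using nz by (simp add: divide_simps) (simp add: algebra_simps)
  ultimately have "Q * (sa * sb * sc * sd) / (s2 * sp) * (ua * ub / (sc * sd) * D * \<psi>p - D * \<psi>)
    + Q * (ta * tb * tc * td) / (s2 * sm) * (uc * ud / (ta * tb) * D * \<psi>m - D * \<psi>)
    = Q * D * ((sa * sb * ua * ub * sm * \<psi>p + tc * td * uc * ud * sp * \<psi>m)
        - (sa * sb * sc * sd * sm + ta * tb * tc * td * sp) * \<psi>) / (s2 * sp * sm)"
    by (simp only: add_divide_distrib[symmetric]) (simp add: algebra_simps)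
  also have "\<dots> = Q * D * (E * (s2 * sp * sm) * \<psi>) / (s2 * sp * sm)"
    unfolding rel by (simp add: algebra_simps)
  finally show ?thesis using nz by simp
qed

text \<open>The excluded heights contain the zeros of the denominators and the zeros and poles of
  \<delta>. Shifts by 2 are real, so the conditions at \<open>x\<close> cover \<open>x + 2\<close>
  and \<open>x - 2\<close> as well.\<close>

lemma difference_equation_generic:
  fixes lam \<alpha> \<rho> \<beta> \<sigma> x a b c d :: complex
  assumes \<tau>: "\<tau> < 0" and gen: "generic_params \<tau> lam \<alpha> \<rho> \<beta> \<sigma>" and x: "generic_arg \<tau> lam \<alpha> \<rho> \<beta> \<sigma> x"
    and abcd: "a = 1 + \<rho> + \<sigma>" "b = 1 - \<rho> + \<sigma>" "c = 1 + \<alpha> + \<rho> - \<beta> - \<sigma>" "d = 1 - \<alpha> - \<rho> - \<beta> - \<sigma>"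
    and H: "H = (\<lambda>x. inverse (delta \<tau> a b c d x) * psi \<tau> lam \<alpha> \<rho> \<beta> \<sigma> x)"
    and im: "Im x \<noteq> 0" "Im (a - x) \<noteq> 0" "Im (b - x) \<noteq> 0" "Im (c + x) \<noteq> 0" "Im (d + x) \<noteq> 0"
  shows "AW_coeff \<tau> a b c d x * (H (x + 2) - H x) + AW_coeff \<tau> a b c d (- x) * (H (x - 2) - H x)
        = AW_eigenvalue \<tau> \<beta> lam * H x"
proof -
  let ?s = "qdiff \<tau>" and ?\<delta> = "delta \<tau> a b c d" and ?\<psi> = "psi \<tau> lam \<alpha> \<rho> \<beta> \<sigma>"
  have "Im (a - (x - 2)) \<noteq> 0" "Im (b - (x - 2)) \<noteq> 0" "Im (c + (x - 2)) \<noteq> 0" "Im (d + (x - 2)) \<noteq> 0"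
    "Im (a - (x + 2)) \<noteq> 0" "Im (b - (x + 2)) \<noteq> 0" "Im (c + (x + 2)) \<noteq> 0" "Im (d + (x + 2)) \<noteq> 0"
    using im by simp_all
  note d = delta_shift[OF \<tau> im(2-5)] delta_shift[OF \<tau> this(1-4)] delta_shift(2)[OF \<tau> this(5-8)]
  have nz: "?s (2 * x) \<noteq> 0" "?s (2 * x + 2) \<noteq> 0" "?s (2 * x - 2) \<noteq> 0" "?s (c + x) \<noteq> 0" "?s (d + x) \<noteq> 0" "?s (a - x) \<noteq> 0" "?s (b - x) \<noteq> 0"
    "?s (2 - c - x) \<noteq> 0" "?s (2 - d - x) \<noteq> 0"
    using im by (intro qdiff_nonzero[OF \<tau>]; simp)+
  have inv: "inverse q = u / v * inverse p" if "p * v = u * q" "p \<noteq> 0" "q \<noteq> 0" "v \<noteq> 0" for p q u v :: complex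
  proof -
    have "u = p * v / q" using that by simp
    hence "u / v * inverse p = p * v / q / v * inverse p" by (rule arg_cong)
    also have "\<dots> = inverse q" using that(2-4) by (simp add: field_simps)
    finally show ?thesis ..
  qed
  have neg: "?s (u - v) = - ?s (v - u)" for u v using qdiff_minus[of \<tau> "v - u"] by simp
  have "inverse (?\<delta> (x + 2)) = ?s (x + 2 - a) * ?s (x + 2 - b) / (?s (c + x) * ?s (d + x)) * inverse (?\<delta> x)"
    by (rule inv[OF d(1,2,5)]) (use nz in simp)
  hence p: "H (x + 2) = ?s (x + 2 - a) * ?s (x + 2 - b) / (?s (c + x) * ?s (d + x)) * inverse (?\<delta> x) * ?\<psi> (x + 2)"
    by (simp add: H)
  have "?\<delta> x * (?s (a - x) * ?s (b - x)) = ?s (2 - c - x) * ?s (2 - d - x) * ?\<delta> (x - 2)"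
  proof -
    have e: "c + (x - 2) = - (2 - c - x)" "d + (x - 2) = - (2 - d - x)" "x - 2 + 2 = x" "x - a = - (a - x)" "x - b = - (b - x)"
      by simp_all
    from d(3) show ?thesis unfolding e qdiff_minus by (simp add: mult_ac)
  qed
  hence "inverse (?\<delta> (x - 2)) = ?s (2 - c - x) * ?s (2 - d - x) / (?s (a - x) * ?s (b - x)) * inverse (?\<delta> x)"
    by (rule inv[OF _ d(2,4)]) (use nz in simp)
  hence m: "H (x - 2) = ?s (2 - c - x) * ?s (2 - d - x) / (?s (a - x) * ?s (b - x)) * inverse (?\<delta> x) * ?\<psi> (x - 2)"
    by (simp add: H)
  have sum: "a + b + c + d = 4 - 2 * \<beta>" by (simp add: abcd)
  have Am: "AW_coeff \<tau> a b c d (- x) = qpow \<tau> (1 - \<beta>) *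
    (?s (a - x) * ?s (b - x) * ?s (c - x) * ?s (d - x)) / (?s (2 * x) * ?s (2 * x - 2))"
  proof -
    have e: "2 * (- x) = - (2 * x)" "- (2 * x) + 2 = - (2 * x - 2)" by simp_all
    show ?thesis using AW_coeff_eq[OF sum, of \<tau> "- x"] unfolding e qdiff_minus by simp
  qed
  show ?thesis
    unfolding p m Am AW_coeff_eq[OF sum, of \<tau> x] AW_eigenvalue_eq unfolding H
    by (rule AW_algebra[OF nz(1-7) psi_three_term[OF \<tau> gen x abcd]])
qed

section \<open>From generic points to an identity of meromorphic functions\<close>

lemma delta_meromorphic:
  assumes "\<tau> < 0"
  shows "delta \<tau> a b c d meromorphic_on UNIV"
proof -
  have "(\<lambda>x. hyp_G (2 * \<tau>) (u - x)) meromorphic_on UNIV" for u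
    by (rule meromorphic_on_compose[where f = "\<lambda>x. u - x", OF hyp_G_meromorphic])
       (use assms in \<open>auto intro!: analytic_intros\<close>)
  thus ?thesis unfolding delta_def Let_def by (intro meromorphic_intros)
qed

lemma AW_coeff_meromorphic:
  assumes "f analytic_on UNIV"
  shows "(\<lambda>x. AW_coeff \<tau> a b c d (f x)) meromorphic_on UNIV"
proof -
  have "(\<lambda>x. qpow \<tau> (u + f x)) meromorphic_on UNIV" "(\<lambda>x. qpow \<tau> (2 * f x)) meromorphic_on UNIV" "(\<lambda>x. qpow \<tau> (2 + 2 * f x)) meromorphic_on UNIV" for u
    unfolding qpow_def by (intro analytic_on_imp_meromorphic_on analytic_intros assms)+
  thus ?thesis unfolding AW_coeff_def by (intro meromorphic_intros)
qed

lemma meromorphic_on_shift: "f meromorphic_on UNIV \<Longrightarrow> (\<lambda>x. f (x + w)) meromorphic_on UNIV"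
  by (rule meromorphic_on_compose[where f = "\<lambda>x. x + w"]) (auto intro!: analytic_intros)

theorem corollary6p7:
  fixes \<tau> :: real and lam \<alpha> \<rho> \<beta> \<sigma> a b c d :: complex and H :: "complex \<Rightarrow> complex"
  assumes "- 1 / 2 < \<tau>" and "\<tau> < 0"
    and "generic_params \<tau> lam \<alpha> \<rho> \<beta> \<sigma>"
    and "a = 1 + \<rho> + \<sigma>" and "b = 1 - \<rho> + \<sigma>"
    and "c = 1 + \<alpha> + \<rho> - \<beta> - \<sigma>" and "d = 1 - \<alpha> - \<rho> - \<beta> - \<sigma>"
    and "H = (\<lambda>x. inverse (delta \<tau> a b c d x) * psi \<tau> lam \<alpha> \<rho> \<beta> \<sigma> x)"
  shows "H meromorphic_on UNIV \<and>
    (\<forall>\<^sub>\<approx>x. AW_coeff \<tau> a b c d x * (H (x + 2) - H x)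
          + AW_coeff \<tau> a b c d (- x) * (H (x - 2) - H x)
        = AW_eigenvalue \<tau> \<beta> lam * H x)"
proof
  note \<tau> = assms(2)
  have "psi \<tau> lam \<alpha> \<rho> \<beta> \<sigma> meromorphic_on UNIV"
    using psi_spec(1)[OF \<tau> assms(3)] unfolding nicely_meromorphic_on_def by (rule conjunct1)
  thus mero: "H meromorphic_on UNIV"
    unfolding assms(8) by (intro meromorphic_intros delta_meromorphic \<tau>)
  define F where "F = (\<lambda>x. AW_coeff \<tau> a b c d x * (H (x + 2) - H x)
          + AW_coeff \<tau> a b c d (- x) * (H (x - 2) - H x) - AW_eigenvalue \<tau> \<beta> lam * H x)"
  have sh: "(\<lambda>x. H (x + 2)) meromorphic_on UNIV" "(\<lambda>x. H (x - 2)) meromorphic_on UNIV"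
    using meromorphic_on_shift[OF mero, of 2] meromorphic_on_shift[OF mero, of "- 2"] by simp_all
  have "F meromorphic_on UNIV"
    unfolding F_def by (intro meromorphic_intros mero sh AW_coeff_meromorphic analytic_intros)
  \<comment> \<open>On the connected plane \<open>F\<close> vanishes off a sparse set or is nonzero
    off a sparse set. The second alternative fails at 0, where zeros of \<open>F\<close>
    accumulate.\<close>
  hence alt: "eventually (\<lambda>x. F x = 0) (cosparse UNIV) \<or> eventually (\<lambda>x. F x \<noteq> 0) (cosparse UNIV)"
    by (rule meromorphic_imp_constant_or_avoid) auto
  obtain S where S: "finite S" "\<And>x. Im x \<notin> S \<Longrightarrow> generic_arg \<tau> lam \<alpha> \<rho> \<beta> \<sigma> x"
    using assms(3) unfolding generic_params_def by blast
  define S' where "S' = S \<union> {0, Im a, Im b, - Im c, - Im d}"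
  have F0: "F x = 0" if "Im x \<notin> S'" for x
    unfolding F_def
    by (subst difference_equation_generic[OF \<tau> assms(3) S(2) assms(4-8)]) (use that in \<open>auto simp: S'_def\<close>)
  have "\<not> eventually (\<lambda>x. F x \<noteq> 0) (cosparse UNIV)"
  proof
    assume "eventually (\<lambda>x. F x \<noteq> 0) (cosparse UNIV)"
    hence "\<forall>\<^sub>F x in at 0. F x \<noteq> 0" by (simp add: eventually_cosparse_open_eq)
    moreover have "\<exists>\<^sub>F x in at 0. F x = 0"
      by (rule frequently_elim1[OF frequently_Im_notin[of S'] F0]) (simp_all add: S'_def S(1))
    ultimately show False by (simp add: frequently_def)
  qed
  with alt have "eventually (\<lambda>x. F x = 0) (cosparse UNIV)" by blast
  thus "\<forall>\<^sub>\<approx>x. AW_coeff \<tau> a b c d x * (H (x + 2) - H x)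
          + AW_coeff \<tau> a b c d (- x) * (H (x - 2) - H x) = AW_eigenvalue \<tau> \<beta> lam * H x"
    by eventually_elim (simp add: F_def)
qed

end
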